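(* Let $m,n$ be integers and let $0\le s\le\min(n,m)$. Write $h_p\otimes h_q$ for the symmetrizer on the first $p$ strands times the symmetrizer on the last $q$ strands of $\mathsf P^{\otimes(p+q)}$, and let $\tau:\mathsf P^{\otimes m}\mathsf P^{\otimes n}\to\mathsf P^{\otimes n}\mathsf P^{\otimes m}$ be the morphism crossing the first $m$ strands past the last $n$ strands. Define morphisms $\iota_s^m:\mathsf P^{(m+n-s,s)}\to\mathsf P^{(m)}\mathsf P^{(n)}$ and $\rho_m^s:\mathsf P^{(m)}\mathsf P^{(n)}\to\mathsf P^{(m+n-s,s)}$ in $\mathcal H$ by $$\iota_s^m=n\,(h_m\otimes h_n)\circ e_{(m+n-s,s)},\qquad \rho_m^s=e_{(m+n-s,s)}\circ(h_m\otimes h_n)\qquad\text{if }m\ge n,$$ $$\iota_s^m=m\,(h_m\otimes h_n)\circ\tau^{-1}\circ(h_n\otimes h_m)\circ e_{(m+n-s,s)},\qquad \rho_m^s=e_{(m+n-s,s)}\circ(h_n\otimes h_m)\circ\tau\circ(h_m\otimes h_n)\qquad\text{if }m<n.$$ These maps satisfy $\rho_m^t\circ\iota_s^m=\delta_{s,t}\,\mathsf 1_{\mathsf P^{(m+n-s,s)}}$ and $\mathsf 1_{\mathsf P^{(m)}\mathsf P^{(n)}}=\sum_{s=0}^{\min(n,m)}\iota_s^m\circ\rho_m^s$. Hence the following isomorphism holds in $\mathcal H$: $$\mathsf P^{(m)}\mathsf P^{(n)}\cong\bigoplus_{s=0}^{\min(m,n)}\mathsf P^{(m+n-s,s)}.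$$
   Context: Let $k$ be a field of characteristic zero. Khovanov's Heisenberg category: $\mathcal H'$ is the additive $k$-linear monoidal category generated by two objects $Q_+,Q_-$. Its morphisms are $k$-linear combinations of oriented planar string diagrams up to isotopy rel boundary (read bottom to top; $Q_+$ is an upward strand, $Q_-$ a downward strand), generated by the crossing of two upward strands and the four oriented cups and caps, modulo: (i) the double crossing of two upward strands is the identity; (ii) the braid relation for three upward strands; (iii) the double crossing $Q_+Q_-\to Q_-Q_+\to Q_+Q_-$ is the identity; (iv) the double crossing $Q_-Q_+\to Q_+Q_-\to Q_-Q_+$ is the identity minus the composite of the cap $Q_-Q_+\to\mathsf 1$ followed by the cup $\mathsf 1\to Q_-Q_+$; (v) a counterclockwise circle equals $1$; (vi) an upward strand with a curl on its left is zero. $\mathcal H$ is the Karoubi envelope of $\mathcal H'$. Write $\mathsf P=Q_+$, juxtaposition for $\otimes$, and $\mathsf 1_{\mathsf X}$ for the identity of $\mathsf X$. Relations (i),(ii) give an algebra map $k[S_r]\to\mathrm{End}(\mathsf P^{\otimes r})$. For $\lambda\vdash r$ let $e_\lambda\in k[S_r]$ be the Young idempotent of the row-ordered standard tableau of shape $\lambda$: $e_\lambda=\alpha_\lambda\cdot(\text{row symmetrizer})\cdot(\text{column antisymmetrizer})$ with $\alpha_\lambda$ the scalar making it idempotent (strands labelled $1,\dots,r$ from left to right); $\mathsf P^\lambda$ is its image in $\mathsf P^{\otimes r}$. $\mathsf P^{(r)}$ is the image of the complete symmetrizer $h_r$ (normalized to be idempotent). $\delta_{s,t}$ is the Kronecker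 delta.
   Formalization: The scalar n (resp. m) in the definition of ι_s^m is replaced by the binomial coefficient C(n,s) (resp. C(m,s)); with the printed scalar the claim fails, e.g. for m=n=2, s=t=0, where ρ∘ι is 2 times the identity. *)

theory Defs
  imports
    "HOL-Library.Poly_Mapping"
    "HOL-Library.Function_Algebras"
    "HOL-Combinatorics.Permutations"
begin

section \<open>Oriented planar string diagrams up to isotopy\<close>

text \<open>
  Diagrams are written as terms of the strict monoidal category generated by the upward crossing
  and the oriented cups and caps; they are read bottom to top, and \<open>d \<cdot> e\<close> puts \<open>d\<close> on top of \<open>e\<close>.
  Objects are words in \<open>Q\<^sub>+\<close> (\<open>Qp\<close>, upward strand) and \<open>Q\<^sub>-\<close> (\<open>Qm\<close>, downward strand).  In the name of
  a cup or cap the two letters give the orientations of its left and right endpoint.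
\<close>

datatype strand = Qp | Qm

type_synonym obj_word = "strand list"

datatype diagram =
    Ident obj_word
  | Cross
  | CapPM | CapMP
  | CupPM | CupMP
  | Vert diagram diagram  (infixr \<open>\<cdot>\<close> 70)
  | Horiz diagram diagram (infixr \<open>\<parallel>\<close> 75)

fun source :: "diagram \<Rightarrow> obj_word" where
  "source (Ident X) = X"
| "source Cross = [Qp, Qp]"
| "source CapPM = [Qp, Qm]"
| "source CapMP = [Qm, Qp]"
| "source CupPM = []"
| "source CupMP = []"
| "source (d \<cdot> e) = source e"
| "source (d \<parallel> e) = source d @ source e"

fun target :: "diagram \<Rightarrow> obj_word" where
  "target (Ident X) = X"
| "target Cross = [Qp, Qp]"
| "target CapPM = []"
| "target CapMP = []"
| "target CupPM = [Qp, Qm]"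
| "target CupMP = [Qm, Qp]"
| "target (d \<cdot> e) = target d"
| "target (d \<parallel> e) = target d @ target e"

fun wf_diagram :: "diagram \<Rightarrow> bool" where
  "wf_diagram (d \<cdot> e) \<longleftrightarrow> wf_diagram d \<and> wf_diagram e \<and> source d = target e"
| "wf_diagram (d \<parallel> e) \<longleftrightarrow> wf_diagram d \<and> wf_diagram e"
| "wf_diagram _ \<longleftrightarrow> True"

abbreviation up :: diagram where "up \<equiv> Ident [Qp]"
abbreviation down :: diagram where "down \<equiv> Ident [Qm]"

text \<open>
  Isotopy rel boundary is the congruence generated by the axioms of a strict monoidal category, the
  straightening of the four zigzags, and the equality of the two rotations of the crossing by
  180 degrees (that is, the strict pivotal structure).
\<close>

inductive isotopic :: "diagram \<Rightarrow> diagram \<Rightarrow> bool" (infix \<open>\<approx>\<close> 50) where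
  refl: "wf_diagram d \<Longrightarrow> d \<approx> d"
| sym: "d \<approx> e \<Longrightarrow> e \<approx> d"
| trans: "d \<approx> e \<Longrightarrow> e \<approx> f \<Longrightarrow> d \<approx> f"
| vert_cong: "d \<approx> d' \<Longrightarrow> e \<approx> e' \<Longrightarrow> source d = target e \<Longrightarrow> d \<cdot> e \<approx> d' \<cdot> e'"
| horiz_cong: "d \<approx> d' \<Longrightarrow> e \<approx> e' \<Longrightarrow> d \<parallel> e \<approx> d' \<parallel> e'"
| vert_assoc: "wf_diagram (d \<cdot> e \<cdot> f) \<Longrightarrow> (d \<cdot> e) \<cdot> f \<approx> d \<cdot> e \<cdot> f"
| vert_id_left: "wf_diagram d \<Longrightarrow> Ident (target d) \<cdot> d \<approx> d"
| vert_id_right: "wf_diagram d \<Longrightarrow> d \<cdot> Ident (source d) \<approx> d"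
| horiz_assoc: "wf_diagram (d \<parallel> e \<parallel> f) \<Longrightarrow> (d \<parallel> e) \<parallel> f \<approx> d \<parallel> e \<parallel> f"
| horiz_unit_left: "wf_diagram d \<Longrightarrow> Ident [] \<parallel> d \<approx> d"
| horiz_unit_right: "wf_diagram d \<Longrightarrow> d \<parallel> Ident [] \<approx> d"
| horiz_id: "Ident X \<parallel> Ident Y \<approx> Ident (X @ Y)"
| interchange: "wf_diagram (d \<cdot> e) \<Longrightarrow> wf_diagram (d' \<cdot> e') \<Longrightarrow>
    (d \<parallel> d') \<cdot> (e \<parallel> e') \<approx> (d \<cdot> e) \<parallel> (d' \<cdot> e')"
| zigzag_up_left: "(CapPM \<parallel> up) \<cdot> (up \<parallel> CupMP) \<approx> up"
| zigzag_up_right: "(up \<parallel> CapMP) \<cdot> (CupPM \<parallel> up) \<approx> up"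
| zigzag_down_left: "(CapMP \<parallel> down) \<cdot> (down \<parallel> CupPM) \<approx> down"
| zigzag_down_right: "(down \<parallel> CapPM) \<cdot> (CupMP \<parallel> down) \<approx> down"
| crossing_rotation:
    "CapMP \<parallel> down \<parallel> down
       \<cdot> down \<parallel> CapMP \<parallel> up \<parallel> down \<parallel> down
       \<cdot> down \<parallel> down \<parallel> Cross \<parallel> down \<parallel> down
       \<cdot> down \<parallel> down \<parallel> up \<parallel> CupPM \<parallel> down
       \<cdot> down \<parallel> down \<parallel> CupPM
     \<approx> down \<parallel> down \<parallel> CapPM
       \<cdot> down \<parallel> down \<parallel> up \<parallel> CapPM \<parallel> down
       \<cdot> down \<parallel> down \<parallel> Cross \<parallel> down \<parallel> down
       \<cdot> down \<parallel> CupMP \<parallel> up \<parallel> down \<parallel> down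
       \<cdot> CupMP \<parallel> down \<parallel> down"

lemma isotopic_typing:
  assumes "d \<approx> e"
  shows "wf_diagram d \<and> wf_diagram e \<and> source d = source e \<and> target d = target e"
  using assms by induction auto

quotient_type sdiagram = diagram / partial: isotopic
proof (rule part_equivpI)
  show "\<exists>d. d \<approx> d" using isotopic.refl[of Cross] by auto
  show "symp (\<approx>)" by (rule sympI) (rule isotopic.sym)
  show "transp (\<approx>)" by (rule transpI) (rule isotopic.trans)
qed

lift_definition ssource :: "sdiagram \<Rightarrow> obj_word" is source
  using isotopic_typing by blast

lift_definition starget :: "sdiagram \<Rightarrow> obj_word" is target
  using isotopic_typing by blast

text \<open>The value of \<open>svert\<close> on diagrams that cannot be stacked is never used.\<close>

lift_definition svert :: "sdiagram \<Rightarrow> sdiagram \<Rightarrow> sdiagram"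
  is "\<lambda>d e. if source d = target e then d \<cdot> e else Ident []"
  using isotopic_typing by (auto intro: isotopic.intros)

lift_definition shoriz :: "sdiagram \<Rightarrow> sdiagram \<Rightarrow> sdiagram" is Horiz
  by (rule isotopic.horiz_cong)


section \<open>Linear combinations of diagrams\<close>

text \<open>
  All Hom spaces are kept in one vector space; stacking is extended bilinearly, diagrams that
  cannot be stacked having product zero.
\<close>

definition bilinear_ext ::
  "(sdiagram \<Rightarrow> sdiagram \<Rightarrow> sdiagram \<Rightarrow>\<^sub>0 'k) \<Rightarrow>
   (sdiagram \<Rightarrow>\<^sub>0 'k) \<Rightarrow> (sdiagram \<Rightarrow>\<^sub>0 'k) \<Rightarrow> (sdiagram \<Rightarrow>\<^sub>0 'k::field)" where
  "bilinear_ext B x y =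
     (\<Sum>d\<in>Poly_Mapping.keys x. \<Sum>e\<in>Poly_Mapping.keys y.
        Poly_Mapping.map ((*) (Poly_Mapping.lookup x d * Poly_Mapping.lookup y e)) (B d e))"

definition lin_vert ::
  "(sdiagram \<Rightarrow>\<^sub>0 'k) \<Rightarrow> (sdiagram \<Rightarrow>\<^sub>0 'k) \<Rightarrow> (sdiagram \<Rightarrow>\<^sub>0 'k::field)" where
  "lin_vert = bilinear_ext
     (\<lambda>d e. if ssource d = starget e then Poly_Mapping.single (svert d e) 1 else 0)"

definition lin_horiz ::
  "(sdiagram \<Rightarrow>\<^sub>0 'k) \<Rightarrow> (sdiagram \<Rightarrow>\<^sub>0 'k) \<Rightarrow> (sdiagram \<Rightarrow>\<^sub>0 'k::field)" where
  "lin_horiz = bilinear_ext (\<lambda>d e. Poly_Mapping.single (shoriz d e) 1)"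

definition dia :: "diagram \<Rightarrow> (sdiagram \<Rightarrow>\<^sub>0 'k::field)" where
  "dia d = Poly_Mapping.single (abs_sdiagram d) 1"

lemma lookup_scale [simp]:
  "Poly_Mapping.lookup (Poly_Mapping.map ((*) (c::'k::field)) x) d = c * Poly_Mapping.lookup x d"
  by transfer (auto simp: when_def)

lemma bilinear_ext_superset:
  assumes "finite D" "finite E" "Poly_Mapping.keys x \<subseteq> D" "Poly_Mapping.keys y \<subseteq> E"
  shows "bilinear_ext B x y =
     (\<Sum>d\<in>D. \<Sum>e\<in>E.
        Poly_Mapping.map ((*) (Poly_Mapping.lookup x d * Poly_Mapping.lookup y e)) (B d e))"
proof -
  have scale0: "Poly_Mapping.map ((*) 0) z = 0" for z :: "sdiagram \<Rightarrow>\<^sub>0 'a"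
    by (rule poly_mapping_eqI) simp
  have "(\<Sum>e\<in>Poly_Mapping.keys y.
          Poly_Mapping.map ((*) (Poly_Mapping.lookup x d * Poly_Mapping.lookup y e)) (B d e)) =
        (\<Sum>e\<in>E. Poly_Mapping.map ((*) (Poly_Mapping.lookup x d * Poly_Mapping.lookup y e)) (B d e))"
    for d
    by (rule sum.mono_neutral_left) (use assms in \<open>auto simp: in_keys_iff scale0\<close>)
  then show ?thesis
    unfolding bilinear_ext_def
    by (simp, intro sum.mono_neutral_left) (use assms in \<open>auto simp: in_keys_iff scale0\<close>)
qed

lemma bilinear_ext_diff_left:
  "bilinear_ext B (x - x') y = bilinear_ext B x y - bilinear_ext B x' y"
proof -
  let ?D = "Poly_Mapping.keys x \<union> Poly_Mapping.keys x' \<union> Poly_Mapping.keys (x - x')"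
  have eq: "bilinear_ext B z y =
     (\<Sum>d\<in>?D. \<Sum>e\<in>Poly_Mapping.keys y.
        Poly_Mapping.map ((*) (Poly_Mapping.lookup z d * Poly_Mapping.lookup y e)) (B d e))"
    if "Poly_Mapping.keys z \<subseteq> ?D" for z
    by (rule bilinear_ext_superset) (use that in auto)
  show ?thesis
    by (subst (1 2 3) eq)
      (auto simp: sum_subtractf[symmetric] lookup_minus lookup_sum algebra_simps
        intro!: sum.cong poly_mapping_eqI)
qed

lemma bilinear_ext_diff_right:
  "bilinear_ext B x (y - y') = bilinear_ext B x y - bilinear_ext B x y'"
proof -
  let ?E = "Poly_Mapping.keys y \<union> Poly_Mapping.keys y' \<union> Poly_Mapping.keys (y - y')"
  have eq: "bilinear_ext B x z =
     (\<Sum>d\<in>Poly_Mapping.keys x. \<Sum>e\<in>?E.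
        Poly_Mapping.map ((*) (Poly_Mapping.lookup x d * Poly_Mapping.lookup z e)) (B d e))"
    if "Poly_Mapping.keys z \<subseteq> ?E" for z
    by (rule bilinear_ext_superset) (use that in auto)
  show ?thesis
    by (subst (1 2 3) eq)
      (auto simp: sum_subtractf[symmetric] lookup_minus lookup_sum algebra_simps
        intro!: sum.cong poly_mapping_eqI)
qed


section \<open>The Heisenberg relations\<close>

text \<open>The crossing rotated by 90 degrees: \<open>Q\<^sub>+Q\<^sub>- \<rightarrow> Q\<^sub>-Q\<^sub>+\<close> and \<open>Q\<^sub>-Q\<^sub>+ \<rightarrow> Q\<^sub>+Q\<^sub>-\<close>.\<close>

definition CrossPM :: diagram where
  "CrossPM = down \<parallel> up \<parallel> CapPM \<cdot> down \<parallel> Cross \<parallel> down \<cdot> CupMP \<parallel> up \<parallel> down"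

definition CrossMP :: diagram where
  "CrossMP = CapMP \<parallel> up \<parallel> down \<cdot> down \<parallel> Cross \<parallel> down \<cdot> down \<parallel> up \<parallel> CupPM"

definition left_curl :: diagram where
  "left_curl = CapMP \<parallel> up \<cdot> down \<parallel> Cross \<cdot> CupMP \<parallel> up"

definition heisenberg_relations :: "(sdiagram \<Rightarrow>\<^sub>0 'k::field) set" where
  "heisenberg_relations =
    {dia (Cross \<cdot> Cross) - dia (Ident [Qp, Qp]),
     dia (Cross \<parallel> up \<cdot> up \<parallel> Cross \<cdot> Cross \<parallel> up) - dia (up \<parallel> Cross \<cdot> Cross \<parallel> up \<cdot> up \<parallel> Cross),
     dia (CrossMP \<cdot> CrossPM) - dia (Ident [Qp, Qm]),
     dia (CrossPM \<cdot> CrossMP) - (dia (Ident [Qm, Qp]) - dia (CupMP \<cdot> CapMP)),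
     dia (CapMP \<cdot> CupMP) - dia (Ident []),
     dia left_curl}"

inductive_set tensor_ideal :: "(sdiagram \<Rightarrow>\<^sub>0 'k::field) set" where
  rel: "x \<in> heisenberg_relations \<Longrightarrow> x \<in> tensor_ideal"
| zero: "0 \<in> tensor_ideal"
| diff: "x \<in> tensor_ideal \<Longrightarrow> y \<in> tensor_ideal \<Longrightarrow> x - y \<in> tensor_ideal"
| scale: "x \<in> tensor_ideal \<Longrightarrow> Poly_Mapping.map ((*) c) x \<in> tensor_ideal"
| vert_left: "x \<in> tensor_ideal \<Longrightarrow> lin_vert y x \<in> tensor_ideal"
| vert_right: "x \<in> tensor_ideal \<Longrightarrow> lin_vert x y \<in> tensor_ideal"
| horiz_left: "x \<in> tensor_ideal \<Longrightarrow> lin_horiz y x \<in> tensor_ideal"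
| horiz_right: "x \<in> tensor_ideal \<Longrightarrow> lin_horiz x y \<in> tensor_ideal"

lemma tensor_ideal_uminus: "x \<in> tensor_ideal \<Longrightarrow> - x \<in> tensor_ideal"
  using tensor_ideal.diff[OF tensor_ideal.zero] by force

lemma tensor_ideal_add: "x \<in> tensor_ideal \<Longrightarrow> y \<in> tensor_ideal \<Longrightarrow> x + y \<in> tensor_ideal"
  using tensor_ideal.diff[OF _ tensor_ideal_uminus] by force

definition ideal_eq :: "(sdiagram \<Rightarrow>\<^sub>0 'k) \<Rightarrow> (sdiagram \<Rightarrow>\<^sub>0 'k::field) \<Rightarrow> bool" where
  "ideal_eq x y \<longleftrightarrow> x - y \<in> tensor_ideal"

quotient_type (overloaded) 'k hmor = "sdiagram \<Rightarrow>\<^sub>0 'k::field" / ideal_eq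
proof (rule equivpI)
  show "reflp ideal_eq" by (rule reflpI) (simp add: ideal_eq_def tensor_ideal.zero)
  show "symp ideal_eq"
    by (rule sympI, unfold ideal_eq_def, drule tensor_ideal_uminus) simp
  show "transp ideal_eq"
    by (rule transpI, unfold ideal_eq_def, drule (1) tensor_ideal_add) simp
qed

instantiation hmor :: (field) ab_group_add
begin

lift_definition zero_hmor :: "'a hmor" is 0 .

lift_definition plus_hmor :: "'a hmor \<Rightarrow> 'a hmor \<Rightarrow> 'a hmor" is "(+)"
  unfolding ideal_eq_def by (drule (1) tensor_ideal_add) (simp add: algebra_simps)

lift_definition minus_hmor :: "'a hmor \<Rightarrow> 'a hmor \<Rightarrow> 'a hmor" is "(-)"
  unfolding ideal_eq_def by (drule (1) tensor_ideal.diff) (simp add: algebra_simps)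

lift_definition uminus_hmor :: "'a hmor \<Rightarrow> 'a hmor" is uminus
  unfolding ideal_eq_def by (drule tensor_ideal_uminus) (simp add: algebra_simps)

instance
  by standard (transfer, simp add: ideal_eq_def tensor_ideal.zero algebra_simps)+

end

lift_definition hscale :: "'k \<Rightarrow> 'k hmor \<Rightarrow> 'k::field hmor" (infixr \<open>*\<^sub>h\<close> 75)
  is "\<lambda>c. Poly_Mapping.map ((*) c)"
proof -
  fix c :: 'k and x y :: "sdiagram \<Rightarrow>\<^sub>0 'k"
  assume "ideal_eq x y"
  moreover have "Poly_Mapping.map ((*) c) x - Poly_Mapping.map ((*) c) y = Poly_Mapping.map ((*) c) (x - y)"
    by (rule poly_mapping_eqI) (simp add: lookup_minus algebra_simps)
  ultimately show "ideal_eq (Poly_Mapping.map ((*) c) x) (Poly_Mapping.map ((*) c) y)"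
    by (simp add: ideal_eq_def tensor_ideal.scale)
qed

lift_definition hcomp :: "'k hmor \<Rightarrow> 'k hmor \<Rightarrow> 'k::field hmor" (infixr \<open>\<circ>\<^sub>h\<close> 70) is lin_vert
proof -
  fix x x' y y' :: "sdiagram \<Rightarrow>\<^sub>0 'k"
  assume "ideal_eq x x'" "ideal_eq y y'"
  then have "lin_vert (x - x') y + lin_vert x' (y - y') \<in> tensor_ideal"
    by (intro tensor_ideal_add tensor_ideal.vert_left tensor_ideal.vert_right)
      (auto simp: ideal_eq_def)
  then show "ideal_eq (lin_vert x y) (lin_vert x' y')"
    by (simp add: ideal_eq_def lin_vert_def bilinear_ext_diff_left bilinear_ext_diff_right)
qed

lift_definition htensor :: "'k hmor \<Rightarrow> 'k hmor \<Rightarrow> 'k::field hmor" (infixr \<open>\<otimes>\<^sub>h\<close> 75) is lin_horiz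
proof -
  fix x x' y y' :: "sdiagram \<Rightarrow>\<^sub>0 'k"
  assume "ideal_eq x x'" "ideal_eq y y'"
  then have "lin_horiz (x - x') y + lin_horiz x' (y - y') \<in> tensor_ideal"
    by (intro tensor_ideal_add tensor_ideal.horiz_left tensor_ideal.horiz_right)
      (auto simp: ideal_eq_def)
  then show "ideal_eq (lin_horiz x y) (lin_horiz x' y')"
    by (simp add: ideal_eq_def lin_horiz_def bilinear_ext_diff_left bilinear_ext_diff_right)
qed

lift_definition hdiagram :: "diagram \<Rightarrow> 'k::field hmor" is dia .

definition hhom :: "obj_word \<Rightarrow> obj_word \<Rightarrow> 'k::field hmor set" where
  "hhom X Y = abs_hmor ` {x. \<forall>d\<in>Poly_Mapping.keys x. ssource d = X \<and> starget d = Y}"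


section \<open>Direct sums\<close>

text \<open>
  Objects of the additive category are formal direct sums of words, given as lists.  A morphism is
  a matrix whose entry \<open>F i j\<close> goes from the \<open>j\<close>-th summand of the source to the \<open>i\<close>-th summand
  of the target; entries out of range are zero.  Composition takes the middle object as argument.
\<close>

type_synonym 'k hmatrix = "nat \<Rightarrow> nat \<Rightarrow> 'k hmor"

definition mhom :: "obj_word list \<Rightarrow> obj_word list \<Rightarrow> 'k::field hmatrix set" where
  "mhom Xs Ys =
     {F. \<forall>i j. if i < length Ys \<and> j < length Xs then F i j \<in> hhom (Xs ! j) (Ys ! i) else F i j = 0}"

definition mcomp :: "obj_word list \<Rightarrow> 'k hmatrix \<Rightarrow> 'k hmatrix \<Rightarrow> 'k::field hmatrix" where
  "mcomp Ys G F = (\<lambda>i k. \<Sum>j<length Ys. G i j \<circ>\<^sub>h F j k)"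

text \<open>A morphism between objects that are single words.\<close>

definition entry :: "'k hmor \<Rightarrow> 'k::field hmatrix" where
  "entry f = (\<lambda>i j. if i = 0 \<and> j = 0 then f else 0)"


section \<open>The Karoubi envelope\<close>

type_synonym 'k kobj = "obj_word list \<times> 'k hmatrix"

abbreviation under :: "'k::field kobj \<Rightarrow> obj_word list" where "under \<equiv> fst"
abbreviation idem :: "'k::field kobj \<Rightarrow> 'k hmatrix" where "idem \<equiv> snd"

definition is_kobj :: "'k::field kobj \<Rightarrow> bool" where
  "is_kobj A \<longleftrightarrow> idem A \<in> mhom (under A) (under A) \<and> mcomp (under A) (idem A) (idem A) = idem A"

definition khom :: "'k kobj \<Rightarrow> 'k kobj \<Rightarrow> 'k::field hmatrix set" where
  "khom A B =
     {F. is_kobj A \<and> is_kobj B \<and> F \<in> mhom (under A) (under B) \<and>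
         mcomp (under A) F (idem A) = F \<and> mcomp (under B) (idem B) F = F}"

definition kid :: "'k kobj \<Rightarrow> 'k::field hmatrix" where
  "kid A = idem A"

definition kcomp :: "'k kobj \<Rightarrow> 'k hmatrix \<Rightarrow> 'k hmatrix \<Rightarrow> 'k::field hmatrix" where
  "kcomp B G F = mcomp (under B) G F"

definition kiso :: "'k::field kobj \<Rightarrow> 'k kobj \<Rightarrow> bool" (infix \<open>\<cong>\<^sub>k\<close> 50) where
  "A \<cong>\<^sub>k B \<longleftrightarrow> (\<exists>F\<in>khom A B. \<exists>G\<in>khom B A. kcomp B G F = kid A \<and> kcomp A F G = kid B)"

text \<open>The summand \<open>X\<^sub>i \<otimes> Y\<^sub>j\<close> of a tensor product is listed at position \<open>i * n + j\<close>, \<open>n\<close> being the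
  number of summands of the second factor.\<close>

definition ktensor :: "'k kobj \<Rightarrow> 'k kobj \<Rightarrow> 'k::field kobj" (infixr \<open>\<otimes>\<^sub>k\<close> 75) where
  "A \<otimes>\<^sub>k B =
     (let n = length (under B); l = length (under A) * n in
      ([X @ Y. X \<leftarrow> under A, Y \<leftarrow> under B],
       \<lambda>i j. if i < l \<and> j < l
             then idem A (i div n) (j div n) \<otimes>\<^sub>h idem B (i mod n) (j mod n) else 0))"

definition kzero :: "'k::field kobj" where
  "kzero = ([], \<lambda>i j. 0)"

definition ksum2 :: "'k kobj \<Rightarrow> 'k kobj \<Rightarrow> 'k::field kobj" where
  "ksum2 A B =
     (let a = length (under A) in
      (under A @ under B,
       \<lambda>i j. if i < a \<and> j < a then idem A i j
             else if i \<ge> a \<and> j \<ge> a then idem B (i - a) (j - a) else 0))"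

definition ksum :: "'k kobj list \<Rightarrow> 'k::field kobj" where
  "ksum As = foldr ksum2 As kzero"


section \<open>Symmetric group algebras\<close>

text \<open>
  \<open>S\<^sub>r\<close> permutes \<open>{0..<r}\<close>, that is, strands are numbered from 0; elements of its group algebra are
  functions on permutations, of which only the values on \<open>S\<^sub>r\<close> matter.
\<close>

type_synonym 'k galg = "(nat \<Rightarrow> nat) \<Rightarrow> 'k"

definition Sym :: "nat \<Rightarrow> (nat \<Rightarrow> nat) set" where
  "Sym r = {w. w permutes {..<r}}"

definition gmult :: "nat \<Rightarrow> 'k galg \<Rightarrow> 'k galg \<Rightarrow> 'k::field galg" where
  "gmult r a b = (\<lambda>w. if w \<in> Sym r then \<Sum>u\<in>Sym r. a u * b (inv u \<circ> w) else 0)"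

text \<open>
  The row-ordered tableau is filled row by row, so these are the row and the column of the entry
  \<open>j\<close>.  Trailing zeros in \<open>\<mu>\<close> are harmless.
\<close>

definition row_of :: "nat list \<Rightarrow> nat \<Rightarrow> nat" where
  "row_of \<mu> j = (LEAST i. j < sum_list (take (Suc i) \<mu>))"

definition col_of :: "nat list \<Rightarrow> nat \<Rightarrow> nat" where
  "col_of \<mu> j = j - sum_list (take (row_of \<mu> j) \<mu>)"

definition row_symmetrizer :: "nat list \<Rightarrow> 'k::field galg" where
  "row_symmetrizer \<mu> w =
     (if w \<in> Sym (sum_list \<mu>) \<and> (\<forall>j<sum_list \<mu>. row_of \<mu> (w j) = row_of \<mu> j) then 1 else 0)"

definition column_antisymmetrizer :: "nat list \<Rightarrow> 'k::field galg" where
  "column_antisymmetrizer \<mu> w =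
     (if w \<in> Sym (sum_list \<mu>) \<and> (\<forall>j<sum_list \<mu>. col_of \<mu> (w j) = col_of \<mu> j)
      then of_int (sign w) else 0)"

definition young_symmetrizer :: "nat list \<Rightarrow> 'k::field galg" where
  "young_symmetrizer \<mu> =
     gmult (sum_list \<mu>) (row_symmetrizer \<mu>) (column_antisymmetrizer \<mu>)"

definition young_scalar :: "nat list \<Rightarrow> 'k::field" where
  "young_scalar \<mu> =
     (THE c. c \<noteq> 0 \<and>
        gmult (sum_list \<mu>) (\<lambda>w. c * young_symmetrizer \<mu> w) (\<lambda>w. c * young_symmetrizer \<mu> w) =
        (\<lambda>w. c * young_symmetrizer \<mu> w))"

definition young_idempotent :: "nat list \<Rightarrow> 'k::field galg" where
  "young_idempotent \<mu> = (\<lambda>w. young_scalar \<mu> * young_symmetrizer \<mu> w)"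

definition complete_symmetrizer :: "nat \<Rightarrow> 'k::field galg" where
  "complete_symmetrizer r = (\<lambda>w. if w \<in> Sym r then 1 / of_nat (fact r) else 0)"


section \<open>The action on powers of \<open>P\<close>\<close>

definition Ppow :: "nat \<Rightarrow> obj_word" where
  "Ppow r = replicate r Qp"

text \<open>
  The algebra map \<open>k[S\<^sub>r] \<rightarrow> End(P\<^sup>r)\<close> is evaluated on a permutation by writing the permutation as a
  product of simple transpositions; by the first two relations the choice does not matter.  A
  permutation \<open>w\<close> becomes a diagram joining position \<open>i\<close> at the bottom to position \<open>w i\<close> at the top.
\<close>

definition crossing_at :: "nat \<Rightarrow> nat \<Rightarrow> 'k::field hmor" where
  "crossing_at r i = hdiagram (Ident (Ppow i) \<parallel> Cross \<parallel> Ident (Ppow (r - (i + 2))))"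

definition perm_word :: "nat \<Rightarrow> (nat \<Rightarrow> nat) \<Rightarrow> nat list" where
  "perm_word r w =
     (SOME is. (\<forall>i\<in>set is. Suc i < r) \<and> w = foldr (\<lambda>i v. transpose i (Suc i) \<circ> v) is id)"

definition perm_mor :: "nat \<Rightarrow> (nat \<Rightarrow> nat) \<Rightarrow> 'k::field hmor" where
  "perm_mor r w =
     foldr (\<lambda>i f. crossing_at r i \<circ>\<^sub>h f) (perm_word r w) (hdiagram (Ident (Ppow r)))"

definition galg_mor :: "nat \<Rightarrow> 'k galg \<Rightarrow> 'k::field hmor" where
  "galg_mor r a = (\<Sum>w\<in>Sym r. a w *\<^sub>h perm_mor r w)"

definition e_mor :: "nat list \<Rightarrow> 'k::field hmor" where
  "e_mor \<mu> = galg_mor (sum_list \<mu>) (young_idempotent \<mu>)"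

definition h_mor :: "nat \<Rightarrow> 'k::field hmor" where
  "h_mor r = galg_mor r (complete_symmetrizer r)"

definition P_part :: "nat list \<Rightarrow> 'k::field kobj" where
  "P_part \<mu> = ([Ppow (sum_list \<mu>)], entry (e_mor \<mu>))"

definition P_sym :: "nat \<Rightarrow> 'k::field kobj" where
  "P_sym r = ([Ppow r], entry (h_mor r))"


section \<open>The maps \<open>\<iota>\<close> and \<open>\<rho>\<close>\<close>

definition block_perm :: "nat \<Rightarrow> nat \<Rightarrow> nat \<Rightarrow> nat" where
  "block_perm m n i = (if i < m then i + n else if i < m + n then i - m else i)"

definition tau :: "nat \<Rightarrow> nat \<Rightarrow> 'k::field hmor" where
  "tau m n = perm_mor (m + n) (block_perm m n)"

definition tau_inv :: "nat \<Rightarrow> nat \<Rightarrow> 'k::field hmor" where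
  "tau_inv m n = perm_mor (m + n) (inv (block_perm m n))"

text \<open>
  The scalar is the binomial coefficient \<open>n choose s\<close> (\<open>m choose s\<close> if \<open>m < n\<close>), a correction of the
  bare \<open>n\<close> (\<open>m\<close>) printed in the source.  With the bare integer \<open>\<rho> \<circ> \<iota> = 1\<close> fails already for
  \<open>s = 0\<close>, where the Young idempotent is the complete symmetrizer and absorbs \<open>h\<^sub>m \<otimes> h\<^sub>n\<close>, so that
  \<open>\<rho> \<circ> \<iota>\<close> is the scalar times the identity.  The two agree if \<open>min m n = 1\<close>.
\<close>

definition iota :: "nat \<Rightarrow> nat \<Rightarrow> nat \<Rightarrow> 'k::field hmatrix" where
  "iota m n s = entry
     (if m \<ge> n
      then of_nat (n choose s) *\<^sub>h ((h_mor m \<otimes>\<^sub>h h_mor n) \<circ>\<^sub>h e_mor [m + n - s, s])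
      else of_nat (m choose s) *\<^sub>h
        ((h_mor m \<otimes>\<^sub>h h_mor n) \<circ>\<^sub>h tau_inv m n \<circ>\<^sub>h (h_mor n \<otimes>\<^sub>h h_mor m) \<circ>\<^sub>h e_mor [m + n - s, s]))"

definition rho :: "nat \<Rightarrow> nat \<Rightarrow> nat \<Rightarrow> 'k::field hmatrix" where
  "rho m n s = entry
     (if m \<ge> n
      then e_mor [m + n - s, s] \<circ>\<^sub>h (h_mor m \<otimes>\<^sub>h h_mor n)
      else e_mor [m + n - s, s] \<circ>\<^sub>h (h_mor n \<otimes>\<^sub>h h_mor m) \<circ>\<^sub>h tau m n \<circ>\<^sub>h (h_mor m \<otimes>\<^sub>h h_mor n))"

end

theory Submission
  imports Defs "HOL.Vector_Spaces"
begin

text \<open>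
  Far commutation of crossings is isotopy, and the first two relations supply the others of
  Coxeter's relations; hence \<open>k[S\<^sub>r]\<close> acts on \<open>P\<^sup>r\<close> and everything takes place in \<open>A = k[S\<^bsub>m+n\<^esub>]\<close>.
  Write \<open>e\<^sub>s\<close> for the Young idempotent of \<open>(m+n-s,s)\<close>, a multiple of \<open>R C\<close> with \<open>R\<close> the row and \<open>C\<close>
  the column (anti)symmetrizer, and \<open>h\<close> for \<open>h\<^sub>m \<otimes> h\<^sub>n\<close>, where \<open>m \<ge> n\<close> (the other case is conjugate by
  \<open>\<tau>\<close>).  For \<open>w \<in> S\<^bsub>m+n\<^esub>\<close> the product \<open>C w R\<close> vanishes unless \<open>w\<close> maps the second row to a
  transversal of the columns of length two, and then it is \<open>\<plusminus> C R\<close>.  For \<open>w \<in> S\<^sub>m \<times> S\<^sub>n\<close> this happens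
  only if \<open>w\<close> preserves the second row, which has probability \<open>1 / (n choose s)\<close>; hence
  \<open>e\<^sub>s h e\<^sub>s = e\<^sub>s / (n choose s)\<close>, while \<open>e\<^sub>s A e\<^sub>t = 0\<close> for \<open>s \<noteq> t\<close> by the pigeonhole principle.  So
  the elements \<open>(n choose s) h e\<^sub>s h\<close> are \<open>n + 1\<close> nonzero orthogonal idempotents of \<open>h A h\<close>.  That algebra
  has at most \<open>n + 1\<close> double cosets as generators, so they span it and their sum is its unit \<open>h\<close>.
\<close>

section \<open>Bilinearity in the Heisenberg category\<close>

text \<open>Two circumstances shape the work outside the algebra. \<open>perm_mor\<close> evaluates
  a permutation on an arbitrarily chosen word, so even multiplicativity needs the full presentation
  theorem: the Coxeter relations connect any two words of the same permutation. It is proved by a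
  normal form along the chain of groups S_r < S_{r+1}. Moreover nothing is known here about
  injectivity of k[S_r] -> End(P^r). Every identity is therefore proved in the group algebra and
  only pushed forward; this suffices because the claims about morphisms are equations. The arguments
  that need something to be nonzero stay in the group algebra. The scalar making R C idempotent is
  never evaluated. It is enough that R C R C = N R C where N counts a nonempty set, and this holds
  because all surviving terms carry the same sign. Characteristic zero enters through N, through the
  factorials and through the step from x = -x to x = 0.\<close>

lemma sum_fun_apply: "(\<Sum>s\<in>S. f s) x = (\<Sum>s\<in>S. f s x)"
  by (induction S rule: infinite_finite_induct) auto

lemma bilinear_ext_scale_left:
  "bilinear_ext B (Poly_Mapping.map ((*) c) x) y = Poly_Mapping.map ((*) c) (bilinear_ext B x y)"
proof -
  \<comment> \<open>For \<open>c = 0\<close> the keys shrink; both sides are therefore expanded over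
    the keys of \<open>x\<close> and \<open>y\<close>.\<close>
  have "Poly_Mapping.keys (Poly_Mapping.map ((*) c) x) \<subseteq> Poly_Mapping.keys x"
    by (auto simp: in_keys_iff)
  then show ?thesis
    by (subst (1 2) bilinear_ext_superset[of "Poly_Mapping.keys x" "Poly_Mapping.keys y"])
      (auto intro!: poly_mapping_eqI simp: lookup_sum sum_distrib_left mult.assoc)
qed

lemma bilinear_ext_scale_right:
  "bilinear_ext B x (Poly_Mapping.map ((*) c) y) = Poly_Mapping.map ((*) c) (bilinear_ext B x y)"
proof -
  have "Poly_Mapping.keys (Poly_Mapping.map ((*) c) y) \<subseteq> Poly_Mapping.keys y"
    by (auto simp: in_keys_iff)
  then show ?thesis
    by (subst (1 2) bilinear_ext_superset[of "Poly_Mapping.keys x" "Poly_Mapping.keys y"])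
      (auto intro!: poly_mapping_eqI simp: lookup_sum sum_distrib_left algebra_simps)
qed

lemma bilinear_ext_single:
  "bilinear_ext B (Poly_Mapping.single d 1) (Poly_Mapping.single e 1) = B d e"
  by (subst bilinear_ext_superset[of "{d}" "{e}"]) (auto intro!: poly_mapping_eqI)

lemma ideal_eq_refl [simp]: "ideal_eq x x"
  by (simp add: ideal_eq_def tensor_ideal.zero)

lemma hcomp_diff_left: "(x - y) \<circ>\<^sub>h z = x \<circ>\<^sub>h z - y \<circ>\<^sub>h z"
  by transfer (simp add: lin_vert_def bilinear_ext_diff_left)

lemma hcomp_diff_right: "z \<circ>\<^sub>h (x - y) = z \<circ>\<^sub>h x - z \<circ>\<^sub>h y"
  by transfer (simp add: lin_vert_def bilinear_ext_diff_right)

lemma htensor_diff_left: "(x - y) \<otimes>\<^sub>h z = x \<otimes>\<^sub>h z - y \<otimes>\<^sub>h z"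
  by transfer (simp add: lin_horiz_def bilinear_ext_diff_left)

lemma htensor_diff_right: "z \<otimes>\<^sub>h (x - y) = z \<otimes>\<^sub>h x - z \<otimes>\<^sub>h y"
  by transfer (simp add: lin_horiz_def bilinear_ext_diff_right)

lemma hscale_diff_right: "c *\<^sub>h (x - y) = c *\<^sub>h x - c *\<^sub>h y"
  \<comment> \<open>The two sides agree already before passing to the quotient, so
    \<open>ideal_eq\<close> reduces to reflexivity.\<close>
  by transfer (auto intro!: arg_cong2[of _ _ _ _ ideal_eq, THEN iffD2, OF _ _ ideal_eq_refl]
      poly_mapping_eqI simp: lookup_minus algebra_simps)

text \<open>The definitions come with compatibility with subtraction only. Taking both arguments
  zero gives \<open>f 0 = 0\<close>, and adding is subtracting a negative; the locale
  \<open>additive\<close> then yields the rules for sums and zero below.\<close>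

lemma additive_if_diff:
  fixes f :: "'a::ab_group_add \<Rightarrow> 'b::ab_group_add"
  assumes "\<And>x y. f (x - y) = f x - f y"
  shows "additive f"
proof
  fix x y
  have "f (0 - y) = - f y" using assms[of 0 0] assms[of 0 y] by simp
  then show "f (x + y) = f x + f y" using assms[of x "0 - y"] by simp
qed

lemmas hcomp_sum_left = additive.sum[OF additive_if_diff, OF hcomp_diff_left]
lemmas hcomp_sum_right = additive.sum[OF additive_if_diff, OF hcomp_diff_right]
lemmas htensor_sum_left = additive.sum[OF additive_if_diff, OF htensor_diff_left]
lemmas htensor_sum_right = additive.sum[OF additive_if_diff, OF htensor_diff_right]
lemmas hscale_sum_right = additive.sum[OF additive_if_diff, OF hscale_diff_right]
lemmas hcomp_zero_left [simp] = additive.zero[OF additive_if_diff, OF hcomp_diff_left]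
lemmas hcomp_zero_right [simp] = additive.zero[OF additive_if_diff, OF hcomp_diff_right]

lemma hscale_add_left: "(c + d) *\<^sub>h x = c *\<^sub>h x + d *\<^sub>h x"
  by transfer (auto intro!: arg_cong2[of _ _ _ _ ideal_eq, THEN iffD2, OF _ _ ideal_eq_refl]
      poly_mapping_eqI simp: lookup_add algebra_simps)

lemma hscale_hscale: "c *\<^sub>h d *\<^sub>h x = (c * d) *\<^sub>h x"
  by transfer (auto intro!: arg_cong2[of _ _ _ _ ideal_eq, THEN iffD2, OF _ _ ideal_eq_refl]
      poly_mapping_eqI simp: algebra_simps)

lemma hscale_one [simp]: "1 *\<^sub>h x = x"
  by transfer (auto intro!: arg_cong2[of _ _ _ _ ideal_eq, THEN iffD2, OF _ _ ideal_eq_refl]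
      poly_mapping_eqI)

lemma hscale_zero_left [simp]: "0 *\<^sub>h x = 0"
  using hscale_add_left[of 0 0 x] by simp

lemma hscale_sum_left: "(\<Sum>i\<in>I. c i) *\<^sub>h x = (\<Sum>i\<in>I. c i *\<^sub>h x)"
  by (induction I rule: infinite_finite_induct) (auto simp: hscale_add_left)

lemma hcomp_hscale_left: "(c *\<^sub>h x) \<circ>\<^sub>h y = c *\<^sub>h (x \<circ>\<^sub>h y)"
  by transfer (simp add: lin_vert_def bilinear_ext_scale_left)

lemma hcomp_hscale_right: "x \<circ>\<^sub>h (c *\<^sub>h y) = c *\<^sub>h (x \<circ>\<^sub>h y)"
  by transfer (simp add: lin_vert_def bilinear_ext_scale_right)

lemma htensor_hscale_left: "(c *\<^sub>h x) \<otimes>\<^sub>h y = c *\<^sub>h (x \<otimes>\<^sub>h y)"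
  by transfer (simp add: lin_horiz_def bilinear_ext_scale_left)

lemma htensor_hscale_right: "x \<otimes>\<^sub>h (c *\<^sub>h y) = c *\<^sub>h (x \<otimes>\<^sub>h y)"
  by transfer (simp add: lin_horiz_def bilinear_ext_scale_right)

text \<open>\<open>sdiagram\<close> is a partial quotient in which exactly the well-formed terms are
  related to themselves; hence the premises.\<close>

lemma abs_sdiagram_eq_iff:
  "wf_diagram d \<Longrightarrow> wf_diagram e \<Longrightarrow> abs_sdiagram d = abs_sdiagram e \<longleftrightarrow> d \<approx> e"
  using Quotient3_rel[OF Quotient3_sdiagram, of d e] isotopic.refl by auto

lemma hdiagram_isotopic: "d \<approx> e \<Longrightarrow> hdiagram d = hdiagram e"
  using isotopic_typing[of d e] abs_sdiagram_eq_iff[of d e]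
  by transfer (simp add: dia_def)

lemma hdiagram_vert:
  assumes "wf_diagram d" "wf_diagram e" "source d = target e"
  shows "hdiagram d \<circ>\<^sub>h hdiagram e = (hdiagram (d \<cdot> e) :: 'k::field hmor)"
proof -
  have *: "d \<approx> d" "e \<approx> e" using assms isotopic.refl by auto
  have "lin_vert (dia d) (dia e) = (dia (d \<cdot> e) :: _ \<Rightarrow>\<^sub>0 'k::field)"
    using assms * unfolding lin_vert_def dia_def bilinear_ext_single
    by (simp add: ssource.abs_eq starget.abs_eq svert.abs_eq eq_onp_def)
  then show ?thesis by (simp add: hdiagram.abs_eq hcomp.abs_eq)
qed

lemma hdiagram_horiz:
  assumes "wf_diagram d" "wf_diagram e"
  shows "hdiagram d \<otimes>\<^sub>h hdiagram e = (hdiagram (d \<parallel> e) :: 'k::field hmor)"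
proof -
  have *: "d \<approx> d" "e \<approx> e" using assms isotopic.refl by auto
  have "lin_horiz (dia d) (dia e) = (dia (d \<parallel> e) :: _ \<Rightarrow>\<^sub>0 'k::field)"
    using assms * unfolding lin_horiz_def dia_def bilinear_ext_single
    by (simp add: shoriz.abs_eq)
  then show ?thesis by (simp add: hdiagram.abs_eq htensor.abs_eq)
qed

lemma hdiagram_eqI:
  assumes "dia d - dia e \<in> (tensor_ideal :: (_ \<Rightarrow>\<^sub>0 'k::field) set)"
  shows "hdiagram d = (hdiagram e :: 'k hmor)"
  using assms by (simp add: hdiagram.abs_eq hmor.abs_eq_iff ideal_eq_def)

section \<open>Hom spaces and linear combinations\<close>

lemma hdiagram_in_hhom:
  "wf_diagram d \<Longrightarrow> hdiagram d \<in> hhom (source d) (target d)"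
  unfolding hhom_def hdiagram.abs_eq dia_def
  by (intro imageI) (auto simp: ssource.abs_eq starget.abs_eq isotopic.refl)

lemma hhom_zero: "0 \<in> hhom X Y"
  unfolding hhom_def zero_hmor.abs_eq by (intro imageI) auto

lemma hhom_add: "x \<in> hhom X Y \<Longrightarrow> y \<in> hhom X Y \<Longrightarrow> x + y \<in> hhom X Y"
proof -
  assume "x \<in> hhom X Y" "y \<in> hhom X Y"
  then obtain a b where "x = abs_hmor a" "y = abs_hmor b"
    "\<forall>d\<in>Poly_Mapping.keys a. ssource d = X \<and> starget d = Y"
    "\<forall>d\<in>Poly_Mapping.keys b. ssource d = X \<and> starget d = Y"
    unfolding hhom_def by auto
  then show ?thesis unfolding hhom_def
    using keys_add[of a b] by (auto simp: plus_hmor.abs_eq intro!: imageI)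
qed

lemma hhom_hscale: "x \<in> hhom X Y \<Longrightarrow> c *\<^sub>h x \<in> hhom X Y"
proof -
  assume "x \<in> hhom X Y"
  then obtain a where "x = abs_hmor a"
    "\<forall>d\<in>Poly_Mapping.keys a. ssource d = X \<and> starget d = Y"
    unfolding hhom_def by auto
  then show ?thesis unfolding hhom_def
    by (auto simp: hscale.abs_eq in_keys_iff intro!: imageI)
qed

lemma hhom_sum: "(\<And>i. i \<in> I \<Longrightarrow> f i \<in> hhom X Y) \<Longrightarrow> (\<Sum>i\<in>I. f i) \<in> hhom X Y"
  by (induction I rule: infinite_finite_induct) (auto intro: hhom_zero hhom_add)


section \<open>Crossings and the Coxeter relations\<close>

abbreviation layer :: "obj_word \<Rightarrow> diagram \<Rightarrow> obj_word \<Rightarrow> diagram" where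
  "layer X d Y \<equiv> Ident X \<parallel> d \<parallel> Ident Y"

declare isotopic.trans [trans]

lemma layer_cong: "d \<approx> e \<Longrightarrow> layer X d Y \<approx> layer X e Y"
  by (intro isotopic.horiz_cong isotopic.refl) auto

text \<open>Strictness holds only up to \<open>\<approx>\<close>, since terms keep their bracketing.
  Merging the identity strands on either side allows a crossing to be viewed inside any window of
  strands.\<close>

lemma layer_layer:
  assumes "wf_diagram d"
  shows "layer X (layer Y d Z) W \<approx> layer (X @ Y) d (Z @ W)"
proof -
  have "layer X (layer Y d Z) W \<approx> (Ident X \<parallel> Ident Y \<parallel> d \<parallel> Ident Z) \<parallel> Ident W"
    by (rule isotopic.sym, rule isotopic.horiz_assoc) (use assms in auto)
  also have "\<dots> \<approx> ((Ident X \<parallel> Ident Y) \<parallel> d \<parallel> Ident Z) \<parallel> Ident W"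
    by (rule isotopic.horiz_cong, rule isotopic.sym, rule isotopic.horiz_assoc)
      (use assms in \<open>auto intro: isotopic.refl\<close>)
  also have "\<dots> \<approx> (Ident (X @ Y) \<parallel> d \<parallel> Ident Z) \<parallel> Ident W"
    by (intro isotopic.horiz_cong isotopic.horiz_id isotopic.refl) (use assms in auto)
  also have "\<dots> \<approx> Ident (X @ Y) \<parallel> (d \<parallel> Ident Z) \<parallel> Ident W"
    by (rule isotopic.horiz_assoc) (use assms in auto)
  also have "\<dots> \<approx> Ident (X @ Y) \<parallel> d \<parallel> Ident Z \<parallel> Ident W"
    by (rule isotopic.horiz_cong, rule isotopic.refl, simp, rule isotopic.horiz_assoc)
      (use assms in auto)
  also have "\<dots> \<approx> layer (X @ Y) d (Z @ W)"
    by (intro isotopic.horiz_cong isotopic.horiz_id isotopic.refl) (use assms in auto)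
  finally show ?thesis .
qed

lemma layer_Nil_left: "wf_diagram d \<Longrightarrow> layer [] d Y \<approx> d \<parallel> Ident Y"
  by (rule isotopic.horiz_unit_left) simp

lemma layer_Nil_right: "wf_diagram d \<Longrightarrow> layer X d [] \<approx> Ident X \<parallel> d"
  by (intro isotopic.horiz_cong isotopic.horiz_unit_right isotopic.refl) auto

lemma layer_Ident: "layer X (Ident Y) Z \<approx> Ident (X @ Y @ Z)"
  by (rule isotopic.trans[OF isotopic.horiz_cong[OF isotopic.refl isotopic.horiz_id]])
    (auto intro: isotopic.horiz_id)

lemma Ident_vert: "Ident X \<cdot> Ident X \<approx> Ident X"
  using isotopic.vert_id_left[of "Ident X"] by simp

lemma layer_vert:
  assumes "wf_diagram (d \<cdot> e)"
  shows "layer X d Y \<cdot> layer X e Y \<approx> layer X (d \<cdot> e) Y"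
proof -
  have "layer X d Y \<cdot> layer X e Y \<approx> (Ident X \<cdot> Ident X) \<parallel> ((d \<parallel> Ident Y) \<cdot> (e \<parallel> Ident Y))"
    by (rule isotopic.interchange) (use assms in auto)
  also have "\<dots> \<approx> Ident X \<parallel> ((d \<cdot> e) \<parallel> (Ident Y \<cdot> Ident Y))"
    by (intro isotopic.horiz_cong Ident_vert isotopic.interchange) (use assms in auto)
  also have "\<dots> \<approx> layer X (d \<cdot> e) Y"
    by (intro isotopic.horiz_cong Ident_vert isotopic.refl) (use assms in auto)
  finally show ?thesis .
qed

lemma hdiagram_layer:
  assumes "wf_diagram d"
  shows "hdiagram (layer X d Y) = hdiagram (Ident X) \<otimes>\<^sub>h hdiagram d \<otimes>\<^sub>h hdiagram (Ident Y)"
  using assms by (simp add: hdiagram_horiz)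

text \<open>This and \<open>exchange_right\<close> are the two relative heights at which
  side-by-side diagrams can be drawn; together they let disjoint diagrams slide past each
  other.\<close>

lemma exchange_left:
  assumes "wf_diagram d" "wf_diagram e"
  shows "(d \<parallel> Ident (target e)) \<cdot> (Ident (source d) \<parallel> e) \<approx> d \<parallel> e"
  by (rule isotopic.trans[OF isotopic.interchange])
    (use assms in \<open>auto intro: isotopic.horiz_cong isotopic.vert_id_left isotopic.vert_id_right\<close>)

lemma exchange_right:
  assumes "wf_diagram d" "wf_diagram e"
  shows "(Ident (target d) \<parallel> e) \<cdot> (d \<parallel> Ident (source e)) \<approx> d \<parallel> e"
  by (rule isotopic.trans[OF isotopic.interchange])
    (use assms in \<open>auto intro: isotopic.horiz_cong isotopic.vert_id_left isotopic.vert_id_right\<close>)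

lemma Ppow_simps:
  "Ppow i @ Ppow j = Ppow (i + j)" "Qp # Ppow i = Ppow (Suc i)" "[Qp] = Ppow (Suc 0)" "Ppow 0 = []"
  by (simp_all add: Ppow_def replicate_add)

abbreviation cross_dia :: "nat \<Rightarrow> nat \<Rightarrow> diagram" where
  "cross_dia r i \<equiv> layer (Ppow i) Cross (Ppow (r - (i + 2)))"

lemma cross_dia_typing:
  assumes "Suc i < r"
  shows "source (cross_dia r i) = Ppow r" "target (cross_dia r i) = Ppow r"
proof -
  obtain l where "r = Suc (Suc (i + l))" using less_imp_Suc_add[OF assms] by auto
  then show "source (cross_dia r i) = Ppow r" "target (cross_dia r i) = Ppow r"
    by (simp_all add: Ppow_simps)
qed

lemma cross_dia_layer:
  "layer (Ppow j) (cross_dia r i) (Ppow l) \<approx> layer (Ppow (j + i)) Cross (Ppow (r - (i + 2) + l))"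
  using layer_layer[of Cross "Ppow j" "Ppow i" "Ppow (r - (i + 2))" "Ppow l"]
  by (simp add: Ppow_simps)

text \<open>The fold of \<open>perm_mor\<close> carried out on diagrams, where isotopies can be
  applied before passing to morphisms.\<close>

definition crossing_word :: "nat \<Rightarrow> nat list \<Rightarrow> diagram" where
  "crossing_word r xs = foldr (\<lambda>i d. cross_dia r i \<cdot> d) xs (Ident (Ppow r))"

abbreviation valid_word :: "nat \<Rightarrow> nat list \<Rightarrow> bool" where
  "valid_word r xs \<equiv> (\<forall>i\<in>set xs. Suc i < r)"

lemma crossing_word_simps [simp]:
  "crossing_word r [] = Ident (Ppow r)"
  "crossing_word r (i # xs) = cross_dia r i \<cdot> crossing_word r xs"
  by (simp_all add: crossing_word_def)

lemma crossing_word_typing: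
  assumes "valid_word r xs"
  shows "wf_diagram (crossing_word r xs)" "source (crossing_word r xs) = Ppow r"
    "target (crossing_word r xs) = Ppow r"
proof -
  have "wf_diagram (crossing_word r xs) \<and> source (crossing_word r xs) = Ppow r
    \<and> target (crossing_word r xs) = Ppow r"
    using assms
  proof (induction xs)
    case (Cons i xs)
    then show ?case using cross_dia_typing[of i r]
      by (cases xs) (simp_all del: source.simps target.simps add: source.simps(7) target.simps(7))
  qed simp
  then show "wf_diagram (crossing_word r xs)" "source (crossing_word r xs) = Ppow r"
    "target (crossing_word r xs) = Ppow r" by auto
qed

lemma crossing_word_append:
  assumes "valid_word r xs" "valid_word r js"
  shows "crossing_word r (xs @ js) \<approx> crossing_word r xs \<cdot> crossing_word r js"
  using assms(1)
proof (induction xs)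
  case Nil
  show ?case
    using isotopic.vert_id_left[OF crossing_word_typing(1)[OF assms(2)], THEN isotopic.sym]
    by (simp add: crossing_word_typing[OF assms(2)])
next
  case (Cons i xs)
  have v: "valid_word r (xs @ js)" using Cons.prems assms by auto
  have "crossing_word r ((i # xs) @ js) = cross_dia r i \<cdot> crossing_word r (xs @ js)" by simp
  also have "\<dots> \<approx> cross_dia r i \<cdot> crossing_word r xs \<cdot> crossing_word r js"
    by (rule isotopic.vert_cong)
      (use Cons assms cross_dia_typing[of i r] crossing_word_typing(3)[OF v] in
        \<open>auto intro: isotopic.refl simp: crossing_word_typing simp del: source.simps target.simps\<close>)
  also have "\<dots> \<approx> (cross_dia r i \<cdot> crossing_word r xs) \<cdot> crossing_word r js"
    by (rule isotopic.sym, rule isotopic.vert_assoc)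
      (use Cons assms cross_dia_typing[of i r] in
        \<open>auto simp: crossing_word_typing simp del: source.simps(8) target.simps(8)\<close>)
  finally show ?case by simp
qed

lemma crossing_word_singleton:
  assumes "Suc i < r"
  shows "crossing_word r [i] \<approx> cross_dia r i"
  using isotopic.vert_id_right[of "cross_dia r i"] cross_dia_typing[OF assms] by simp

lemma hdiagram_crossing_word:
  assumes "valid_word r xs"
  shows "hdiagram (crossing_word r xs) =
    foldr (\<lambda>i f. crossing_at r i \<circ>\<^sub>h f) xs (hdiagram (Ident (Ppow r)))"
  using assms
proof (induction xs)
  case (Cons i xs)
  then show ?case
    using cross_dia_typing[of i r]
    by (simp add: crossing_at_def crossing_word_typing hdiagram_vert[symmetric]
        del: source.simps(8) target.simps(8))
qed simp

lemma crossing_word_pair: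
  assumes "Suc i < r" "Suc j < r"
  shows "crossing_word r [i, j] \<approx> cross_dia r i \<cdot> cross_dia r j"
  using assms cross_dia_typing[OF assms(1)] cross_dia_typing[OF assms(2)]
    crossing_word_singleton[OF assms(2)] crossing_word_typing(3)[of "[j]" r]
  by (auto intro!: isotopic.vert_cong isotopic.refl simp del: source.simps(8) target.simps(8))

lemma hdiagram_crossing_square:
  assumes "Suc i < r"
  shows "hdiagram (crossing_word r [i, i]) = (hdiagram (crossing_word r []) :: 'k::field hmor)"
proof -
  have rel: "hdiagram (Cross \<cdot> Cross) = (hdiagram (Ident [Qp, Qp]) :: 'k hmor)"
    by (intro hdiagram_eqI tensor_ideal.rel) (simp add: heisenberg_relations_def)
  have "crossing_word r [i, i] \<approx> layer (Ppow i) (Cross \<cdot> Cross) (Ppow (r - (i + 2)))"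
    using crossing_word_pair[OF assms assms] by (rule isotopic.trans) (simp add: layer_vert)
  then have "hdiagram (crossing_word r [i, i]) =
      (hdiagram (layer (Ppow i) (Ident [Qp, Qp]) (Ppow (r - (i + 2)))) :: 'k hmor)"
    using rel by (simp add: hdiagram_isotopic hdiagram_layer del: crossing_word_simps)
  also have "\<dots> = hdiagram (crossing_word r [])"
    using hdiagram_isotopic[OF layer_Ident[of "Ppow i" "[Qp, Qp]" "Ppow (r - (i + 2))"],
        where ?'a = 'k] cross_dia_typing(1)[OF assms]
    by simp
  finally show ?thesis .
qed

lemma hdiagram_crossing_comm:
  assumes "Suc i < j" "Suc j < r"
  shows "hdiagram (crossing_word r [i, j]) = (hdiagram (crossing_word r [j, i]) :: 'k::field hmor)"
proof -
  \<comment> \<open>\<open>l\<close> strands lie between the two crossings, so that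
    \<open>?d\<close> and \<open>?e\<close> below occupy disjoint strands; \<open>?Y\<close> is what
    remains to the right of both.\<close>
  define l where "l = j - i - 2"
  have j: "j = i + (2 + l)" using assms by (simp add: l_def)
  let ?d = "Cross" and ?e = "Ident (Ppow l) \<parallel> Cross"
  let ?X = "Ppow i" and ?Y = "Ppow (r - (i + (l + 4)))"
  have Y: "Suc (Suc (r - (i + 4))) = r - Suc (Suc i)" using assms by simp
  have Y': "r - Suc (Suc (Suc (Suc (i + l)))) = r - (i + (l + 4))" by (simp add: numeral_eq_Suc)
  have di: "layer [] Cross (Ppow (l + 2)) \<approx> Cross \<parallel> Ident (target ?e)"
    using layer_Nil_left[of Cross "Ppow (l + 2)"] by (simp add: Ppow_simps)
  have ej: "layer (Ppow (2 + l)) Cross [] \<approx> Ident (source ?d) \<parallel> ?e"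
  proof -
    have "layer (Ppow (2 + l)) Cross [] \<approx> Ident (Ppow (2 + l)) \<parallel> Cross"
      by (rule layer_Nil_right) simp
    also have "\<dots> \<approx> (Ident (Ppow 2) \<parallel> Ident (Ppow l)) \<parallel> Cross"
      using isotopic.horiz_cong[OF isotopic.horiz_id[THEN isotopic.sym] isotopic.refl[of Cross],
          of "Ppow 2" "Ppow l"] by (simp add: Ppow_simps)
    also have "\<dots> \<approx> Ident (source ?d) \<parallel> ?e"
      using isotopic.horiz_assoc[of "Ident (Ppow 2)" "Ident (Ppow l)" Cross]
      by (simp add: Ppow_simps eval_nat_numeral)
    finally show ?thesis .
  qed
  have ci: "cross_dia r i \<approx> layer ?X (Cross \<parallel> Ident (target ?e)) ?Y"
  proof -
    have "cross_dia r i \<approx> layer ?X (layer [] Cross (Ppow (l + 2))) ?Y"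
      using layer_layer[of Cross ?X "[]" "Ppow (l + 2)" ?Y, THEN isotopic.sym] assms
      by (simp add: Ppow_simps j Y)
    also have "\<dots> \<approx> layer ?X (Cross \<parallel> Ident (target ?e)) ?Y" using di by (rule layer_cong)
    finally show ?thesis .
  qed
  have cj: "cross_dia r j \<approx> layer ?X (Ident (source ?d) \<parallel> ?e) ?Y"
  proof -
    have "cross_dia r j \<approx> layer ?X (layer (Ppow (2 + l)) Cross []) ?Y"
      using layer_layer[of Cross ?X "Ppow (2 + l)" "[]" ?Y, THEN isotopic.sym] assms
      by (simp add: Ppow_simps j Y')
    also have "\<dots> \<approx> layer ?X (Ident (source ?d) \<parallel> ?e) ?Y" using ej by (rule layer_cong)
    finally show ?thesis .
  qed
  have r: "Suc i < r" using assms by simp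
  have "crossing_word r [i, j] \<approx> cross_dia r i \<cdot> cross_dia r j"
    using crossing_word_pair[OF r assms(2)] .
  also have "\<dots> \<approx> layer ?X (Cross \<parallel> Ident (target ?e)) ?Y \<cdot> layer ?X (Ident (source ?d) \<parallel> ?e) ?Y"
    by (rule isotopic.vert_cong[OF ci cj])
      (simp only: cross_dia_typing[OF r] cross_dia_typing[OF assms(2)])
  also have "\<dots> \<approx> layer ?X ((Cross \<parallel> Ident (target ?e)) \<cdot> (Ident (source ?d) \<parallel> ?e)) ?Y"
    by (rule layer_vert) simp
  also have "\<dots> \<approx> layer ?X (?d \<parallel> ?e) ?Y" by (intro layer_cong exchange_left) auto
  also have "\<dots> \<approx> layer ?X ((Ident (target ?d) \<parallel> ?e) \<cdot> (?d \<parallel> Ident (source ?e))) ?Y"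
    by (intro layer_cong isotopic.sym[OF exchange_right]) auto
  also have "\<dots> \<approx> layer ?X (Ident (source ?d) \<parallel> ?e) ?Y \<cdot> layer ?X (Cross \<parallel> Ident (target ?e)) ?Y"
    using layer_vert[of "Ident (target ?d) \<parallel> ?e" "?d \<parallel> Ident (source ?e)", THEN isotopic.sym] by simp
  also have "\<dots> \<approx> cross_dia r j \<cdot> cross_dia r i"
    by (rule isotopic.sym, rule isotopic.vert_cong[OF cj ci])
      (simp only: cross_dia_typing[OF r] cross_dia_typing[OF assms(2)])
  also have "\<dots> \<approx> crossing_word r [j, i]"
    by (rule isotopic.sym, rule crossing_word_pair[OF assms(2) r])
  finally show ?thesis by (rule hdiagram_isotopic)
qed

lemma hdiagram_crossing_braid:
  assumes "Suc (Suc i) < r"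
  shows "hdiagram (crossing_word r [i, Suc i, i]) =
    (hdiagram (crossing_word r [Suc i, i, Suc i]) :: 'k::field hmor)"
proof -
  \<comment> \<open>Both crossings are placed in one window of three strands starting at
    \<open>i\<close>, where the braid relation applies literally.\<close>
  let ?X = "Ppow i" and ?Y = "Ppow (r - (i + 3))"
  have Y: "r - Suc (Suc i) = Suc (r - (i + 3))" "r - Suc (Suc (Suc i)) = r - (i + 3)"
    using assms by (simp_all add: numeral_eq_Suc)
  let ?a = "Cross \<parallel> up" and ?b = "up \<parallel> Cross"
  have ca: "cross_dia r i \<approx> layer ?X ?a ?Y"
    by (rule isotopic.trans[OF _ layer_cong[OF layer_Nil_left]])
      (use layer_layer[of Cross ?X "[]" "[Qp]" ?Y, THEN isotopic.sym] assms
        in \<open>auto simp: Ppow_simps Y\<close>)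
  have cb: "cross_dia r (Suc i) \<approx> layer ?X ?b ?Y"
    by (rule isotopic.trans[OF _ layer_cong[OF layer_Nil_right]])
      (use layer_layer[of Cross ?X "[Qp]" "[]" ?Y, THEN isotopic.sym] assms
        in \<open>auto simp: Ppow_simps Y\<close>)
  \<comment> \<open>Both sides of the relation have the shape f g f, so one statement serves twice,
    with the roles of \<open>?a\<close> and \<open>?b\<close> exchanged.\<close>
  have triple: "crossing_word r [j, k, j] \<approx> layer ?X (f \<cdot> g \<cdot> f) ?Y"
    if "cross_dia r j \<approx> layer ?X f ?Y" "cross_dia r k \<approx> layer ?X g ?Y" "Suc j < r" "Suc k < r"
      "wf_diagram (f \<cdot> g \<cdot> f)" for j k f g
  proof -
    have "crossing_word r [j, k, j] \<approx> cross_dia r j \<cdot> cross_dia r k \<cdot> cross_dia r j"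
      using crossing_word_pair[of k r j] crossing_word_typing(3)[of "[k, j]" r] that
        cross_dia_typing[of j r]
      by (auto intro!: isotopic.vert_cong isotopic.refl simp del: source.simps(8) target.simps(8))
    also have "\<dots> \<approx> layer ?X f ?Y \<cdot> layer ?X g ?Y \<cdot> layer ?X f ?Y"
      using that(1,2) cross_dia_typing[OF that(3)] cross_dia_typing[OF that(4)]
      by (auto intro!: isotopic.vert_cong simp del: source.simps(8) target.simps(8))
    also have "\<dots> \<approx> layer ?X f ?Y \<cdot> layer ?X (g \<cdot> f) ?Y"
      using that(5) by (intro isotopic.vert_cong isotopic.refl layer_vert) auto
    also have "\<dots> \<approx> layer ?X (f \<cdot> g \<cdot> f) ?Y"
      using that(5) by (rule layer_vert)
    finally show ?thesis .
  qed
  have rel: "hdiagram (?a \<cdot> ?b \<cdot> ?a) = (hdiagram (?b \<cdot> ?a \<cdot> ?b) :: 'k hmor)"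
    by (intro hdiagram_eqI tensor_ideal.rel) (simp add: heisenberg_relations_def)
  have "hdiagram (crossing_word r [i, Suc i, i]) = (hdiagram (layer ?X (?a \<cdot> ?b \<cdot> ?a) ?Y) :: 'k hmor)"
    using assms by (intro hdiagram_isotopic triple ca cb) auto
  also have "\<dots> = hdiagram (layer ?X (?b \<cdot> ?a \<cdot> ?b) ?Y)"
    using rel by (subst (1 2) hdiagram_layer) simp_all
  also have "\<dots> = hdiagram (crossing_word r [Suc i, i, Suc i])"
    using assms by (intro hdiagram_isotopic[symmetric] triple ca cb) auto
  finally show ?thesis .
qed


section \<open>The action of the symmetric group\<close>

definition word_perm :: "nat list \<Rightarrow> nat \<Rightarrow> nat" where
  "word_perm xs = foldr (\<lambda>i v. transpose i (Suc i) \<circ> v) xs id"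

lemma word_perm_simps [simp]:
  "word_perm [] = id"
  "word_perm (i # xs) = transpose i (Suc i) \<circ> word_perm xs"
  by (simp_all add: word_perm_def)

lemma word_perm_append: "word_perm (xs @ js) = word_perm xs \<circ> word_perm js"
  by (induction xs) (simp_all add: o_assoc)

lemma word_perm_in_Sym: "valid_word r xs \<Longrightarrow> word_perm xs \<in> Sym r"
  by (induction xs) (auto simp: Sym_def id_def intro!: permutes_compose permutes_swap_id permutes_id[unfolded id_def])

text \<open>The Coxeter presentation as a congruence on words, free of diagrams. That it coincides
  with equality of permutations is pure combinatorics of S_r; \<open>coxeter_eq_hdiagram\<close>
  carries the result over to morphisms.\<close>

inductive coxeter_eq :: "nat \<Rightarrow> nat list \<Rightarrow> nat list \<Rightarrow> bool" for r where
  refl: "valid_word r xs \<Longrightarrow> coxeter_eq r xs xs"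
| sym: "coxeter_eq r xs js \<Longrightarrow> coxeter_eq r js xs"
| trans: "coxeter_eq r xs js \<Longrightarrow> coxeter_eq r js ks \<Longrightarrow> coxeter_eq r xs ks"
| append: "coxeter_eq r xs js \<Longrightarrow> coxeter_eq r ks ls \<Longrightarrow> coxeter_eq r (xs @ ks) (js @ ls)"
| square: "Suc i < r \<Longrightarrow> coxeter_eq r [i, i] []"
| commute: "Suc i < j \<Longrightarrow> Suc j < r \<Longrightarrow> coxeter_eq r [i, j] [j, i]"
| braid: "Suc (Suc i) < r \<Longrightarrow> coxeter_eq r [i, Suc i, i] [Suc i, i, Suc i]"

declare coxeter_eq.trans [trans]

lemma coxeter_eq_valid: "coxeter_eq r xs js \<Longrightarrow> valid_word r xs \<and> valid_word r js"
  by (induction rule: coxeter_eq.induct) auto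

text \<open>Normal words are built by induction on \<open>r\<close>, so relations of S_r have to be
  read in S_{r+1}.\<close>

lemma coxeter_eq_mono: "coxeter_eq r xs js \<Longrightarrow> r \<le> r' \<Longrightarrow> coxeter_eq r' xs js"
proof (induction rule: coxeter_eq.induct)
  case (trans xs js ks) then show ?case using coxeter_eq.trans by blast
next
  case (refl xs) then show ?case by (intro coxeter_eq.refl) auto
qed (auto intro: coxeter_eq.intros)

lemma coxeter_eq_word_perm: "coxeter_eq r xs js \<Longrightarrow> word_perm xs = word_perm js"
proof (induction rule: coxeter_eq.induct)
  case (commute i j)
  then show ?case by (auto simp: fun_eq_iff transpose_def)
next
  case (braid i)
  then show ?case by (auto simp: fun_eq_iff transpose_def)
qed (auto simp: word_perm_append)

lemma coxeter_eq_hdiagram: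
  "coxeter_eq r xs js \<Longrightarrow> hdiagram (crossing_word r xs) = (hdiagram (crossing_word r js) :: 'k::field hmor)"
proof (induction rule: coxeter_eq.induct)
  case (append xs js ks ls)
  have *: "hdiagram (crossing_word r (xs @ ys)) =
      (hdiagram (crossing_word r xs) \<circ>\<^sub>h hdiagram (crossing_word r ys) :: 'k hmor)"
    if "valid_word r xs" "valid_word r ys" for xs ys
    using that by (simp add: hdiagram_isotopic[OF crossing_word_append] hdiagram_vert crossing_word_typing)
  show ?case using append coxeter_eq_valid[OF append.hyps(1)] coxeter_eq_valid[OF append.hyps(2)]
    by (simp add: *)
next
  case (commute i j)
  then show ?case by (rule hdiagram_crossing_comm)
next
  case (braid i)
  then show ?case by (rule hdiagram_crossing_braid)
next
  case (square i)
  then show ?case by (rule hdiagram_crossing_square)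
qed auto

lemma coxeter_eq_Cons: "coxeter_eq r xs js \<Longrightarrow> Suc i < r \<Longrightarrow> coxeter_eq r (i # xs) (i # js)"
  using coxeter_eq.append[OF coxeter_eq.refl[of "[i]" r], of xs js] by simp

lemma coxeter_eq_move:
  assumes "valid_word r xs" "Suc i < r" "\<forall>j\<in>set xs. Suc j < i \<or> Suc i < j"
  shows "coxeter_eq r (i # xs) (xs @ [i])"
  using assms
proof (induction xs)
  case Nil
  then show ?case by (auto intro: coxeter_eq.refl)
next
  case (Cons j xs)
  have "coxeter_eq r [i, j] [j, i]"
    using Cons.prems by (auto intro: coxeter_eq.commute coxeter_eq.commute[THEN coxeter_eq.sym])
  from coxeter_eq.append[OF this coxeter_eq.refl[of xs]] Cons.prems
  have "coxeter_eq r (i # j # xs) (j # i # xs)" by simp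
  also have "coxeter_eq r \<dots> (j # xs @ [i])"
    using Cons by (intro coxeter_eq_Cons Cons.IH) auto
  finally show ?case by simp
qed

text \<open>
  With \<open>k = w r\<close> and \<open>s\<^sub>i\<close> the transposition of \<open>i\<close> and \<open>i + 1\<close>, the word \<open>s\<^sub>k \<dots> s\<^bsub>r-1\<^esub>\<close> carries \<open>r\<close>
  to \<open>k\<close>; it is split off \<open>w\<close> on the left, and the remaining factor fixes \<open>r\<close>.
\<close>

fun normal_word :: "nat \<Rightarrow> (nat \<Rightarrow> nat) \<Rightarrow> nat list" where
  "normal_word 0 w = []"
| "normal_word (Suc r) w = [w r..<r] @ normal_word r (inv (word_perm [w r..<r]) \<circ> w)"

lemma word_perm_upt: "k \<le> r \<Longrightarrow> word_perm [k..<r] r = k"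
proof (induction "r - k" arbitrary: k)
  case (Suc d)
  then have "word_perm [Suc k..<r] r = Suc k" by auto
  then show ?case using Suc.hyps by (auto simp: upt_conv_Cons)
qed auto

lemma Sym_bij: "w \<in> Sym r \<Longrightarrow> bij w"
  by (auto simp: Sym_def permutes_bij)

lemma Sym_comp: "u \<in> Sym r \<Longrightarrow> v \<in> Sym r \<Longrightarrow> u \<circ> v \<in> Sym r"
  by (auto simp: Sym_def permutes_compose)

lemma Sym_inv: "u \<in> Sym r \<Longrightarrow> inv u \<in> Sym r"
  by (auto simp: Sym_def permutes_inv)

lemma Sym_inv_comp [simp]: "u \<in> Sym r \<Longrightarrow> inv u \<circ> u = id" "u \<in> Sym r \<Longrightarrow> u \<circ> inv u = id"
  by (auto simp: Sym_def permutes_inv_o)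

lemma Sym_in: "u \<in> Sym r \<Longrightarrow> u i < r \<longleftrightarrow> i < r"
  using permutes_in_image[of u "{..<r}" i] by (auto simp: Sym_def)

lemma Sym_fix: "w \<in> Sym (Suc r) \<Longrightarrow> w r = r \<Longrightarrow> w \<in> Sym r"
  unfolding Sym_def by (auto intro: permutes_superset simp: less_Suc_eq)

lemma finite_Sym [simp]: "finite (Sym r)"
  by (simp add: Sym_def finite_permutations)

lemma normal_word_reduce:
  assumes "w \<in> Sym (Suc r)"
  shows "word_perm [w r..<r] \<in> Sym (Suc r)" "inv (word_perm [w r..<r]) \<circ> w \<in> Sym r"
proof -
  have le: "w r \<le> r" using Sym_in[OF assms, of r] by simp
  show 1: "word_perm [w r..<r] \<in> Sym (Suc r)" by (rule word_perm_in_Sym) auto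
  have "inv (word_perm [w r..<r]) (w r) = r"
    using word_perm_upt[OF le] Sym_bij[OF 1] by (metis bij_inv_eq_iff)
  then show "inv (word_perm [w r..<r]) \<circ> w \<in> Sym r"
    by (intro Sym_fix[OF Sym_comp[OF Sym_inv[OF 1] assms]]) simp
qed

lemma normal_word_correct:
  "w \<in> Sym r \<Longrightarrow> valid_word r (normal_word r w) \<and> word_perm (normal_word r w) = w"
proof (induction r arbitrary: w)
  case 0
  then show ?case by (auto simp: Sym_def)
next
  case (Suc r)
  note D = normal_word_reduce[OF Suc.prems]
  note IH = Suc.IH[OF D(2)]
  have "word_perm (normal_word (Suc r) w) =
      word_perm [w r..<r] \<circ> (inv (word_perm [w r..<r]) \<circ> w)"
    using IH by (simp only: normal_word.simps word_perm_append)
  also have "\<dots> = w" using D(1) by (simp only: o_assoc Sym_inv_comp id_o)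
  finally have "word_perm (normal_word (Suc r) w) = w" .
  moreover have "valid_word (Suc r) (normal_word (Suc r) w)"
    using IH by (simp only: normal_word.simps) (auto simp del: o_apply)
  ultimately show ?case by blast
qed

text \<open>The words \<open>[k..<r]\<close> represent the cosets of S_r in S_{r+1}. A generator s_i
  on the left permutes these representatives up to a correction on the right: it commutes with the
  whole word if i + 1 < k, lengthens it if k = i + 1, cancels its head if k = i, and emerges as
  s_{i-1} if k < i. So the correction is at most one generator of S_r.\<close>

lemma coxeter_eq_upt:
  assumes "Suc i < Suc r" "k \<le> r"
  shows "\<exists>js. valid_word r js \<and>
    coxeter_eq (Suc r) (i # [k..<r]) ([transpose i (Suc i) k..<r] @ js) \<and> length js \<le> 1"
proof -
  consider "Suc i < k" | "k = Suc i" | "k = i" | "k < i" by linarith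
  then show ?thesis
  proof cases
    case 1
    then show ?thesis using coxeter_eq_move[of "[k..<r]" "Suc r" i] assms
      by (intro exI[of _ "[i]"]) (auto simp: transpose_def)
  next
    case 2
    then show ?thesis using assms
      by (intro exI[of _ "[]"]) (auto simp: upt_conv_Cons intro!: coxeter_eq.refl)
  next
    case 3
    have "coxeter_eq (Suc r) ([i, i] @ [Suc i..<r]) ([] @ [Suc i..<r])"
      using assms by (intro coxeter_eq.append coxeter_eq.square coxeter_eq.refl) auto
    then show ?thesis using assms 3
      by (intro exI[of _ "[]"]) (auto simp: upt_conv_Cons)
  next
    case 4
    then obtain h where h: "i = Suc h" "k \<le> h" by (cases i) auto
    \<comment> \<open>\<open>i\<close> commutes with everything before \<open>h\<close>, the
      predecessor of \<open>i\<close>; the braid relation turns i h i into h i h, and the last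
      \<open>h\<close> commutes with the rest.\<close>
    have split: "[k..<r] = [k..<h] @ [h, i] @ [Suc i..<r]"
      using h assms upt_add_eq_append[of k h "r - h"] by (simp add: upt_conv_Cons)
    have 1: "coxeter_eq (Suc r) (i # [k..<h]) ([k..<h] @ [i])"
      using h assms by (intro coxeter_eq_move) auto
    have 2: "coxeter_eq (Suc r) [i, h, i] [h, i, h]"
      using h assms by (auto intro: coxeter_eq.braid[THEN coxeter_eq.sym])
    have 3: "coxeter_eq (Suc r) (h # [Suc i..<r]) ([Suc i..<r] @ [h])"
      using h assms by (intro coxeter_eq_move) auto
    have "coxeter_eq (Suc r) (i # [k..<r]) ([k..<h] @ [i] @ [h, i] @ [Suc i..<r])"
      unfolding split using h assms coxeter_eq.append[OF 1 coxeter_eq.refl, of "[h, i] @ [Suc i..<r]"] by simp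
    also  have "coxeter_eq (Suc r) \<dots> ([k..<h] @ [h, i, h] @ [Suc i..<r])"
      using h assms coxeter_eq.append[OF coxeter_eq.refl coxeter_eq.append[OF 2 coxeter_eq.refl],
          of "[k..<h]" "[Suc i..<r]"] by simp
    also  have "coxeter_eq (Suc r) \<dots> ([k..<h] @ [h, i] @ [Suc i..<r] @ [h])"
      using h assms coxeter_eq.append[OF coxeter_eq.refl 3, of "[k..<h] @ [h, i]"] by simp
    finally  have "coxeter_eq (Suc r) (i # [k..<r]) ([k..<r] @ [h])"
      unfolding split by simp
    then show ?thesis using h assms by (intro exI[of _ "[h]"]) (auto simp: transpose_def)
  qed
qed

text \<open>The generator is pushed through the coset representative, and the induction hypothesis
  for S_r absorbs whatever emerges on the right. Building up a word letter by letter then brings it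
  to normal form.\<close>

lemma coxeter_eq_normal_word_Cons:
  assumes "w \<in> Sym r" "Suc i < r"
  shows "coxeter_eq r (i # normal_word r w) (normal_word r (transpose i (Suc i) \<circ> w))"
  using assms
proof (induction r arbitrary: w i)
  case 0
  then show ?case by simp
next
  case (Suc r)
  define k where "k = w r"
  \<comment> \<open>The image of \<open>r\<close> under s_i w, hence the index of the coset
    representative of the product.\<close>
  define k' where "k' = transpose i (Suc i) k"
  have k: "k \<le> r" using Sym_in[OF Suc.prems(1), of r] by (simp add: k_def)
  define v where "v = inv (word_perm [k..<r]) \<circ> w"
  note D = normal_word_reduce[OF Suc.prems(1), folded k_def, folded v_def]
  obtain js where js: "valid_word r js"
    "coxeter_eq (Suc r) (i # [k..<r]) ([k'..<r] @ js)" "length js \<le> 1"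
    using coxeter_eq_upt[OF Suc.prems(2) k] by (auto simp: k'_def)
  have "coxeter_eq r (js @ normal_word r v) (normal_word r (word_perm js \<circ> v))"
  proof (cases js)
    case Nil
    then show ?thesis using normal_word_correct[OF D(2)] by (auto intro: coxeter_eq.refl)
  next
    case (Cons j ks)
    then show ?thesis using Suc.IH[OF D(2), of j] js by (auto simp del: o_apply)
  qed
  then have 1: "coxeter_eq (Suc r) ([k'..<r] @ js @ normal_word r v)
      ([k'..<r] @ normal_word r (word_perm js \<circ> v))"
    by (intro coxeter_eq.append[OF coxeter_eq.refl] coxeter_eq_mono[OF _ le_SucI[OF order_refl]]) auto
  have 2: "coxeter_eq (Suc r) ((i # [k..<r]) @ normal_word r v) (([k'..<r] @ js) @ normal_word r v)"
    using normal_word_correct[OF D(2)] js(2) by (intro coxeter_eq.append coxeter_eq.refl) auto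
  have D': "word_perm [k'..<r] \<in> Sym (Suc r)" by (rule word_perm_in_Sym) auto
  have "w = word_perm [k..<r] \<circ> v"
    unfolding v_def using D(1) by (simp only: o_assoc Sym_inv_comp id_o)
  then have "transpose i (Suc i) \<circ> w = (transpose i (Suc i) \<circ> word_perm [k..<r]) \<circ> v"
    by (simp only: o_assoc)
  also have "transpose i (Suc i) \<circ> word_perm [k..<r] = word_perm [k'..<r] \<circ> word_perm js"
    using coxeter_eq_word_perm[OF js(2)] by (simp add: word_perm_append)
  finally have "inv (word_perm [k'..<r]) \<circ> (transpose i (Suc i) \<circ> w) = word_perm js \<circ> v"
    using D' by (simp only: o_assoc Sym_inv_comp id_o)
  then have "normal_word (Suc r) (transpose i (Suc i) \<circ> w) = [k'..<r] @ normal_word r (word_perm js \<circ> v)"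
    by (simp add: k_def[symmetric] k'_def[symmetric])
  moreover have "normal_word (Suc r) w = [k..<r] @ normal_word r v" by (simp add: v_def k_def)
  ultimately show ?case using coxeter_eq.trans[OF 2] 1 by (simp del: o_apply normal_word.simps)
qed

lemma coxeter_eq_normal_word:
  "valid_word r xs \<Longrightarrow> coxeter_eq r xs (normal_word r (word_perm xs))"
proof (induction xs)
  case Nil
  have "normal_word r id = []" by (induction r) simp_all
  then show ?case by (simp add: coxeter_eq.refl id_def)
next
  case (Cons i xs)
  then have "coxeter_eq r (i # xs) (i # normal_word r (word_perm xs))"
    by (intro coxeter_eq_Cons) auto
  also  have "coxeter_eq r \<dots> (normal_word r (word_perm (i # xs)))"
    using coxeter_eq_normal_word_Cons[OF word_perm_in_Sym, of xs r i] Cons.prems by simp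
  finally  show ?case .
qed

lemma perm_word_correct:
  assumes "w \<in> Sym r"
  shows "valid_word r (perm_word r w)" "word_perm (perm_word r w) = w"
proof -
  have "\<exists>xs. (\<forall>i\<in>set xs. Suc i < r) \<and> w = foldr (\<lambda>i v. transpose i (Suc i) \<circ> v) xs id"
    using normal_word_correct[OF assms] unfolding word_perm_def by metis
  from someI_ex[OF this] show "valid_word r (perm_word r w)" "word_perm (perm_word r w) = w"
    unfolding perm_word_def[symmetric] word_perm_def by auto
qed

text \<open>\<open>perm_word\<close> is an arbitrary choice. Any other word of the same permutation
  has the same normal word, so both give the same morphism.\<close>

lemma perm_mor_word_perm:
  assumes "valid_word r xs"
  shows "perm_mor r (word_perm xs) = hdiagram (crossing_word r xs)"
proof -
  have w: "word_perm xs \<in> Sym r" using assms by (rule word_perm_in_Sym)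
  have "coxeter_eq r (perm_word r (word_perm xs)) xs"
    using coxeter_eq_normal_word[OF perm_word_correct(1)[OF w]] coxeter_eq_normal_word[OF assms]
    unfolding perm_word_correct(2)[OF w] by (metis coxeter_eq.sym coxeter_eq.trans)
  then show ?thesis
    using perm_word_correct(1)[OF w]
    by (simp add: perm_mor_def hdiagram_crossing_word[symmetric] coxeter_eq_hdiagram)
qed

lemma perm_mor_comp:
  assumes "u \<in> Sym r" "v \<in> Sym r"
  shows "perm_mor r u \<circ>\<^sub>h perm_mor r v = (perm_mor r (u \<circ> v) :: 'k::field hmor)"
proof -
  let ?u = "perm_word r u" and ?v = "perm_word r v"
  note U = perm_word_correct[OF assms(1)] and V = perm_word_correct[OF assms(2)]
  have "perm_mor r u \<circ>\<^sub>h perm_mor r v = (hdiagram (crossing_word r (?u @ ?v)) :: 'k hmor)"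
    using perm_mor_word_perm[OF U(1), where ?'a = 'k] perm_mor_word_perm[OF V(1), where ?'a = 'k] U V
    by (simp add: hdiagram_isotopic[OF crossing_word_append] hdiagram_vert crossing_word_typing)
  also have "\<dots> = perm_mor r (word_perm (?u @ ?v))"
    using U(1) V(1) by (intro perm_mor_word_perm[symmetric]) auto
  finally show ?thesis using U V by (simp add: word_perm_append)
qed

lemma perm_mor_in_hhom:
  "w \<in> Sym r \<Longrightarrow> (perm_mor r w :: 'k::field hmor) \<in> hhom (Ppow r) (Ppow r)"
  using perm_word_correct[of w r] perm_mor_word_perm[of "perm_word r w" r, where ?'a = 'k]
    hdiagram_in_hhom[of "crossing_word r (perm_word r w)", where ?'a = 'k]
  by (simp add: crossing_word_typing)

section \<open>Tensor products of permutation diagrams\<close>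

definition juxtapose :: "nat \<Rightarrow> (nat \<Rightarrow> nat) \<Rightarrow> (nat \<Rightarrow> nat) \<Rightarrow> nat \<Rightarrow> nat" where
  "juxtapose m u v i = (if i < m then u i else m + v (i - m))"

lemma crossing_word_widen_right:
  assumes "valid_word m xs"
  shows "crossing_word m xs \<parallel> Ident (Ppow n) \<approx> crossing_word (m + n) xs"
  using assms
proof (induction xs)
  case Nil
  then show ?case using isotopic.horiz_id[of "Ppow m" "Ppow n"] by (simp add: Ppow_simps)
next
  case (Cons i xs)
  have i: "Suc i < m" "Suc i < m + n" and v: "valid_word m xs" "valid_word (m + n) xs"
    using Cons.prems by auto
  note tps = cross_dia_typing[OF i(1)] cross_dia_typing[OF i(2)]
    crossing_word_typing[OF v(1)] crossing_word_typing[OF v(2)]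
  have wf: "wf_diagram (cross_dia m i \<cdot> crossing_word m xs)"
    unfolding wf_diagram.simps(1) tps by (simp add: tps)
  have "crossing_word m (i # xs) \<parallel> Ident (Ppow n) \<approx>
      (cross_dia m i \<cdot> crossing_word m xs) \<parallel> (Ident (Ppow n) \<cdot> Ident (Ppow n))"
    unfolding crossing_word_simps
    by (rule isotopic.horiz_cong[OF isotopic.refl[OF wf] isotopic.sym[OF Ident_vert]])
  also have "\<dots> \<approx> (cross_dia m i \<parallel> Ident (Ppow n)) \<cdot> (crossing_word m xs \<parallel> Ident (Ppow n))"
    by (rule isotopic.sym, rule isotopic.interchange[OF wf]) simp
  also have "\<dots> \<approx> cross_dia (m + n) i \<cdot> crossing_word (m + n) xs"
  proof (rule isotopic.vert_cong)
    have "cross_dia m i \<parallel> Ident (Ppow n) \<approx> layer (Ppow 0) (cross_dia m i) (Ppow n)"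
      using layer_Nil_left[of "cross_dia m i" "Ppow n", THEN isotopic.sym] by (simp add: Ppow_simps)
    also have "\<dots> \<approx> cross_dia (m + n) i" using cross_dia_layer[of 0 i m n] i by simp
    finally show "cross_dia m i \<parallel> Ident (Ppow n) \<approx> cross_dia (m + n) i" .
    show "crossing_word m xs \<parallel> Ident (Ppow n) \<approx> crossing_word (m + n) xs"
      using v(1) by (rule Cons.IH)
    show "source (cross_dia m i \<parallel> Ident (Ppow n)) = target (crossing_word m xs \<parallel> Ident (Ppow n))"
      unfolding source.simps(8)[of "cross_dia m i"] target.simps(8)[of "crossing_word m xs"] tps by simp
  qed
  finally show ?case by simp
qed

lemma crossing_word_widen_left:
  assumes "valid_word n xs"
  shows "Ident (Ppow m) \<parallel> crossing_word n xs \<approx> crossing_word (m + n) (map ((+) m) xs)"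
  using assms
proof (induction xs)
  case Nil
  then show ?case using isotopic.horiz_id[of "Ppow m" "Ppow n"] by (simp add: Ppow_simps)
next
  case (Cons i xs)
  have i: "Suc i < n" and v: "valid_word n xs" using Cons.prems by auto
  note tps = cross_dia_typing[OF i] crossing_word_typing[OF v]
  have wf: "wf_diagram (cross_dia n i \<cdot> crossing_word n xs)"
    unfolding wf_diagram.simps(1) tps by (simp add: tps)
  have "Ident (Ppow m) \<parallel> crossing_word n (i # xs) \<approx>
      (Ident (Ppow m) \<cdot> Ident (Ppow m)) \<parallel> (cross_dia n i \<cdot> crossing_word n xs)"
    unfolding crossing_word_simps
    by (rule isotopic.horiz_cong[OF isotopic.sym[OF Ident_vert] isotopic.refl[OF wf]])
  also have "\<dots> \<approx> (Ident (Ppow m) \<parallel> cross_dia n i) \<cdot> (Ident (Ppow m) \<parallel> crossing_word n xs)"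
    by (rule isotopic.sym, rule isotopic.interchange[OF _ wf]) simp
  also have "\<dots> \<approx> cross_dia (m + n) (m + i) \<cdot> crossing_word (m + n) (map ((+) m) xs)"
  proof (rule isotopic.vert_cong)
    have "Ident (Ppow m) \<parallel> cross_dia n i \<approx> layer (Ppow m) (cross_dia n i) (Ppow 0)"
      using layer_Nil_right[of "cross_dia n i" "Ppow m", THEN isotopic.sym] by (simp add: Ppow_simps)
    also have "\<dots> \<approx> cross_dia (m + n) (m + i)"
      using cross_dia_layer[of m i n 0] i by simp
    finally show "Ident (Ppow m) \<parallel> cross_dia n i \<approx> cross_dia (m + n) (m + i)" .
    show "Ident (Ppow m) \<parallel> crossing_word n xs \<approx> crossing_word (m + n) (map ((+) m) xs)"
      using v by (rule Cons.IH)
    show "source (Ident (Ppow m) \<parallel> cross_dia n i) = target (Ident (Ppow m) \<parallel> crossing_word n xs)"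
      unfolding source.simps(8)[of "Ident (Ppow m)"] target.simps(8)[of "Ident (Ppow m)"] tps by simp
  qed
  finally show ?case by simp
qed

text \<open>The left diagram is drawn above the right one, after which both are widened to
  \<open>m + n\<close> strands; for the right one this shifts every index by
  \<open>m\<close>.\<close>

lemma crossing_word_horiz:
  assumes "valid_word m xs" "valid_word n ys"
  shows "crossing_word m xs \<parallel> crossing_word n ys \<approx> crossing_word (m + n) (xs @ map ((+) m) ys)"
proof -
  note tps = crossing_word_typing[OF assms(1)] crossing_word_typing[OF assms(2)]
  have v: "valid_word (m + n) xs" "valid_word (m + n) (map ((+) m) ys)" using assms by auto
  have "crossing_word m xs \<parallel> crossing_word n ys \<approx>
      (crossing_word m xs \<parallel> Ident (Ppow n)) \<cdot> (Ident (Ppow m) \<parallel> crossing_word n ys)"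
    using isotopic.sym[OF exchange_left[OF tps(1,4)]] by (simp only: tps)
  also have "\<dots> \<approx> crossing_word (m + n) xs \<cdot> crossing_word (m + n) (map ((+) m) ys)"
    by (intro isotopic.vert_cong crossing_word_widen_left crossing_word_widen_right assms)
      (simp add: tps)
  also have "\<dots> \<approx> crossing_word (m + n) (xs @ map ((+) m) ys)"
    by (rule isotopic.sym, rule crossing_word_append[OF v])
  finally show ?thesis .
qed

lemma word_perm_shift:
  "word_perm (map ((+) m) ys) = (\<lambda>i. if i < m then i else m + word_perm ys (i - m))"
proof (induction ys)
  case (Cons j ys)
  then show ?case by (auto simp: fun_eq_iff transpose_def)
qed (auto simp: fun_eq_iff)

lemma perm_mor_tensor:
  assumes "u \<in> Sym m" "v \<in> Sym n"
  shows "perm_mor m u \<otimes>\<^sub>h perm_mor n v = (perm_mor (m + n) (juxtapose m u v) :: 'k::field hmor)"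
proof -
  note U = perm_word_correct[OF assms(1)] and V = perm_word_correct[OF assms(2)]
  let ?w = "perm_word m u @ map ((+) m) (perm_word n v)"
  have "perm_mor m u \<otimes>\<^sub>h perm_mor n v = (hdiagram (crossing_word (m + n) ?w) :: 'k hmor)"
    using perm_mor_word_perm[OF U(1), where ?'a = 'k] perm_mor_word_perm[OF V(1), where ?'a = 'k] U V
    by (simp add: hdiagram_horiz crossing_word_typing hdiagram_isotopic[OF crossing_word_horiz])
  also have "\<dots> = perm_mor (m + n) (word_perm ?w)"
    using U(1) V(1) by (intro perm_mor_word_perm[symmetric]) auto
  also have "word_perm ?w = juxtapose m u v"
  proof
    fix i
    have "\<not> u (m + j) < m" "u (m + j) = m + j" for j
      using assms(1) permutes_not_in[of u "{..<m}" "m + j"] by (auto simp: Sym_def)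
    then show "word_perm ?w i = juxtapose m u v i"
      using U(2) V(2) by (simp add: word_perm_append word_perm_shift juxtapose_def)
  qed
  finally show ?thesis .
qed


section \<open>The group algebra\<close>

text \<open>All finitely supported permutations of the naturals form one group, so that the algebras
  k[S_r] for all r sit in a single associative ring. The group is written additively because the
  convolution product of \<open>Poly_Mapping\<close> adds keys.\<close>

typedef fperm = "{w :: nat \<Rightarrow> nat. permutation w}" morphisms fapply Fperm
  by (intro exI[of _ id]) simp

lemma permutation_fapply [simp]: "permutation (fapply p)"
  using fapply[of p] by simp

lemma fapply_Fperm [simp]: "permutation w \<Longrightarrow> fapply (Fperm w) = w"
  by (simp add: Fperm_inverse)

instantiation fperm :: group_add
begin
definition "0 = Fperm id"
definition "p + q = Fperm (fapply p \<circ> fapply q)"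
definition "- p = Fperm (inv (fapply p))"
definition "(p :: fperm) - q = p + - q"
instance
proof
  fix p q r :: fperm
  show "p + q + r = p + (q + r)"
    by (simp add: plus_fperm_def permutation_compose o_assoc)
  show "0 + p = p" "p + 0 = p"
    by (simp_all add: plus_fperm_def zero_fperm_def fapply_inverse)
  show "- p + p = 0"
    by (simp add: plus_fperm_def uminus_fperm_def zero_fperm_def permutation_inverse
        permutation_inverse_works)
  show "p + - q = p - q" by (simp add: minus_fperm_def)
qed
end

text \<open>A scalar acts as multiplication by a multiple of the ring unit, so moving scalars
  through products is associativity and centrality.\<close>

definition scal :: "'k::field \<Rightarrow> (fperm \<Rightarrow>\<^sub>0 'k) \<Rightarrow> (fperm \<Rightarrow>\<^sub>0 'k)" where
  "scal c x = Poly_Mapping.single 0 c * x"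

lemma lookup_scal [simp]:
  "Poly_Mapping.lookup (scal c x) k = c * Poly_Mapping.lookup x k"
  by (simp add: scal_def mult_map_scale_conv_mult[symmetric])

interpretation galg: vector_space scal
  by standard (auto intro!: poly_mapping_eqI simp: lookup_add algebra_simps)

lemma poly_mapping_sum_single:
  "(x :: 'a \<Rightarrow>\<^sub>0 'b::comm_monoid_add) =
    (\<Sum>k\<in>Poly_Mapping.keys x. Poly_Mapping.single k (Poly_Mapping.lookup x k))"
  by (rule poly_mapping_eqI) (simp add: lookup_sum lookup_single when_def in_keys_iff)

lemma mult_scal_left: "scal c x * y = scal c (x * y)"
  by (simp add: scal_def mult.assoc)

lemma mult_scal_right: "x * scal c y = scal c (x * y)"
proof -
  have "Poly_Mapping.single k a * Poly_Mapping.single 0 c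
      = Poly_Mapping.single 0 c * Poly_Mapping.single k a" for k :: fperm and a
    by (simp add: mult_single mult.commute)
  then have "x * Poly_Mapping.single 0 c = Poly_Mapping.single 0 c * x"
    by (subst (1 2) poly_mapping_sum_single[of x]) (simp add: sum_distrib_left sum_distrib_right)
  then show ?thesis by (simp add: scal_def mult.assoc[symmetric])
qed

definition basis :: "(nat \<Rightarrow> nat) \<Rightarrow> (fperm \<Rightarrow>\<^sub>0 'k::field)" where
  "basis w = Poly_Mapping.single (Fperm w) 1"

lemma basis_mult:
  "permutation u \<Longrightarrow> permutation v \<Longrightarrow> basis u * basis v = basis (u \<circ> v)"
  by (simp add: basis_def mult_single plus_fperm_def)

lemma basis_id: "basis id = 1"
  by (simp add: basis_def zero_fperm_def[symmetric])

lemma Sym_permutation [simp]: "w \<in> Sym r \<Longrightarrow> permutation w"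
  by (auto simp: Sym_def intro: permutes_imp_permutation)

lemma basis_mult_Sym: "u \<in> Sym r \<Longrightarrow> v \<in> Sym r \<Longrightarrow> basis u * basis v = basis (u \<circ> v)"
  by (simp add: basis_mult)

lemma lookup_basis:
  "permutation u \<Longrightarrow> permutation v \<Longrightarrow> Poly_Mapping.lookup (basis u) (Fperm v) = (if u = v then 1 else 0)"
  by (simp add: basis_def lookup_single when_def Fperm_inject)

text \<open>The anti-involution inverting group elements. It reverses products and fixes the row and
  column sums, so each result on C x R has a mirror image on R x C.\<close>

definition star :: "(fperm \<Rightarrow>\<^sub>0 'k::field) \<Rightarrow> (fperm \<Rightarrow>\<^sub>0 'k)" where
  "star x = Poly_Mapping.map_key uminus x"

lemma star_single: "star (Poly_Mapping.single k c) = Poly_Mapping.single (- k) c"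
  using map_key_single[of uminus "- k" c] by (simp add: star_def)

lemma star_sum: "star (\<Sum>i\<in>I. f i) = (\<Sum>i\<in>I. star (f i))"
  by (induction I rule: infinite_finite_induct) (simp_all add: star_def map_key_plus)

lemma star_mult: "star (x * y) = star y * star x"
proof -
  have "star (x * y) = (\<Sum>k\<in>Poly_Mapping.keys x. \<Sum>l\<in>Poly_Mapping.keys y.
      star (Poly_Mapping.single k (Poly_Mapping.lookup x k) * Poly_Mapping.single l (Poly_Mapping.lookup y l)))"
    by (subst (1) poly_mapping_sum_single[of x], subst (1) poly_mapping_sum_single[of y])
      (simp only: star_sum sum_product)
  also have "\<dots> = (\<Sum>k\<in>Poly_Mapping.keys x. \<Sum>l\<in>Poly_Mapping.keys y.
      star (Poly_Mapping.single l (Poly_Mapping.lookup y l)) * star (Poly_Mapping.single k (Poly_Mapping.lookup x k)))"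
    by (simp add: mult_single star_single minus_add mult.commute)
  also have "\<dots> = star y * star x"
    by (subst (3) poly_mapping_sum_single[of x], subst (3) poly_mapping_sum_single[of y])
      (simp only: star_sum sum_product, rule sum.swap)
  finally show ?thesis .
qed

lemma star_scal: "star (scal c x) = scal c (star x)"
  by (rule poly_mapping_eqI) (simp add: star_def map_key.rep_eq)

lemma star_basis: "permutation w \<Longrightarrow> star (basis w) = basis (inv w)"
  by (simp add: basis_def star_single uminus_fperm_def)

text \<open>Carries the functions of the definitions into the ring, where \<open>gmult\<close>
  becomes the product. Values outside S_r are lost, so \<open>emb r\<close> determines a function on
  S_r only.\<close>

definition emb :: "nat \<Rightarrow> 'k galg \<Rightarrow> (fperm \<Rightarrow>\<^sub>0 'k::field)" where
  "emb r a = (\<Sum>w\<in>Sym r. scal (a w) (basis w))"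

lemma lookup_emb:
  assumes "w \<in> Sym r"
  shows "Poly_Mapping.lookup (emb r a) (Fperm w) = a w"
  using assms
  by (simp add: emb_def lookup_sum lookup_basis if_distrib[of "(*) _"] sum.delta' cong: if_cong)

lemma emb_inject: "emb r a = emb r b \<Longrightarrow> w \<in> Sym r \<Longrightarrow> a w = b w"
  using lookup_emb by metis

lemma emb_gmult: "emb r (gmult r a b) = emb r a * emb r b"
proof -
  have "emb r (gmult r a b) = (\<Sum>w\<in>Sym r. \<Sum>u\<in>Sym r. scal (a u * b (inv u \<circ> w)) (basis w))"
    by (simp add: emb_def gmult_def galg.scale_sum_left)
  also have "\<dots> = (\<Sum>u\<in>Sym r. \<Sum>w\<in>Sym r. scal (a u * b (inv u \<circ> w)) (basis w))"
    by (rule sum.swap)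
  also have "\<dots> = (\<Sum>u\<in>Sym r. \<Sum>v\<in>Sym r. scal (a u * b v) (basis (u \<circ> v)))"
  proof (rule sum.cong[OF HOL.refl])
    fix u assume u: "u \<in> Sym r"
    show "(\<Sum>w\<in>Sym r. scal (a u * b (inv u \<circ> w)) (basis w)) =
        (\<Sum>v\<in>Sym r. scal (a u * b v) (basis (u \<circ> v)))"
      by (rule sum.reindex_bij_witness[of _ "\<lambda>v. u \<circ> v" "\<lambda>w. inv u \<circ> w"])
        (use u in \<open>auto simp: o_assoc Sym_comp Sym_inv\<close>)
  qed
  also have "\<dots> = emb r a * emb r b"
    unfolding emb_def sum_product
    by (intro sum.cong HOL.refl) (simp add: mult_scal_left mult_scal_right basis_mult_Sym)
  finally show ?thesis .
qed

lemma emb_scal: "emb r (\<lambda>w. c * a w) = scal c (emb r a)"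
  by (simp add: emb_def galg.scale_sum_right)

definition gsum :: "(nat \<Rightarrow> nat) set \<Rightarrow> (fperm \<Rightarrow>\<^sub>0 'k::field)" where
  "gsum S = (\<Sum>w\<in>S. basis w)"

lemma emb_indicator:
  assumes "S \<subseteq> Sym r"
  shows "emb r (\<lambda>w. if w \<in> S then c else 0) = scal c (gsum S)"
proof -
  have "emb r (\<lambda>w. if w \<in> S then c else 0) = (\<Sum>w\<in>Sym r. if w \<in> S then scal c (basis w) else 0)"
    by (auto simp: emb_def intro!: sum.cong)
  also have "\<dots> = (\<Sum>w\<in>S. scal c (basis w))"
    using assms by (simp add: sum.inter_restrict[symmetric] Int_absorb1)
  finally show ?thesis by (simp add: gsum_def galg.scale_sum_right)
qed

text \<open>The subgroup S_a x S_b, in two roles: as the row group of the shape (a,b) and as the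
  group behind the tensor product of \<open>h_mor a\<close> and \<open>h_mor b\<close>.\<close>

definition young_subgroup :: "nat \<Rightarrow> nat \<Rightarrow> (nat \<Rightarrow> nat) set" where
  "young_subgroup a b = {w \<in> Sym (a + b). \<forall>j. w j < a \<longleftrightarrow> j < a}"

lemma young_subgroup_Sym: "w \<in> young_subgroup a b \<Longrightarrow> w \<in> Sym (a + b)"
  by (simp add: young_subgroup_def)

lemma finite_young_subgroup [simp]: "finite (young_subgroup a b)"
  by (rule finite_subset[of _ "Sym (a + b)"]) (auto simp: young_subgroup_def)

lemma young_subgroup_id [simp]: "id \<in> young_subgroup a b"
  by (simp add: young_subgroup_def Sym_def permutes_id)

lemma young_subgroup_comp:
  "u \<in> young_subgroup a b \<Longrightarrow> v \<in> young_subgroup a b \<Longrightarrow> u \<circ> v \<in> young_subgroup a b"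
  by (simp add: young_subgroup_def Sym_comp)

lemma young_subgroup_inv: "u \<in> young_subgroup a b \<Longrightarrow> inv u \<in> young_subgroup a b"
  unfolding young_subgroup_def
  using Sym_inv Sym_bij by (auto; metis bij_inv_eq_iff)

lemma gsum_absorb:
  assumes "u \<in> young_subgroup a b"
  shows "basis u * gsum (young_subgroup a b) = gsum (young_subgroup a b)"
    and "gsum (young_subgroup a b) * basis u = gsum (young_subgroup a b)"
proof -
  note S = young_subgroup_Sym
  show "basis u * gsum (young_subgroup a b) = gsum (young_subgroup a b)"
    unfolding gsum_def sum_distrib_left
    by (rule sum.reindex_bij_witness[of _ "\<lambda>v. inv u \<circ> v" "\<lambda>v. u \<circ> v"])
      (use assms in \<open>auto simp: o_assoc S Sym_inv_comp[OF S] basis_mult_Sym[OF S S] young_subgroup_comp young_subgroup_inv\<close>)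
  show "gsum (young_subgroup a b) * basis u = gsum (young_subgroup a b)"
    unfolding gsum_def sum_distrib_right
    by (rule sum.reindex_bij_witness[of _ "\<lambda>v. v \<circ> inv u" "\<lambda>v. v \<circ> u"])
      (use assms in \<open>auto simp: o_assoc[symmetric] S Sym_inv_comp[OF S] basis_mult_Sym[OF S S] young_subgroup_comp young_subgroup_inv\<close>)
qed

lemma star_gsum: "star (gsum (young_subgroup a b)) = gsum (young_subgroup a b)"
proof -
  have inv_inv: "inv (inv w) = w" if "w \<in> young_subgroup a b" for w
    using Sym_bij[OF young_subgroup_Sym[OF that]] by (rule inv_inv_eq)
  show ?thesis unfolding gsum_def star_sum
    by (rule sum.reindex_bij_witness[of _ inv inv])
      (auto simp: inv_inv young_subgroup_inv star_basis Sym_permutation[OF young_subgroup_Sym])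
qed

text \<open>An injection of the finite last block into itself is onto, which forces the first block
  to be preserved too.\<close>

lemma young_subgroup_stable:
  assumes "w \<in> Sym (a + b)" "\<And>i. a \<le> i \<Longrightarrow> i < a + b \<Longrightarrow> a \<le> w i"
  shows "w \<in> young_subgroup a b"
proof -
  let ?B = "{a..<a + b}"
  have "w ` ?B \<subseteq> ?B" using assms(2) Sym_in[OF assms(1)] by auto
  moreover have inj: "inj w" using Sym_bij[OF assms(1)] by (rule bij_is_inj)
  ultimately have im: "w ` ?B = ?B"
    by (intro endo_inj_surj) (auto intro: inj_on_subset)
  have "w j < a \<longleftrightarrow> j < a" for j
  proof (cases "j < a + b")
    case True
    have "w j \<in> ?B \<longleftrightarrow> j \<in> ?B" using im inj by (metis inj_image_mem_iff)
    then show ?thesis using True Sym_in[OF assms(1), of j] by auto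
  next
    case False
    then show ?thesis using Sym_in[OF assms(1), of j] by auto
  qed
  then show ?thesis using assms(1) by (simp add: young_subgroup_def)
qed

lemma transpose_young_subgroup:
  assumes "p < a + b" "q < a + b" "p < a \<longleftrightarrow> q < a"
  shows "transpose p q \<in> young_subgroup a b"
  using assms by (auto simp: young_subgroup_def Sym_def transpose_def intro!: permutes_swap_id)


section \<open>Row and column symmetrizers\<close>

text \<open>In a two-row shape a column of length two holds j and a + j, and all others have length
  one. Hence the column permutations correspond to the sets \<open>J\<close> of swapped columns, and
  the sign is the parity of \<open>J\<close>.\<close>

definition col_swap :: "nat \<Rightarrow> nat set \<Rightarrow> nat \<Rightarrow> nat" where
  "col_swap a J i = (if i \<in> J then i + a else if a \<le> i \<and> i - a \<in> J then i - a else i)"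

lemma col_swap_involution: "J \<subseteq> {..<a} \<Longrightarrow> col_swap a J (col_swap a J i) = i"
  by (auto simp: col_swap_def)

lemma col_swap_comp_self: "J \<subseteq> {..<a} \<Longrightarrow> col_swap a J \<circ> col_swap a J = id"
  by (simp add: fun_eq_iff col_swap_involution)

lemma col_swap_empty [simp]: "col_swap a {} = id"
  by (simp add: fun_eq_iff col_swap_def)

lemma col_swap_Sym:
  assumes "J \<subseteq> {..<b}" "b \<le> a"
  shows "col_swap a J \<in> Sym (a + b)"
proof -
  have "J \<subseteq> {..<a}" using assms by auto
  note inv = col_swap_involution[OF this]
  have "\<exists>!x. col_swap a J x = y" for y
    by (metis inv)
  moreover have "col_swap a J x = x" if "\<not> x < a + b" for x
    using assms that by (auto simp: col_swap_def)
  ultimately show ?thesis by (auto simp: Sym_def permutes_def)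
qed

lemma inv_col_swap: "J \<subseteq> {..<a} \<Longrightarrow> inv (col_swap a J) = col_swap a J"
  by (rule inv_unique_comp) (simp_all add: col_swap_comp_self)

lemma col_swap_insert:
  assumes "j \<notin> J" "insert j J \<subseteq> {..<a}"
  shows "col_swap a (insert j J) = transpose j (a + j) \<circ> col_swap a J"
    and "col_swap a (insert j J) = col_swap a J \<circ> transpose j (a + j)"
  using assms by (auto simp: fun_eq_iff col_swap_def transpose_def)

lemma sign_col_swap:
  assumes "J \<subseteq> {..<a}"
  shows "sign (col_swap a J) = (- 1) ^ card J"
proof -
  have "finite J" using assms finite_subset by blast
  then show ?thesis using assms
  proof (induction J)
    case (insert j J)
    have "permutation (col_swap a J)"
      using insert.prems by (intro Sym_permutation[OF col_swap_Sym[of _ a]]) auto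
    then show ?case using insert
      by (simp add: col_swap_insert(1) sign_compose permutation_swap_id sign_swap_id del: o_apply)
  qed simp
qed

definition col_alt :: "nat \<Rightarrow> nat \<Rightarrow> (fperm \<Rightarrow>\<^sub>0 'k::field)" where
  "col_alt a b = (\<Sum>J\<in>Pow {..<b}. scal ((- 1) ^ card J) (basis (col_swap a J)))"

lemma star_col_alt:
  assumes "b \<le> a"
  shows "star (col_alt a b) = col_alt a b"
  unfolding col_alt_def star_sum
proof (rule sum.cong[OF HOL.refl])
  fix J assume "J \<in> Pow {..<b}"
  then have "J \<subseteq> {..<b}" "J \<subseteq> {..<a}" using assms by auto
  then show "star (scal ((- 1) ^ card J) (basis (col_swap a J))) =
      (scal ((- 1) ^ card J) (basis (col_swap a J)) :: _ \<Rightarrow>\<^sub>0 'a)"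
    using assms by (simp add: star_scal star_basis inv_col_swap Sym_permutation[OF col_swap_Sym])
qed

text \<open>Toggling membership of \<open>j\<close> in \<open>J\<close> is an involution on the
  summands that changes the sign.\<close>

lemma col_alt_transpose:
  assumes "j < b" "b \<le> a"
  shows "col_alt a b * basis (transpose j (a + j)) = - (col_alt a b :: _ \<Rightarrow>\<^sub>0 'k::field)"
proof -
  define flip where "flip J = (if j \<in> J then J - {j} else insert j J)" for J
  have flip: "flip (flip J) = J" for J by (auto simp: flip_def)
  have flip_Pow: "flip J \<in> Pow {..<b}" if "J \<in> Pow {..<b}" for J
    using that assms by (auto simp: flip_def)
  have t: "transpose j (a + j) \<in> Sym (a + b)"
    using assms by (auto simp: Sym_def intro!: permutes_swap_id)
  have eq: "scal ((- 1) ^ card J) (basis (col_swap a J)) * basis (transpose j (a + j)) =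
      - (scal ((- 1) ^ card (flip J)) (basis (col_swap a (flip J))) :: _ \<Rightarrow>\<^sub>0 'k)"
    if J: "J \<in> Pow {..<b}" for J
  proof -
    have fin: "finite J" using J finite_subset by auto
    have Ja: "J \<subseteq> {..<a}" using J assms by auto
    have "col_swap a J \<circ> transpose j (a + j) = col_swap a (flip J)"
    proof (cases "j \<in> J")
      case True
      then have "col_swap a J = col_swap a (flip J) \<circ> transpose j (a + j)"
        using col_swap_insert(2)[of j "J - {j}" a] Ja assms by (auto simp: flip_def insert_absorb)
      then show ?thesis by (simp add: o_assoc[symmetric])
    next
      case False
      then show ?thesis using col_swap_insert(2)[of j J a] Ja assms by (auto simp: flip_def)
    qed
    moreover have "(- 1) ^ card (flip J) = - ((- 1 :: 'k) ^ card J)"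
    proof (cases "j \<in> J")
      case True
      define n where "n = card (J - {j})"
      have "card J = Suc n" unfolding n_def by (simp only: card_Suc_Diff1[OF fin True])
      then show ?thesis using True by (simp add: flip_def n_def[symmetric] del: card_Diff_insert card_Diff_singleton)
    qed (use fin in \<open>simp add: flip_def\<close>)
    ultimately show ?thesis
      using J assms t col_swap_Sym[of J b a]
      by (simp add: mult_scal_left basis_mult_Sym galg.scale_minus_left)
  qed
  have "col_alt a b * basis (transpose j (a + j)) =
      (\<Sum>J\<in>Pow {..<b}. - (scal ((- 1) ^ card (flip J)) (basis (col_swap a (flip J))) :: _ \<Rightarrow>\<^sub>0 'k))"
    unfolding col_alt_def sum_distrib_right using eq by (rule sum.cong[OF HOL.refl])
  also have "\<dots> = - col_alt a b"
    unfolding col_alt_def sum_negf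
    by (rule arg_cong[of _ _ uminus], rule sum.reindex_bij_witness[of _ flip flip])
      (auto simp only: flip flip_Pow)
  finally show ?thesis .
qed

lemma col_alt_col_swap:
  assumes "J \<subseteq> {..<b}" "b \<le> a"
  shows "col_alt a b * basis (col_swap a J) = scal ((- 1) ^ card J) (col_alt a b :: _ \<Rightarrow>\<^sub>0 'k::field)"
proof -
  have "finite J" using assms finite_subset by blast
  then show ?thesis using assms(1)
  proof (induction J)
    case (insert j J)
    have t: "transpose j (a + j) \<in> Sym (a + b)"
      using insert.prems assms by (auto simp: Sym_def intro!: permutes_swap_id)
    have "basis (col_swap a (insert j J)) = (basis (transpose j (a + j)) * basis (col_swap a J) :: _ \<Rightarrow>\<^sub>0 'k)"
      using insert assms t col_swap_Sym[of J b a] by (subst col_swap_insert(1)) (auto simp: basis_mult_Sym)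
    then have "col_alt a b * basis (col_swap a (insert j J)) =
        - (col_alt a b * (basis (col_swap a J) :: _ \<Rightarrow>\<^sub>0 'k))"
      using insert.prems assms by (simp add: mult.assoc[symmetric] col_alt_transpose)
    then show ?case using insert by (simp add: galg.scale_minus_left)
  qed (simp add: basis_id)
qed

section \<open>Products of the form C w R\<close>

abbreviation row_sum :: "nat \<Rightarrow> nat \<Rightarrow> (fperm \<Rightarrow>\<^sub>0 'k::field)" where
  "row_sum a b \<equiv> gsum (young_subgroup a b)"

text \<open>If both cells of column \<open>j\<close> receive entries of one row, the transposition
  of these entries is absorbed by the row sum. Moved across \<open>w\<close> it becomes a column
  transposition, which \<open>col_alt\<close> turns into a sign; so the product equals its own
  negative. The two shapes may differ, because orthogonality rests on the same argument.\<close>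

lemma col_row_vanish:
  assumes w: "w \<in> Sym (a + b)" and N: "a + b = a' + b'" and j: "j < b" "b \<le> a"
    and eq: "inv w j < a' \<longleftrightarrow> inv w (a + j) < a'"
  shows "col_alt a b * basis w * row_sum a' b' = (0 :: _ \<Rightarrow>\<^sub>0 'k::field_char_0)"
proof -
  let ?p = "inv w j" and ?q = "inv w (a + j)" and ?t = "transpose j (a + j)"
  note bij = Sym_bij[OF w]
  have "?p < a' + b'" "?q < a' + b'"
    using Sym_in[OF Sym_inv[OF w]] j N by auto
  then have u: "transpose ?p ?q \<in> young_subgroup a' b'" using eq by (rule transpose_young_subgroup)
  have t: "?t \<in> Sym (a + b)" using j by (auto simp: Sym_def intro!: permutes_swap_id)
  have "w \<circ> transpose ?p ?q = ?t \<circ> w"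
  proof
    fix x
    have "w x = j \<longleftrightarrow> x = ?p" "w x = a + j \<longleftrightarrow> x = ?q" "w ?p = j" "w ?q = a + j"
      using bij_inv_eq_iff[OF bij] by metis+
    then show "(w \<circ> transpose ?p ?q) x = (?t \<circ> w) x"
      by (auto simp: transpose_def)
  qed
  then have "basis w * basis (transpose ?p ?q) = (basis ?t * basis w :: _ \<Rightarrow>\<^sub>0 'k)"
    using w t young_subgroup_Sym[OF u] N by (simp add: basis_mult_Sym)
  then have "col_alt a b * (basis w * (basis (transpose ?p ?q) * row_sum a' b')) =
      col_alt a b * (basis ?t * (basis w * row_sum a' b' :: _ \<Rightarrow>\<^sub>0 'k))"
    by (simp only: mult.assoc[symmetric])
  then have neg: "col_alt a b * basis w * row_sum a' b' =
      - (col_alt a b * basis w * row_sum a' b' :: _ \<Rightarrow>\<^sub>0 'k)"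
    by (simp add: gsum_absorb(1)[OF u] mult.assoc[symmetric] col_alt_transpose j)
  show ?thesis
  proof (rule poly_mapping_eqI)
    fix k
    let ?c = "Poly_Mapping.lookup (col_alt a b * basis w * row_sum a' b' :: _ \<Rightarrow>\<^sub>0 'k) k"
    have "?c = - ?c" by (subst (1) neg) simp
    then have "2 * ?c = 0" by (simp only: mult_2 eq_neg_iff_add_eq_0)
    then show "?c = Poly_Mapping.lookup 0 k" by simp
  qed
qed

text \<open>The columns whose first-row cell receives an entry of the second row: those that must be
  swapped to bring a transversal \<open>w\<close> back into the row group.\<close>

definition lower_set :: "nat \<Rightarrow> nat \<Rightarrow> (nat \<Rightarrow> nat) \<Rightarrow> nat set" where
  "lower_set a b w = {j. j < b \<and> a \<le> inv w j}"

definition transversal :: "nat \<Rightarrow> nat \<Rightarrow> (nat \<Rightarrow> nat) \<Rightarrow> bool" where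
  "transversal a b w \<longleftrightarrow> (\<forall>j<b. (inv w j < a) \<noteq> (inv w (a + j) < a))"

lemma transversal_factor:
  assumes w: "w \<in> Sym (a + b)" and "b \<le> a" and tr: "transversal a b w"
  shows "col_swap a (lower_set a b w) \<circ> w \<in> young_subgroup a b"
proof -
  let ?J = "lower_set a b w"
  have J: "?J \<subseteq> {..<b}" "?J \<subseteq> {..<a}" using assms by (auto simp: lower_set_def)
  note c = col_swap_Sym[OF J(1) \<open>b \<le> a\<close>]
  \<comment> \<open>The inverse is treated first, since \<open>lower_set\<close> and
    \<open>transversal\<close> speak of preimages.\<close>
  have "inv (col_swap a ?J \<circ> w) = inv w \<circ> col_swap a ?J"
    using Sym_bij[OF c] Sym_bij[OF w] J by (simp add: o_inv_distrib inv_col_swap)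
  moreover have "a \<le> inv w (col_swap a ?J i)" if "a \<le> i" "i < a + b" for i
  proof -
    define j where "j = i - a"
    have "i = a + j" "j < b" using that by (auto simp: j_def)
    then show ?thesis using tr J(2)
      by (auto simp: col_swap_def transversal_def) (auto simp: lower_set_def)
  qed
  ultimately have "inv (col_swap a ?J \<circ> w) \<in> young_subgroup a b"
    using c w by (intro young_subgroup_stable) (auto simp: Sym_comp Sym_inv)
  then have "inv (inv (col_swap a ?J \<circ> w)) \<in> young_subgroup a b" by (rule young_subgroup_inv)
  then show ?thesis using Sym_bij[OF Sym_comp[OF c w]] by (simp add: inv_inv_eq)
qed

text \<open>A transversal \<open>w\<close> equals c (c w) with c in the column group and c w in the
  row group: C absorbs the left factor with a sign, R absorbs the right one. Otherwise some column
  is bad and \<open>col_row_vanish\<close> applies.\<close>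

lemma col_row_factor:
  assumes w: "w \<in> Sym (a + b)" and ab: "b \<le> a"
  shows "col_alt a b * basis w * row_sum a b =
    (if transversal a b w then scal ((- 1) ^ card (lower_set a b w)) (col_alt a b * row_sum a b)
     else (0 :: _ \<Rightarrow>\<^sub>0 'k::field_char_0))"
proof (cases "transversal a b w")
  case True
  let ?c = "col_swap a (lower_set a b w)"
  have J: "lower_set a b w \<subseteq> {..<b}" "lower_set a b w \<subseteq> {..<a}"
    using assms by (auto simp: lower_set_def)
  note c = col_swap_Sym[OF J(1) ab]
  note cw = transversal_factor[OF w ab True]
  have "w = ?c \<circ> (?c \<circ> w)" using col_swap_comp_self[OF J(2)] by (simp add: o_assoc)
  then have "basis w = (basis ?c * basis (?c \<circ> w) :: _ \<Rightarrow>\<^sub>0 'k)"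
    using basis_mult_Sym[OF c young_subgroup_Sym[OF cw]] by metis
  then have "col_alt a b * basis w * row_sum a b =
      col_alt a b * basis ?c * (basis (?c \<circ> w) * row_sum a b :: _ \<Rightarrow>\<^sub>0 'k)"
    by (simp add: mult.assoc)
  then show ?thesis
    using True by (simp add: gsum_absorb(1)[OF cw] col_alt_col_swap[OF J(1) ab] mult_scal_left)
next
  case False
  then show ?thesis using col_row_vanish[OF w HOL.refl _ ab] by (auto simp: transversal_def)
qed

text \<open>The second-row entries that \<open>r \<circ> col_swap a K\<close> sends to the first row
  lie at r(K), and transversality keeps r(K) inside the columns of length two. So the sign coming
  from \<open>col_row_factor\<close> is the sign of the column swap, whatever \<open>r\<close>
  is.\<close>

lemma card_lower_set:
  assumes r: "r \<in> young_subgroup a b" and K: "K \<subseteq> {..<b}" and ab: "b \<le> a"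
    and tr: "transversal a b (r \<circ> col_swap a K)"
  shows "card (lower_set a b (r \<circ> col_swap a K)) = card K"
proof -
  let ?w = "r \<circ> col_swap a K" let ?J = "lower_set a b ?w"
  have Ka: "K \<subseteq> {..<a}" using K ab by auto
  have rS: "r \<in> Sym (a + b)" and w: "?w \<in> Sym (a + b)"
    using young_subgroup_Sym[OF r] col_swap_Sym[OF K ab] by (auto simp: Sym_comp)
  have bij: "bij r" using rS by (rule Sym_bij)
  have inv_w: "inv ?w = col_swap a K \<circ> inv r"
    using bij Sym_bij[OF col_swap_Sym[OF K ab]] by (simp add: o_inv_distrib inv_col_swap Ka)
  have inv_r: "inv r j < a \<longleftrightarrow> j < a" for j
    using young_subgroup_inv[OF r] by (simp add: young_subgroup_def)
  have cs: "a \<le> col_swap a K i \<longleftrightarrow> i \<in> K" if "i < a" for i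
    using that Ka by (auto simp: col_swap_def)
  have J: "?J = {j. j < b \<and> inv r j \<in> K}"
    unfolding lower_set_def inv_w using inv_r cs ab by auto
  \<comment> \<open>Otherwise the second-row entry \<open>a + k\<close> would land in a column of
    length one, which no column swap can repair.\<close>
  have "r k < b" if "k \<in> K" for k
  proof (rule ccontr)
    assume "\<not> r k < b"
    have "k < a" "r k < a" using that Ka r by (auto simp: young_subgroup_def)
    have "col_swap a ?J (r k) = r k"
      using \<open>\<not> r k < b\<close> \<open>r k < a\<close> J by (auto simp: col_swap_def)
    moreover have "?w (a + k) = r k" using that Ka by (auto simp: col_swap_def)
    moreover have "\<not> (col_swap a ?J \<circ> ?w) (a + k) < a"
      using transversal_factor[OF w ab tr] by (simp add: young_subgroup_def)
    ultimately show False using \<open>r k < a\<close> by simp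
  qed
  then have "?J = r ` K" unfolding J
    using bij by (auto simp: bij_is_inj inv_f_f image_iff) (metis bij_inv_eq_iff)
  then show ?thesis using card_image[OF inj_on_subset[OF bij_is_inj[OF bij] subset_UNIV]] by simp
qed

text \<open>Every summand of \<open>C R C R\<close> is either \<open>0\<close> or \<open>+ C R\<close>, so that no cancellation can occur.\<close>

lemma col_row_square:
  assumes ab: "b \<le> a"
  obtains N where "N \<noteq> 0"
    "col_alt a b * row_sum a b * (col_alt a b * row_sum a b) =
      scal (of_nat N) (col_alt a b * row_sum a b :: _ \<Rightarrow>\<^sub>0 'k::field_char_0)"
proof -
  let ?X = "young_subgroup a b \<times> Pow {..<b}"
  \<comment> \<open>The pairs with nonvanishing summand; \<open>N\<close> will be their
    number.\<close>
  define T where "T = {(r, K) \<in> ?X. transversal a b (r \<circ> col_swap a K)}"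
  let ?CR = "col_alt a b * row_sum a b :: _ \<Rightarrow>\<^sub>0 'k"
  have fin: "finite ?X" by simp
  have summand: "scal ((- 1) ^ card K) (col_alt a b * basis (r \<circ> col_swap a K) * row_sum a b) =
      (if (r, K) \<in> T then ?CR else 0)" if X: "(r, K) \<in> ?X" for r K
  proof -
    have "r \<circ> col_swap a K \<in> Sym (a + b)"
      using X ab col_swap_Sym[of K b a] by (auto simp: Sym_comp young_subgroup_Sym)
    \<comment> \<open>The sign in the definition of C and the sign from \<open>lower_set\<close>
      coincide, so their product is 1.\<close>
    from col_row_factor[OF this ab] show ?thesis
      using X card_lower_set[of r a b K] ab
      by (auto simp: T_def power_mult_distrib[symmetric])
  qed
  have "row_sum a b * col_alt a b = (\<Sum>(r, K)\<in>?X. scal ((- 1) ^ card K) (basis (r \<circ> col_swap a K) :: _ \<Rightarrow>\<^sub>0 'k))"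
    unfolding gsum_def col_alt_def sum_product sum.cartesian_product
    by (intro sum.cong HOL.refl)
      (auto simp: mult_scal_right basis_mult_Sym[OF young_subgroup_Sym col_swap_Sym] ab)
  moreover have "?CR * ?CR = col_alt a b * (row_sum a b * col_alt a b) * row_sum a b"
    by (simp only: mult.assoc)
  ultimately have "?CR * ?CR = col_alt a b *
      (\<Sum>(r, K)\<in>?X. scal ((- 1) ^ card K) (basis (r \<circ> col_swap a K))) * row_sum a b"
    by (simp only:)
  also have "\<dots> = (\<Sum>(r, K)\<in>?X. scal ((- 1) ^ card K) (col_alt a b * basis (r \<circ> col_swap a K) * row_sum a b))"
    by (simp add: sum_distrib_left sum_distrib_right mult_scal_right mult_scal_left case_prod_beta)
  also have "\<dots> = (\<Sum>x\<in>?X. if x \<in> T then ?CR else 0)"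
    by (intro sum.cong HOL.refl) (use summand in auto)
  also have "\<dots> = (\<Sum>x\<in>T. ?CR)"
    by (rule sum.mono_neutral_cong_right[OF fin]) (auto simp: T_def)
  also have "\<dots> = scal (of_nat (card T)) ?CR"
    by (simp add: scal_def)
  finally have "?CR * ?CR = scal (of_nat (card T)) ?CR" .
  \<comment> \<open>The trivial pair survives, so the count is not zero.\<close>
  moreover have "(id, {}) \<in> T" using ab by (auto simp: T_def transversal_def)
  moreover have "finite T" by (rule finite_subset[OF _ fin]) (auto simp: T_def)
  ultimately show thesis using that[of "card T"] by (metis card_0_eq empty_iff)
qed


section \<open>Young idempotents of two-row shapes\<close>

text \<open>The anti-involution \<open>w \<mapsto> w\<^sup>-\<^sup>1\<close> fixes \<open>R\<close> and \<open>C\<close>, so it turns \<open>C R C R\<close> into \<open>R C R C\<close>.\<close>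

lemma row_col_square:
  assumes ab: "b \<le> a"
  obtains N where "N \<noteq> 0"
    "row_sum a b * col_alt a b * (row_sum a b * col_alt a b) =
      scal (of_nat N) (row_sum a b * col_alt a b :: _ \<Rightarrow>\<^sub>0 'k::field_char_0)"
proof -
  obtain N where N: "N \<noteq> 0"
    "col_alt a b * row_sum a b * (col_alt a b * row_sum a b) =
      scal (of_nat N) (col_alt a b * row_sum a b :: _ \<Rightarrow>\<^sub>0 'k)"
    using col_row_square[OF ab] by blast
  from arg_cong[OF N(2), of star]
  have "row_sum a b * col_alt a b * (row_sum a b * col_alt a b) =
      scal (of_nat N) (row_sum a b * col_alt a b :: _ \<Rightarrow>\<^sub>0 'k)"
    by (simp add: star_mult star_scal star_gsum star_col_alt[OF ab] mult.assoc)
  with N(1) that show thesis by blast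
qed

section \<open>Row and column groups of a two-row tableau\<close>

lemma row_of_two:
  assumes "j < a + b"
  shows "row_of [a, b] j = (if j < a then 0 else 1)"
proof (cases "j < a")
  case True
  then show ?thesis unfolding row_of_def by (auto intro!: Least_equality)
next
  case False
  have "(LEAST i. j < sum_list (take (Suc i) [a, b])) = 1"
  proof (rule Least_equality)
    fix i assume "j < sum_list (take (Suc i) [a, b])"
    then show "1 \<le> i" using False by (cases i) auto
  qed (use assms in simp)
  then show ?thesis using False by (simp add: row_of_def)
qed

lemma col_of_two: "j < a + b \<Longrightarrow> col_of [a, b] j = (if j < a then j else j - a)"
  by (simp add: col_of_def row_of_two)

lemma emb_row_symmetrizer: "emb (a + b) (row_symmetrizer [a, b]) = row_sum a b"
proof -
  have "row_symmetrizer [a, b] w = (if w \<in> young_subgroup a b then 1 else 0 :: 'a)"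
    if w: "w \<in> Sym (a + b)" for w
  proof -
    have "row_of [a, b] (w j) = row_of [a, b] j \<longleftrightarrow> (w j < a \<longleftrightarrow> j < a)" if "j < a + b" for j
      using that Sym_in[OF w, of j] by (simp add: row_of_two)
    moreover have "w j < a \<longleftrightarrow> j < a" if "\<not> j < a + b" for j
      using that Sym_in[OF w, of j] by auto
    ultimately have "(\<forall>j<a + b. row_of [a, b] (w j) = row_of [a, b] j) \<longleftrightarrow> (\<forall>j. w j < a \<longleftrightarrow> j < a)"
      by blast
    then show ?thesis using w by (simp add: row_symmetrizer_def young_subgroup_def)
  qed
  then have "emb (a + b) (row_symmetrizer [a, b]) =
      (emb (a + b) (\<lambda>w. if w \<in> young_subgroup a b then 1 else 0) :: _ \<Rightarrow>\<^sub>0 'a)"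
    by (simp add: emb_def)
  also have "\<dots> = row_sum a b"
    by (subst emb_indicator) (auto simp: young_subgroup_Sym)
  finally show ?thesis .
qed

text \<open>Columns of length one are fixed, and each column of length two is fixed or swapped;
  \<open>J\<close> collects the swapped ones. Injectivity determines the images of the second-row
  cells from those of the first row.\<close>

lemma column_group:
  assumes w: "w \<in> Sym (a + b)" and ab: "b \<le> a"
  shows "(\<forall>j<a + b. col_of [a, b] (w j) = col_of [a, b] j) \<longleftrightarrow> w \<in> col_swap a ` Pow {..<b}"
proof
  assume col: "\<forall>j<a + b. col_of [a, b] (w j) = col_of [a, b] j"
  define J where "J = {j. j < b \<and> w j = j + a}"
  have inj: "w x = w y \<Longrightarrow> x = y" for x y using Sym_bij[OF w] by (auto dest: bij_is_inj injD)
  have c: "(if w j < a then w j else w j - a) = (if j < a then j else j - a)" if "j < a + b" for j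
    using col[rule_format, OF that] col_of_two[of j a b] col_of_two[of "w j" a b] that Sym_in[OF w, of j]
    by simp
  have "w i = col_swap a J i" for i
  proof -
    consider "a + b \<le> i" | "i < a" | "a \<le> i" "i < a + b" by linarith
    then show ?thesis
    proof cases
      case 1
      then have "w i = i" using w by (simp add: Sym_def permutes_not_in)
      then show ?thesis using 1 ab by (auto simp: col_swap_def J_def)
    next
      case 2
      then show ?thesis using c[of i] Sym_in[OF w, of i] ab
        by (auto simp: col_swap_def J_def split: if_splits)
    next
      case 3
      define j where "j = i - a"
      have i: "i = a + j" and j: "j < b" using 3 by (auto simp: j_def)
      have "w i = j \<or> w i = i" using c[OF 3(2)] i by (auto split: if_splits)
      moreover have "w j = j \<or> w j = i" using c[of j] i j ab by (auto split: if_splits)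
      ultimately have "w i = (if w j = i then j else i)"
        using inj[of i j] i j ab by auto
      then show ?thesis using i j ab by (auto simp: col_swap_def J_def add.commute)
    qed
  qed
  then have "w = col_swap a J" by auto
  then show "w \<in> col_swap a ` Pow {..<b}" by (auto simp: J_def)
next
  assume "w \<in> col_swap a ` Pow {..<b}"
  then obtain J where J: "w = col_swap a J" "J \<subseteq> {..<b}" by auto
  show "\<forall>j<a + b. col_of [a, b] (w j) = col_of [a, b] j"
    using Sym_in[OF w] J ab by (auto simp: col_of_two) (auto simp: col_swap_def)
qed

lemma inj_col_swap: "inj_on (col_swap a) (Pow {..<a})"
proof (rule inj_onI)
  fix J K assume "J \<in> Pow {..<a}" "K \<in> Pow {..<a}" and eq: "col_swap a J = col_swap a K"
  moreover have "j \<in> L \<longleftrightarrow> col_swap a L j \<noteq> j" if "j < a" "L \<in> Pow {..<a}" for j L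
    using that by (auto simp: col_swap_def)
  ultimately show "J = K" by (metis PowD lessThan_iff subsetD subsetI subset_antisym)
qed

lemma emb_column_antisymmetrizer:
  assumes ab: "b \<le> a"
  shows "emb (a + b) (column_antisymmetrizer [a, b]) = (col_alt a b :: _ \<Rightarrow>\<^sub>0 'k::field)"
proof -
  have "emb (a + b) (column_antisymmetrizer [a, b]) =
      (\<Sum>w\<in>Sym (a + b). if w \<in> col_swap a ` Pow {..<b} then scal (of_int (sign w)) (basis w) else (0 :: _ \<Rightarrow>\<^sub>0 'k))"
    using column_group[OF _ ab] by (auto simp: emb_def column_antisymmetrizer_def intro!: sum.cong)
  also have "\<dots> = (\<Sum>w\<in>col_swap a ` Pow {..<b}. scal (of_int (sign w)) (basis w))"
    by (rule sum.mono_neutral_cong_right) (auto intro: col_swap_Sym ab)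
  also have "\<dots> = (\<Sum>J\<in>Pow {..<b}. scal (of_int (sign (col_swap a J))) (basis (col_swap a J)))"
    by (rule sum.reindex_cong[OF inj_on_subset[OF inj_col_swap]]) (use ab in auto)
  also have "\<dots> = col_alt a b"
    unfolding col_alt_def
    by (rule sum.cong[OF HOL.refl], subst sign_col_swap) (use ab in auto)
  finally show ?thesis .
qed

lemma emb_young_symmetrizer:
  "b \<le> a \<Longrightarrow> emb (a + b) (young_symmetrizer [a, b]) = row_sum a b * col_alt a b"
  by (simp add: young_symmetrizer_def emb_gmult emb_row_symmetrizer emb_column_antisymmetrizer)

text \<open>The coefficient of the identity is 1, since the row group and the column group meet
  trivially.\<close>

lemma row_col_nonzero:
  assumes ab: "b \<le> a"
  shows "row_sum a b * col_alt a b \<noteq> (0 :: _ \<Rightarrow>\<^sub>0 'k::field)"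
proof -
  let ?X = "young_subgroup a b \<times> Pow {..<b}"
  define f where "f x = (case x of (r, K) \<Rightarrow>
      scal ((- 1) ^ card K) (basis (r \<circ> col_swap a K) :: _ \<Rightarrow>\<^sub>0 'k))" for x
  have "row_sum a b * col_alt a b = (\<Sum>x\<in>?X. f x)"
    unfolding gsum_def col_alt_def sum_product sum.cartesian_product f_def
    by (intro sum.cong HOL.refl)
      (auto simp: mult_scal_right basis_mult_Sym[OF young_subgroup_Sym col_swap_Sym] ab)
  then have "Poly_Mapping.lookup (row_sum a b * col_alt a b) (Fperm id) =
      (\<Sum>x\<in>?X. Poly_Mapping.lookup (f x) (Fperm id))"
    by (simp only: lookup_sum)
  also have "\<dots> = (\<Sum>x\<in>{(id :: nat \<Rightarrow> nat, {} :: nat set)}. 1)"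
  proof (rule sum.mono_neutral_cong_right)
    show "\<forall>x\<in>?X - {(id, {})}. Poly_Mapping.lookup (f x) (Fperm id) = 0"
    proof
      fix x assume x: "x \<in> ?X - {(id, {})}"
      obtain r K where rK: "x = (r, K)" by (cases x)
      then have r: "r \<in> young_subgroup a b" and K: "K \<subseteq> {..<b}" and neq: "\<not> (r = id \<and> K = {})"
        using x by auto
      have Ka: "K \<subseteq> {..<a}" using K ab by auto
      have "r \<circ> col_swap a K \<noteq> id"
      proof
        assume id: "r \<circ> col_swap a K = id"
        have "K = {}"
        proof (rule ccontr)
          assume "K \<noteq> {}"
          then obtain j where j: "j \<in> K" by auto
          then have "j < a" using Ka by auto
          \<comment> \<open>\<open>r\<close> preserves rows, so it cannot bring a second-row cell to
            the first row.\<close>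
          have "r (j + a) = j" using fun_cong[OF id, of j] j by (simp add: col_swap_def)
          moreover have "r (j + a) < a \<longleftrightarrow> j + a < a" using r by (simp add: young_subgroup_def)
          ultimately show False using \<open>j < a\<close> by simp
        qed
        then show False using id neq by simp
      qed
      moreover have "permutation (r \<circ> col_swap a K)"
        using r K ab by (intro Sym_permutation[OF Sym_comp[OF young_subgroup_Sym col_swap_Sym]])
      ultimately show "Poly_Mapping.lookup (f x) (Fperm id) = 0"
        by (simp add: rK f_def lookup_basis del: o_apply)
    qed
  qed (simp_all add: lookup_basis f_def)
  finally have "Poly_Mapping.lookup (row_sum a b * col_alt a b) (Fperm id) = (1 :: 'k)" by simp
  then show ?thesis by (metis lookup_zero zero_neq_one)
qed

lemma eq_if_emb_eq:
  assumes "emb r a = emb r b" "\<And>w. w \<notin> Sym r \<Longrightarrow> a w = b w"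
  shows "a = b"
  using assms emb_inject by blast

text \<open>From Y Y = N Y with Y = R C nonzero, a multiple d Y is idempotent exactly if d d N = d.
  So 1/N is the only nonzero solution, and the definite description in \<open>young_scalar\<close>
  picks it.\<close>

lemma young_idempotent_emb:
  assumes ab: "b \<le> a"
  obtains c where "c \<noteq> 0"
    "emb (a + b) (young_idempotent [a, b]) = scal c (row_sum a b * col_alt a b :: _ \<Rightarrow>\<^sub>0 'k::field_char_0)"
    "scal c (row_sum a b * col_alt a b) * scal c (row_sum a b * col_alt a b) =
      (scal c (row_sum a b * col_alt a b) :: _ \<Rightarrow>\<^sub>0 'k)"
proof -
  let ?Y = "row_sum a b * col_alt a b :: _ \<Rightarrow>\<^sub>0 'k"
  obtain N where N: "N \<noteq> 0" "?Y * ?Y = scal (of_nat N) ?Y"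
    using row_col_square[OF ab] by blast
  let ?c = "1 / of_nat N :: 'k"
  have sq: "scal d ?Y * scal d ?Y = scal (d * d * of_nat N) ?Y" for d
    by (simp add: mult_scal_left mult_scal_right N(2) mult.assoc[where ?'a = 'k])
  have sum: "sum_list [a, b] = a + b" by simp
  have "young_scalar [a, b] = ?c"
    unfolding young_scalar_def
  proof (rule the_equality)
    show "?c \<noteq> 0 \<and> gmult (sum_list [a, b]) (\<lambda>w. ?c * young_symmetrizer [a, b] w)
        (\<lambda>w. ?c * young_symmetrizer [a, b] w) = (\<lambda>w. ?c * young_symmetrizer [a, b] w)"
    proof
      show "gmult (sum_list [a, b]) (\<lambda>w. ?c * young_symmetrizer [a, b] w)
        (\<lambda>w. ?c * young_symmetrizer [a, b] w) = (\<lambda>w. ?c * young_symmetrizer [a, b] w)"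
      proof (rule eq_if_emb_eq[of "a + b"])
        show "emb (a + b) (gmult (sum_list [a, b]) (\<lambda>w. ?c * young_symmetrizer [a, b] w)
            (\<lambda>w. ?c * young_symmetrizer [a, b] w)) = emb (a + b) (\<lambda>w. ?c * young_symmetrizer [a, b] w)"
          unfolding sum emb_gmult emb_scal emb_young_symmetrizer[OF ab] sq using N(1) by simp
      \<comment> \<open>\<open>gmult\<close> is zero outside S_r, so both functions agree there as
        well.\<close>
      qed (simp add: gmult_def young_symmetrizer_def)
    qed (use N in simp)
  next
    fix d :: 'k
    assume d: "d \<noteq> 0 \<and> gmult (sum_list [a, b]) (\<lambda>w. d * young_symmetrizer [a, b] w)
        (\<lambda>w. d * young_symmetrizer [a, b] w) = (\<lambda>w. d * young_symmetrizer [a, b] w)"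
    then have "emb (a + b) (gmult (a + b) (\<lambda>w. d * young_symmetrizer [a, b] w)
        (\<lambda>w. d * young_symmetrizer [a, b] w)) = emb (a + b) (\<lambda>w. d * young_symmetrizer [a, b] w)"
      by simp
    then have "scal (d * d * of_nat N) ?Y = scal d ?Y"
      by (simp only: emb_gmult emb_scal emb_young_symmetrizer[OF ab] sq)
    then have "d * d * of_nat N = d"
      using row_col_nonzero[OF ab, where ?'k = 'k] by (simp add: galg.scale_cancel_right)
    then show "d = ?c" using d N(1) by (simp add: field_simps)
  qed
  then have "emb (a + b) (young_idempotent [a, b]) = scal ?c ?Y"
    by (simp only: young_idempotent_def emb_scal emb_young_symmetrizer[OF ab])
  moreover have "scal ?c ?Y * scal ?c ?Y = scal ?c ?Y" using sq[of ?c] N(1) by simp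
  ultimately show thesis using that[of ?c] N(1) by simp
qed


section \<open>Products with the symmetrizer of a Young subgroup\<close>

lemma permutes_if_inverse:
  assumes "\<And>x. x \<notin> S \<Longrightarrow> p x = x" "\<And>x. p (q x) = x" "\<And>x. q (p x) = x"
  shows "p permutes S"
  unfolding permutes_def using assms by metis

lemma juxtapose_comp:
  assumes "u' \<in> Sym m"
  shows "juxtapose m u v (juxtapose m u' v' i) = juxtapose m (u \<circ> u') (v \<circ> v') i"
  using Sym_in[OF assms, of i] by (auto simp: juxtapose_def)

lemma juxtapose_id: "juxtapose m id id = id"
  by (auto simp: juxtapose_def)

lemma juxtapose_young_subgroup:
  assumes "u \<in> Sym m" "v \<in> Sym n"
  shows "juxtapose m u v \<in> young_subgroup m n"
proof -
  have inv: "inv u \<in> Sym m" "inv v \<in> Sym n" using assms by (auto intro: Sym_inv)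
  have "juxtapose m u v permutes {..<m + n}"
  proof (rule permutes_if_inverse[of _ _ "juxtapose m (inv u) (inv v)"])
    show "juxtapose m u v x = x" if "x \<notin> {..<m + n}" for x
      using that assms(2) permutes_not_in[of v "{..<n}" "x - m"] by (auto simp: juxtapose_def Sym_def)
  qed (simp_all add: juxtapose_comp[OF inv(1)] juxtapose_comp[OF assms(1)] Sym_inv_comp[OF assms(1)]
      Sym_inv_comp[OF assms(2)] juxtapose_id del: o_apply)
  moreover have "juxtapose m u v j < m \<longleftrightarrow> j < m" for j
    using Sym_in[OF assms(1), of j] by (simp add: juxtapose_def)
  ultimately show ?thesis by (simp add: young_subgroup_def Sym_def)
qed

lemma juxtapose_split:
  assumes w: "w \<in> young_subgroup m n"
  shows "(\<lambda>i. if i < m then w i else i) \<in> Sym m" "(\<lambda>i. w (m + i) - m) \<in> Sym n"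
    "juxtapose m (\<lambda>i. if i < m then w i else i) (\<lambda>i. w (m + i) - m) = w"
proof -
  have le: "w j < m \<longleftrightarrow> j < m" "inv w j < m \<longleftrightarrow> j < m" for j
    using w young_subgroup_inv[OF w] by (auto simp: young_subgroup_def)
  have le': "m \<le> w (m + j)" "m \<le> inv w (m + j)" for j
    using le[of "m + j"] by auto
  have bij: "w (inv w x) = x" "inv w (w x) = x" for x
    using Sym_bij[OF young_subgroup_Sym[OF w]] by (simp_all add: bij_is_inj bij_is_surj surj_f_inv_f)
  have "(\<lambda>i. if i < m then w i else i) permutes {..<m}"
    by (rule permutes_if_inverse[of _ _ "\<lambda>i. if i < m then inv w i else i"]) (auto simp: le bij)
  then show "(\<lambda>i. if i < m then w i else i) \<in> Sym m" by (simp add: Sym_def)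
  have "(\<lambda>i. w (m + i) - m) permutes {..<n}"
  proof (rule permutes_if_inverse[of _ _ "\<lambda>i. inv w (m + i) - m"])
    show "w (m + x) - m = x" if "x \<notin> {..<n}" for x
      using that w permutes_not_in[of w "{..<m + n}" "m + x"] by (auto simp: young_subgroup_def Sym_def)
  qed (simp_all add: le' bij)
  then show "(\<lambda>i. w (m + i) - m) \<in> Sym n" by (simp add: Sym_def)
  have "m + (w (m + (i - m)) - m) = w i" if "\<not> i < m" for i
    using that le'(1)[of "i - m"] by simp
  then show "juxtapose m (\<lambda>i. if i < m then w i else i) (\<lambda>i. w (m + i) - m) = w"
    by (auto simp: juxtapose_def)
qed

lemma inj_on_juxtapose: "inj_on (\<lambda>(u, v). juxtapose m u v) (Sym m \<times> Sym n)"
proof (rule inj_onI, safe)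
  fix u v u' v'
  assume u: "u \<in> Sym m" "u' \<in> Sym m" and eq: "juxtapose m u v = juxtapose m u' v'"
  show "u = u'"
  proof
    fix i
    show "u i = u' i"
    proof (cases "i < m")
      case True
      then show ?thesis using fun_cong[OF eq, of i] by (simp add: juxtapose_def)
    next
      case False
      then have "u i = i" "u' i = i" using u by (auto simp: Sym_def intro!: permutes_not_in)
      then show ?thesis by simp
    qed
  qed
  show "v = v'"
  proof
    fix i
    show "v i = v' i" using fun_cong[OF eq, of "m + i"] by (simp add: juxtapose_def)
  qed
qed

lemma bij_betw_juxtapose:
  "bij_betw (\<lambda>(u, v). juxtapose m u v) (Sym m \<times> Sym n) (young_subgroup m n)"
proof -
  have "young_subgroup m n \<subseteq> (\<lambda>(u, v). juxtapose m u v) ` (Sym m \<times> Sym n)"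
  proof
    fix w assume w: "w \<in> young_subgroup m n"
    show "w \<in> (\<lambda>(u, v). juxtapose m u v) ` (Sym m \<times> Sym n)"
      using juxtapose_split[OF w]
      by (intro image_eqI[of _ _ "(\<lambda>i. if i < m then w i else i, \<lambda>i. w (m + i) - m)"]) auto
  qed
  moreover have "(\<lambda>(u, v). juxtapose m u v) ` (Sym m \<times> Sym n) \<subseteq> young_subgroup m n"
    by (auto intro: juxtapose_young_subgroup)
  ultimately show ?thesis unfolding bij_betw_def by (simp add: inj_on_juxtapose subset_antisym)
qed

lemma card_Sym: "card (Sym r) = fact r"
  by (simp add: Sym_def card_permutations[of "{..<r}" r])

lemma card_young_subgroup: "card (young_subgroup m n) = fact m * fact n"
  using bij_betw_same_card[OF bij_betw_juxtapose, of m n] by (simp add: card_cartesian_product card_Sym)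

text \<open>The second row of (m+n-s, s) consists of the last s of the last n strands, so the
  intersection is S_m x S_{n-s} x S_s. Its index in S_m x S_n is \<open>n choose s\<close>, the
  origin of the scalar in \<open>iota\<close>.\<close>

lemma card_young_subgroup_Int:
  assumes "s \<le> n"
  shows "card (young_subgroup m n \<inter> young_subgroup (m + n - s) s) = fact m * (fact (n - s) * fact s)"
proof -
  let ?S = "Sym m \<times> young_subgroup (n - s) s"
  have sub: "?S \<subseteq> Sym m \<times> Sym n"
    using young_subgroup_Sym[of _ "n - s" s] assms by auto
  have mem: "juxtapose m u v \<in> young_subgroup (m + n - s) s \<longleftrightarrow> v \<in> young_subgroup (n - s) s"
    if "u \<in> Sym m" "v \<in> Sym n" for u v
  proof -
    have "juxtapose m u v \<in> Sym (m + n)"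
      using juxtapose_young_subgroup[OF that] by (rule young_subgroup_Sym)
    moreover have "(\<forall>i. juxtapose m u v i < m + n - s \<longleftrightarrow> i < m + n - s) \<longleftrightarrow>
        (\<forall>i. v i < n - s \<longleftrightarrow> i < n - s)"
    proof safe
      fix i assume *: "\<forall>i. juxtapose m u v i < m + n - s \<longleftrightarrow> i < m + n - s"
      show "v i < n - s" if "i < n - s" using that *[rule_format, of "m + i"] by (simp add: juxtapose_def) arith
      show "i < n - s" if "v i < n - s" using that *[rule_format, of "m + i"] by (simp add: juxtapose_def) arith
    next
      fix i assume *: "\<forall>i. v i < n - s \<longleftrightarrow> i < n - s"
      have "juxtapose m u v i < m + n - s \<longleftrightarrow> i < m + n - s"
        using *[rule_format, of "i - m"] Sym_in[OF that(1), of i] assms by (auto simp: juxtapose_def)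
      then show "i < m + n - s \<Longrightarrow> juxtapose m u v i < m + n - s"
        "juxtapose m u v i < m + n - s \<Longrightarrow> i < m + n - s" by blast+
    qed
    ultimately show ?thesis using that(2) assms by (simp add: young_subgroup_def)
  qed
  have "young_subgroup m n \<inter> young_subgroup (m + n - s) s = (\<lambda>(u, v). juxtapose m u v) ` ?S"
  proof (intro equalityI subsetI)
    fix w assume w: "w \<in> young_subgroup m n \<inter> young_subgroup (m + n - s) s"
    then obtain u v where uv: "u \<in> Sym m" "v \<in> Sym n" "w = juxtapose m u v"
      using juxtapose_split[of w m n] by (metis IntD1)
    then have "v \<in> young_subgroup (n - s) s" using w mem by auto
    then show "w \<in> (\<lambda>(u, v). juxtapose m u v) ` ?S" using uv by auto
  next
    fix w assume "w \<in> (\<lambda>(u, v). juxtapose m u v) ` ?S"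
    then obtain u v where uv: "u \<in> Sym m" "v \<in> young_subgroup (n - s) s" "w = juxtapose m u v" by auto
    then have "v \<in> Sym n" using sub by auto
    then show "w \<in> young_subgroup m n \<inter> young_subgroup (m + n - s) s"
      using uv mem juxtapose_young_subgroup by auto
  qed
  then show ?thesis
    using card_image[OF inj_on_subset[OF inj_on_juxtapose sub]]
    by (simp add: card_cartesian_product card_Sym card_young_subgroup)
qed

text \<open>The element h of the overview; \<open>represents_h_mor_tensor\<close> identifies its
  action.\<close>

definition block_sym :: "nat \<Rightarrow> nat \<Rightarrow> (fperm \<Rightarrow>\<^sub>0 'k::field_char_0)" where
  "block_sym m n = scal (1 / (fact m * fact n)) (row_sum m n)"

lemma block_sym_absorb:
  assumes "w \<in> young_subgroup m n"
  shows "basis w * block_sym m n = block_sym m n" "block_sym m n * basis w = block_sym m n"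
  using gsum_absorb[OF assms] by (simp_all add: block_sym_def mult_scal_right mult_scal_left)

lemma block_sym_expand:
  "x * block_sym m n * y = scal (1 / (fact m * fact n)) (\<Sum>w\<in>young_subgroup m n. x * basis w * y)"
  by (simp add: block_sym_def gsum_def sum_distrib_left sum_distrib_right mult_scal_left mult_scal_right)

lemma sum_const_scal: "(\<Sum>w\<in>S. z) = scal (of_nat (card S)) z"
  by (simp add: scal_def)

lemma block_sym_idem: "block_sym m n * block_sym m n = (block_sym m n :: _ \<Rightarrow>\<^sub>0 'k::field_char_0)"
proof -
  have "1 * block_sym m n * block_sym m n = scal (1 / (fact m * fact n)) (\<Sum>w\<in>young_subgroup m n. block_sym m n :: _ \<Rightarrow>\<^sub>0 'k)"
    unfolding block_sym_expand by (simp add: block_sym_absorb(1))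
  then show ?thesis unfolding sum_const_scal by (simp add: card_young_subgroup)
qed

lemma col_block_sym_row:
  assumes "s \<le> n" "n \<le> m"
  shows "col_alt (m + n - s) s * block_sym m n * row_sum (m + n - s) s =
    scal (1 / of_nat (n choose s)) (col_alt (m + n - s) s * row_sum (m + n - s) s :: _ \<Rightarrow>\<^sub>0 'k::field_char_0)"
proof -
  let ?a = "m + n - s"
  let ?C = "col_alt ?a s :: _ \<Rightarrow>\<^sub>0 'k" and ?R = "row_sum ?a s :: _ \<Rightarrow>\<^sub>0 'k"
  let ?I = "young_subgroup m n \<inter> young_subgroup ?a s"
  have N: "?a + s = m + n" using assms by simp
  have summand: "?C * basis w * ?R = (if w \<in> ?I then ?C * ?R else 0)" if w: "w \<in> young_subgroup m n" for w
  proof (cases "w \<in> young_subgroup ?a s")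
    case True
    then show ?thesis using w by (simp add: mult.assoc gsum_absorb(1))
  next
    case False
    have wS: "w \<in> Sym (?a + s)" using young_subgroup_Sym[OF w] N by simp
    have "inv w \<notin> young_subgroup ?a s"
      using False young_subgroup_inv[of "inv w" ?a s] Sym_bij[OF wS] by (auto simp: inv_inv_eq)
    then obtain z where z: "?a \<le> z" "z < ?a + s" "inv w z < ?a"
      using young_subgroup_stable[OF Sym_inv[OF wS]] by (meson not_le)
    define j where "j = z - ?a"
    have j: "z = ?a + j" "j < s" using z by (auto simp: j_def)
    \<comment> \<open>The upper cell of column \<open>j\<close> is among the first \<open>m\<close>
      strands because \<open>j < s \<le> n \<le> m\<close>, and \<open>w\<close> preserves these.
      Hence both cells of the column receive first-row entries and the summand vanishes.\<close>
    have "inv w j < m"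
      using young_subgroup_inv[OF w] j assms by (simp add: young_subgroup_def)
    then have "inv w j < ?a \<longleftrightarrow> inv w (?a + j) < ?a" using z j assms by auto
    then have "?C * basis w * ?R = 0"
      using j assms by (intro col_row_vanish[OF wS HOL.refl]) auto
    then show ?thesis using False by simp
  qed
  have "?C * block_sym m n * ?R = scal (1 / (fact m * fact n)) (\<Sum>w\<in>young_subgroup m n. ?C * basis w * ?R)"
    by (rule block_sym_expand)
  also have "(\<Sum>w\<in>young_subgroup m n. ?C * basis w * ?R) = (\<Sum>w\<in>?I. ?C * ?R)"
    by (rule sum.mono_neutral_cong_right) (use summand in auto)
  also have "\<dots> = scal (of_nat (card ?I)) (?C * ?R)" by (rule sum_const_scal)
  also have "scal (1 / (fact m * fact n)) \<dots> = scal (1 / of_nat (n choose s)) (?C * ?R)"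
  proof -
    have "of_nat (fact s * fact (n - s) * (n choose s)) = (fact n :: 'k)"
      unfolding binomial_fact_lemma[OF assms(1)] by simp
    then have "1 / (fact m * fact n) * of_nat (card ?I) = (1 / of_nat (n choose s) :: 'k)"
      using assms by (simp add: card_young_subgroup_Int divide_simps binomial_eq_0_iff mult.commute)
    then show ?thesis by simp
  qed
  finally show ?thesis .
qed

section \<open>Young idempotents and their products\<close>

definition young_idem :: "nat \<Rightarrow> nat \<Rightarrow> (fperm \<Rightarrow>\<^sub>0 'k::field)" where
  "young_idem a b = emb (a + b) (young_idempotent [a, b])"

lemma young_idem_idem: "b \<le> a \<Longrightarrow> young_idem a b * young_idem a b = (young_idem a b :: _ \<Rightarrow>\<^sub>0 'k::field_char_0)"
  using young_idempotent_emb[of b a, where ?'k = 'k] by (metis young_idem_def)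

lemma young_idem_nonzero:
  assumes "b \<le> a"
  shows "young_idem a b \<noteq> (0 :: _ \<Rightarrow>\<^sub>0 'k::field_char_0)"
  using young_idempotent_emb[OF assms, where ?'k = 'k] row_col_nonzero[OF assms, where ?'k = 'k]
  by (metis young_idem_def galg.scale_eq_0_iff)

lemma young_idem_block_sym_young_idem:
  assumes "s \<le> n" "n \<le> m"
  shows "young_idem (m + n - s) s * block_sym m n * young_idem (m + n - s) s =
    scal (1 / of_nat (n choose s)) (young_idem (m + n - s) s :: _ \<Rightarrow>\<^sub>0 'k::field_char_0)"
proof -
  let ?a = "m + n - s"
  have le: "s \<le> ?a" using assms by simp
  let ?C = "col_alt ?a s :: _ \<Rightarrow>\<^sub>0 'k" and ?R = "row_sum ?a s :: _ \<Rightarrow>\<^sub>0 'k"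
  obtain c where c: "c \<noteq> 0" "young_idem ?a s = scal c (?R * ?C)"
    "scal c (?R * ?C) * scal c (?R * ?C) = scal c (?R * ?C)"
    using young_idempotent_emb[OF le, where ?'k = 'k] unfolding young_idem_def by metis
  \<comment> \<open>With e = c R C the middle of e h e is C h R, which collapses to a multiple of C
    R; what remains is that multiple of e e.\<close>
  have "young_idem ?a s * block_sym m n * young_idem ?a s = scal (c * c) (?R * (?C * block_sym m n * ?R) * ?C)"
    by (simp add: c(2) mult_scal_left mult_scal_right mult.assoc)
  also have "\<dots> = scal (1 / of_nat (n choose s)) (scal c (?R * ?C) * scal c (?R * ?C))"
    unfolding col_block_sym_row[OF assms]
    by (simp add: mult_scal_left mult_scal_right mult.assoc mult.commute mult.left_commute)
  finally show ?thesis by (simp only: c)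
qed

text \<open>The middle factor is confined to k[S_{a+b}], since the count of cells below needs
  permutations of exactly these strands.\<close>

lemma col_row_orthogonal:
  assumes N: "a + b = a' + b'" and "b' < b" "b \<le> a"
  shows "col_alt a b * emb (a + b) f * row_sum a' b' = (0 :: _ \<Rightarrow>\<^sub>0 'k::field_char_0)"
proof -
  have "col_alt a b * basis w * row_sum a' b' = (0 :: _ \<Rightarrow>\<^sub>0 'k)" if w: "w \<in> Sym (a + b)" for w
  proof -
    have "\<exists>j<b. inv w j < a' \<and> inv w (a + j) < a'"
    proof (rule ccontr)
      assume "\<not> ?thesis"
      then have neg: "j < b \<Longrightarrow> \<not> (inv w j < a' \<and> inv w (a + j) < a')" for j by blast
      \<comment> \<open>If no column has both preimages in the first row of the other shape,
        \<open>g\<close> selects from each column a preimage in its second row, which has only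
        \<open>b'\<close> cells for \<open>b\<close> columns.\<close>
      define g where "g j = (if inv w j < a' then inv w (a + j) else inv w j)" for j
      have inj: "inv w x = inv w y \<longleftrightarrow> x = y" for x y
        using Sym_bij[OF Sym_inv[OF w]] by (auto dest: bij_is_inj injD)
      have "inj_on g {..<b}"
        using assms(3) by (auto simp: inj_on_def g_def inj split: if_splits)
      moreover have "g ` {..<b} \<subseteq> {a'..<a' + b'}"
      proof
        fix y assume "y \<in> g ` {..<b}"
        then obtain j where j: "j < b" "y = g j" by auto
        have "inv w j < a + b" "inv w (a + j) < a + b"
          using j assms(3) Sym_in[OF Sym_inv[OF w]] by auto
        then show "y \<in> {a'..<a' + b'}" using neg[OF j(1)] j(2) N by (auto simp: g_def)
      qed
      ultimately have "card {..<b} \<le> card {a'..<a' + b'}" by (intro card_inj_on_le) auto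
      then show False using assms(2) by simp
    qed
    then show ?thesis using col_row_vanish[OF w N _ assms(3)] by blast
  qed
  then show ?thesis
    by (simp add: emb_def sum_distrib_left sum_distrib_right mult_scal_left mult_scal_right)
qed

lemma star_emb: "star (emb r f) = emb r (\<lambda>w. f (inv w))"
  unfolding emb_def star_sum
  by (rule sum.reindex_bij_witness[of _ inv inv])
    (auto simp: star_scal star_basis Sym_inv inv_inv_eq[OF Sym_bij])

text \<open>The mirror image of \<open>col_row_orthogonal\<close>: \<open>star\<close> reverses the
  product and keeps the middle factor of the form \<open>emb (a + b) f\<close>.\<close>

lemma row_col_orthogonal:
  assumes N: "a + b = a' + b'" and "b' < b" "b \<le> a"
  shows "row_sum a' b' * emb (a + b) f * col_alt a b = (0 :: _ \<Rightarrow>\<^sub>0 'k::field_char_0)"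
proof -
  have "star (row_sum a' b' * emb (a + b) f * col_alt a b) = (0 :: _ \<Rightarrow>\<^sub>0 'k)"
    using col_row_orthogonal[OF assms, of "\<lambda>w. f (inv w)"]
    by (simp add: star_mult star_gsum star_col_alt[OF assms(3)] star_emb mult.assoc)
  then have "star (star (row_sum a' b' * emb (a + b) f * col_alt a b)) = (star 0 :: _ \<Rightarrow>\<^sub>0 'k)" by simp
  moreover have "star (star x) = x" "star 0 = (0 :: _ \<Rightarrow>\<^sub>0 'k)" for x :: "_ \<Rightarrow>\<^sub>0 'k"
    by (auto intro!: poly_mapping_eqI simp: star_def map_key.rep_eq)
  ultimately show ?thesis by simp
qed

text \<open>If \<open>b' < b\<close>, the inner part C x R' vanishes. Otherwise C x R' is merely
  some element of the group algebra, and the outer pair R and C' annihilates everything.\<close>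

lemma young_idem_orthogonal:
  assumes N: "a + b = a' + b'" and "b \<le> a" "b' \<le> a'" "b \<noteq> b'"
  shows "young_idem a b * emb (a + b) f * young_idem a' b' = (0 :: _ \<Rightarrow>\<^sub>0 'k::field_char_0)"
proof -
  obtain c where c: "young_idem a b = scal c (row_sum a b * col_alt a b :: _ \<Rightarrow>\<^sub>0 'k)"
    using young_idempotent_emb[OF assms(2), where ?'k = 'k] unfolding young_idem_def by metis
  obtain c' where c': "young_idem a' b' = scal c' (row_sum a' b' * col_alt a' b' :: _ \<Rightarrow>\<^sub>0 'k)"
    using young_idempotent_emb[OF assms(3), where ?'k = 'k] unfolding young_idem_def by metis
  show ?thesis
  proof (cases "b' < b")
    case True
    have "young_idem a b * emb (a + b) f * young_idem a' b' =
        scal (c * c') (row_sum a b * (col_alt a b * emb (a + b) f * row_sum a' b') * col_alt a' b')"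
      by (simp add: c c' mult_scal_left mult_scal_right mult.assoc)
    then show ?thesis by (simp add: col_row_orthogonal[OF N True assms(2)])
  next
    case False
    then have lt: "b < b'" using assms(4) by simp
    \<comment> \<open>The inner part is exhibited in the form that \<open>row_col_orthogonal\<close>
      accepts as its middle factor.\<close>
    obtain g where g: "col_alt a b * emb (a + b) f * row_sum a' b' = (emb (a' + b') g :: _ \<Rightarrow>\<^sub>0 'k)"
    proof
      let ?h = "\<lambda>w. if w \<in> young_subgroup a' b' then 1 else (0 :: 'k)"
      have "emb (a' + b') ?h = scal 1 (row_sum a' b')"
        by (rule emb_indicator) (auto simp: young_subgroup_Sym)
      then show "col_alt a b * emb (a + b) f * row_sum a' b' =
          (emb (a' + b') (gmult (a' + b') (gmult (a' + b') (column_antisymmetrizer [a, b]) f) ?h) :: _ \<Rightarrow>\<^sub>0 'k)"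
        using emb_column_antisymmetrizer[OF assms(2), where ?'k = 'k] N by (simp add: emb_gmult)
    qed
    have "young_idem a b * emb (a + b) f * young_idem a' b' =
        scal (c * c') (row_sum a b * (col_alt a b * emb (a + b) f * row_sum a' b') * col_alt a' b')"
      by (simp add: c c' mult_scal_left mult_scal_right mult.assoc)
    then show ?thesis unfolding g by (simp add: row_col_orthogonal[OF N[symmetric] lt assms(3)])
  qed
qed


section \<open>Double cosets and completeness\<close>

lemma permutes_image_exists:
  assumes "finite U" "A \<subseteq> U" "B \<subseteq> U" "card A = card B"
  shows "\<exists>p. p permutes U \<and> p ` A = B"
proof -
  have fin: "finite A" "finite B" using assms finite_subset by auto
  obtain f where f: "bij_betw f A B" using finite_same_card_bij[OF fin assms(4)] by blast
  have "card (U - A) = card (U - B)" using assms fin by (simp add: card_Diff_subset)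
  then obtain g where g: "bij_betw g (U - A) (U - B)"
    using finite_same_card_bij[of "U - A" "U - B"] assms(1) by auto
  define p where "p x = (if x \<in> A then f x else if x \<in> U then g x else x)" for x
  have pA: "bij_betw p A B"
    using f by (rule bij_betw_cong[THEN iffD1, rotated]) (simp add: p_def)
  have "bij_betw p (U - A) (U - B)"
    using g by (rule bij_betw_cong[THEN iffD1, rotated]) (auto simp: p_def)
  then have "bij_betw p (A \<union> (U - A)) (B \<union> (U - B))"
    using pA by (intro bij_betw_combine) auto
  moreover have "A \<union> (U - A) = U" "B \<union> (U - B) = U" using assms by auto
  ultimately have "bij_betw p U U" by simp
  then have "p permutes U" using assms(2) by (intro bij_imp_permutes) (auto simp: p_def)
  then show ?thesis using pA by (auto simp: bij_betw_def)
qed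

text \<open>The classical invariant of the double cosets of S_m x S_n in S_{m+n}: equal values force
  equal double cosets, and the values lie between 0 and n.\<close>

definition crossing_number :: "nat \<Rightarrow> nat \<Rightarrow> (nat \<Rightarrow> nat) \<Rightarrow> nat" where
  "crossing_number m n w = card (w ` {m..<m + n} \<inter> {..<m})"

text \<open>With equal crossing numbers the images of the last block under \<open>w\<close> and
  \<open>w'\<close> meet each block in equally many points, so some y in S_m x S_n carries one image
  to the other. Then \<open>w'\<close> and y w differ on the right by a permutation preserving the
  last block.\<close>

lemma young_subgroup_move:
  assumes w: "w \<in> Sym (m + n)" and w': "w' \<in> Sym (m + n)"
    and eq: "crossing_number m n w = crossing_number m n w'"
  shows "\<exists>y\<in>young_subgroup m n. inv w' \<circ> (y \<circ> w) \<in> young_subgroup m n"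
proof -
  let ?E = "{..<m}" and ?F = "{m..<m + n}"
  let ?X = "w ` ?F" and ?X' = "w' ` ?F"
  have range: "u ` ?F \<subseteq> ?E \<union> ?F" if u: "u \<in> Sym (m + n)" for u
  proof
    fix x assume "x \<in> u ` ?F"
    then obtain i where "i \<in> ?F" "x = u i" by (rule imageE)
    then have "x < m + n" using Sym_in[OF u, of i] by simp
    then show "x \<in> ?E \<union> ?F" by (cases "x < m") auto
  qed
  note sub = range[OF w] range[OF w']
  have card: "card ?X = n" "card ?X' = n"
    using card_image[OF inj_on_subset[OF bij_is_inj[OF Sym_bij[OF w]] subset_UNIV]]
      card_image[OF inj_on_subset[OF bij_is_inj[OF Sym_bij[OF w']] subset_UNIV]] by simp_all
  have split: "card Z = card (Z \<inter> ?E) + card (Z \<inter> ?F)" if "Z \<subseteq> ?E \<union> ?F" for Z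
  proof -
    have "card Z = card ((Z \<inter> ?E) \<union> (Z \<inter> ?F))"
      by (rule arg_cong[of _ _ card]) (use that in auto)
    also have "\<dots> = card (Z \<inter> ?E) + card (Z \<inter> ?F)"
      by (rule card_Un_disjoint) auto
    finally show ?thesis .
  qed
  have E: "card (?X \<inter> ?E) = card (?X' \<inter> ?E)" using eq by (simp add: crossing_number_def)
  then have F: "card (?X \<inter> ?F) = card (?X' \<inter> ?F)"
    using split[OF sub(1)] split[OF sub(2)] card by simp
  obtain p where p: "p permutes ?E" "p ` (?X \<inter> ?E) = ?X' \<inter> ?E"
    using permutes_image_exists[OF _ _ _ E, of ?E] by auto
  obtain q where q: "q permutes ?F" "q ` (?X \<inter> ?F) = ?X' \<inter> ?F"
    using permutes_image_exists[OF _ _ _ F, of ?F] by auto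
  have fixq: "q x = x" if "x < m" for x using permutes_not_in[OF q(1), of x] that by simp
  have fixp: "p x = x" if "m \<le> x" for x using permutes_not_in[OF p(1), of x] that by simp
  have pE: "p x < m \<longleftrightarrow> x < m" for x using permutes_in_image[OF p(1), of x] by simp
  have qF: "m \<le> q x \<longleftrightarrow> m \<le> x" for x
    using permutes_in_image[OF q(1), of x] permutes_not_in[OF q(1), of x] by (cases "x \<in> ?F") auto
  have qE: "q x < m \<longleftrightarrow> x < m" for x using qF[of x] by linarith
  define y where "y = p \<circ> q"
  have "p permutes {..<m + n}" using p(1) by (rule permutes_subset) auto
  moreover have "q permutes {..<m + n}" using q(1) by (rule permutes_subset) auto
  ultimately have yS: "y \<in> Sym (m + n)" by (simp add: y_def Sym_def permutes_compose)
  have y: "y \<in> young_subgroup m n"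
    using yS pE qE by (simp add: young_subgroup_def y_def)
  have yX: "y x \<in> ?X'" if x: "x \<in> ?X" for x
  proof (cases "x < m")
    case True
    then have "p x \<in> p ` (?X \<inter> ?E)" using x by (intro imageI) auto
    then show ?thesis unfolding p(2) using True by (simp add: y_def fixq)
  next
    case False
    then have "x \<in> ?F" using x sub by auto
    then have "q x \<in> q ` (?X \<inter> ?F)" using x by (intro imageI) auto
    then show ?thesis unfolding q(2) using False qF[of x] fixp[of "q x"] by (simp add: y_def)
  qed
  have "inv w' \<circ> (y \<circ> w) \<in> young_subgroup m n"
  proof (rule young_subgroup_stable)
    show "inv w' \<circ> (y \<circ> w) \<in> Sym (m + n)" using w w' yS by (intro Sym_comp Sym_inv)
    fix i assume "m \<le> i" "i < m + n"
    then have "y (w i) \<in> ?X'" by (intro yX imageI) simp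
    then obtain i' where "i' \<in> ?F" "y (w i) = w' i'" by (rule imageE)
    then show "m \<le> (inv w' \<circ> (y \<circ> w)) i" using Sym_bij[OF w'] by (simp add: bij_is_inj inv_f_f)
  qed
  then show ?thesis using y by blast
qed

lemma block_sym_double_coset:
  assumes w: "w \<in> Sym (m + n)" and w': "w' \<in> Sym (m + n)"
    and eq: "crossing_number m n w = crossing_number m n w'"
  shows "block_sym m n * basis w * block_sym m n = (block_sym m n * basis w' * block_sym m n :: _ \<Rightarrow>\<^sub>0 'k::field_char_0)"
proof -
  obtain y where y: "y \<in> young_subgroup m n" "inv w' \<circ> (y \<circ> w) \<in> young_subgroup m n"
    using young_subgroup_move[OF assms] by blast
  let ?u = "inv w' \<circ> (y \<circ> w)"
  note yS = young_subgroup_Sym[OF y(1)] and uS = young_subgroup_Sym[OF y(2)]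
  have "w' \<circ> ?u = y \<circ> w" using Sym_inv_comp[OF w'] by (simp only: o_assoc id_o)
  then have "basis y * basis w = (basis w' * basis ?u :: _ \<Rightarrow>\<^sub>0 'k)"
    by (simp only: basis_mult_Sym[OF yS w] basis_mult_Sym[OF w' uS])
  then have "block_sym m n * (basis y * basis w) * block_sym m n = (block_sym m n * (basis w' * basis ?u) * block_sym m n :: _ \<Rightarrow>\<^sub>0 'k)"
    by (simp only:)
  then have "(block_sym m n * basis y) * basis w * block_sym m n = (block_sym m n * basis w' * (basis ?u * block_sym m n) :: _ \<Rightarrow>\<^sub>0 'k)"
    by (simp only: mult.assoc)
  then show ?thesis by (simp only: block_sym_absorb[OF y(1)] block_sym_absorb[OF y(2)])
qed

lemma card_block_sym_double_cosets:
  "card ((\<lambda>w. block_sym m n * basis w * block_sym m n :: _ \<Rightarrow>\<^sub>0 'k::field_char_0) ` Sym (m + n)) \<le> Suc n"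
proof -
  let ?g = "\<lambda>w. block_sym m n * basis w * block_sym m n :: _ \<Rightarrow>\<^sub>0 'k"
  \<comment> \<open>A representative for each crossing number that occurs; the values at other
    numbers are arbitrary and can only enlarge the image that is counted.\<close>
  define r where "r k = (SOME w. w \<in> Sym (m + n) \<and> crossing_number m n w = k)" for k
  have "?g ` Sym (m + n) \<subseteq> (\<lambda>k. ?g (r k)) ` {..n}"
  proof
    fix x assume "x \<in> ?g ` Sym (m + n)"
    then obtain w where w: "w \<in> Sym (m + n)" "x = ?g w" by auto
    have "r (crossing_number m n w) \<in> Sym (m + n) \<and>
        crossing_number m n (r (crossing_number m n w)) = crossing_number m n w"
      unfolding r_def by (rule someI[of _ w]) (simp add: w)
    then have "x = ?g (r (crossing_number m n w))"
      using block_sym_double_coset[OF w(1), where ?'k = 'k] w(2) by metis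
    moreover have "crossing_number m n w \<le> n"
      unfolding crossing_number_def
      using card_mono[of "w ` {m..<m + n}" "w ` {m..<m + n} \<inter> {..<m}"] card_image_le[of "{m..<m + n}" w] by simp
    ultimately show "x \<in> (\<lambda>k. ?g (r k)) ` {..n}" by auto
  qed
  then have "card (?g ` Sym (m + n)) \<le> card ((\<lambda>k. ?g (r k)) ` {..n})" by (intro card_mono) auto
  also have "\<dots> \<le> Suc n" using card_image_le[of "{..n}" "\<lambda>k. ?g (r k)"] by simp
  finally show ?thesis .
qed

lemma emb_block_sym:
  "emb (m + n) (\<lambda>w. if w \<in> young_subgroup m n then 1 / (fact m * fact n) else 0) = block_sym m n"
  unfolding block_sym_def by (rule emb_indicator) (auto simp: young_subgroup_Sym)

lemma block_sym_decomposition: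
  assumes nm: "n \<le> m"
  shows "(\<Sum>s\<le>n. scal (of_nat (n choose s)) (block_sym m n * young_idem (m + n - s) s * block_sym m n)) =
    (block_sym m n :: _ \<Rightarrow>\<^sub>0 'k::field_char_0)"
proof -
  let ?h = "block_sym m n :: _ \<Rightarrow>\<^sub>0 'k"
  define e where "e s = (young_idem (m + n - s) s :: _ \<Rightarrow>\<^sub>0 'k)" for s
  define b where "b s = (of_nat (n choose s) :: 'k)" for s
  define p where "p s = scal (b s) (?h * e s * ?h)" for s
  have b: "b s \<noteq> 0" if "s \<le> n" for s using that by (simp add: b_def)
  have ehe: "e s * ?h * e t = (if s = t then scal (1 / b s) (e s) else 0)" if "s \<le> n" "t \<le> n" for s t
  proof (cases "s = t")
    case True
    then show ?thesis using young_idem_block_sym_young_idem[OF that(1) nm, where ?'k = 'k] by (simp add: e_def b_def)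
  next
    case False
    have "?h = emb (m + n - s + s) (\<lambda>w. if w \<in> young_subgroup m n then 1 / (fact m * fact n) else 0)"
      using that by (simp add: emb_block_sym)
    moreover have "s \<le> m + n - s" "t \<le> m + n - t" using that nm by auto
    ultimately show ?thesis
      using young_idem_orthogonal[of "m + n - s" s "m + n - t" t] that False by (simp add: e_def)
  qed
  have hp: "?h * p s = p s" for s
    by (simp add: p_def mult_scal_right mult.assoc[symmetric] block_sym_idem)
  have pp: "p s * p t = (if s = t then p s else 0)" if "s \<le> n" "t \<le> n" for s t
  proof -
    have "p s * p t = scal (b s * b t) (?h * (e s * (?h * ?h) * e t) * ?h)"
      by (simp add: p_def mult_scal_right mult_scal_left mult.assoc)
    also have "\<dots> = scal (b s * b t) (?h * (e s * ?h * e t) * ?h)" by (simp only: block_sym_idem)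
    finally show ?thesis
      unfolding ehe[OF that] using b[OF that(1)] by (auto simp: p_def mult_scal_left mult_scal_right)
  qed
  have p_nonzero: "p s \<noteq> 0" if s: "s \<le> n" for s
  proof
    assume "p s = 0"
    \<comment> \<open>Sandwiching \<open>p s\<close> between two copies of \<open>e s\<close> leaves
      a nonzero multiple of \<open>e s\<close>.\<close>
    then have "scal (b s) (e s * ?h * (e s * ?h * e s)) = 0"
      using arg_cong[of "p s" 0 "\<lambda>x. e s * x * e s"]
      by (simp add: p_def mult_scal_left mult_scal_right mult.assoc)
    then have "e s = 0"
      using b[OF s] ehe[OF s s] by (simp add: mult_scal_left mult_scal_right galg.scale_eq_0_iff)
    then show False using young_idem_nonzero[of s "m + n - s", where ?'k = 'k] s nm by (simp add: e_def)
  qed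
  have inj: "inj_on p {..n}"
    using pp p_nonzero by (intro inj_onI) (metis atMost_iff)
  define D where "D = (\<lambda>w. ?h * basis w * ?h) ` Sym (m + n)"
  have in_span: "?h * emb (m + n) f * ?h \<in> galg.span D" for f
  proof -
    have "?h * emb (m + n) f * ?h = (\<Sum>w\<in>Sym (m + n). scal (f w) (?h * basis w * ?h))"
      by (simp add: emb_def sum_distrib_left sum_distrib_right mult_scal_left mult_scal_right)
    also have "\<dots> \<in> galg.span D"
      by (intro galg.span_sum galg.span_scale galg.span_base) (auto simp: D_def)
    finally show ?thesis .
  qed
  have "p s \<in> galg.span D" if "s \<le> n" for s
    using galg.span_scale[OF in_span[of "young_idempotent [m + n - s, s]"], of "b s"] that
    by (simp add: p_def e_def young_idem_def)
  moreover have "?h \<in> galg.span D"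
  proof -
    have "?h * basis id * ?h \<in> galg.span D"
      by (rule galg.span_base) (auto simp: D_def Sym_def permutes_id)
    then show ?thesis by (simp add: basis_id block_sym_idem)
  qed
  ultimately have sub: "insert ?h (p ` {..n}) \<subseteq> galg.span D" by auto
  have indep: "galg.independent (p ` {..n})"
  proof (rule ccontr)
    assume "\<not> ?thesis"
    then obtain u v where u: "v \<in> p ` {..n}" "u v \<noteq> 0" "(\<Sum>x\<in>p ` {..n}. scal (u x) x) = 0"
      by (auto simp: galg.dependent_finite)
    then obtain t where t: "t \<le> n" "v = p t" by auto
    \<comment> \<open>Multiplying a linear relation by \<open>p t\<close> isolates one
      coefficient.\<close>
    have "0 = (\<Sum>s\<le>n. scal (u (p s)) (p s)) * p t"
      using u(3) inj by (simp add: sum.reindex)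
    also have "\<dots> = (\<Sum>s\<le>n. if s = t then scal (u (p t)) (p t) else 0)"
      unfolding sum_distrib_right using t(1) by (intro sum.cong HOL.refl) (auto simp: mult_scal_left pp)
    also have "\<dots> = scal (u (p t)) (p t)" using t(1) by simp
    finally show False using u(2) t p_nonzero[OF t(1)] by (simp add: galg.scale_eq_0_iff)
  qed
  have "?h \<in> galg.span (p ` {..n})"
  proof (rule ccontr)
    assume notin: "?h \<notin> galg.span (p ` {..n})"
    then have "galg.independent (insert ?h (p ` {..n}))" using indep by (simp add: galg.independent_insert)
    \<comment> \<open>If h were outside the span, h and the \<open>p s\<close> would be n + 2
      independent vectors in the span of at most n + 1 generators.\<close>
    then have "card (insert ?h (p ` {..n})) \<le> card D"
      using galg.independent_span_bound[OF _ _ sub] by (simp add: D_def)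
    moreover have "card (insert ?h (p ` {..n})) = Suc (Suc n)"
      using notin galg.span_base[of ?h "p ` {..n}"] inj by (simp add: card_insert_if card_image) blast
    moreover have "card D \<le> Suc n" unfolding D_def by (rule card_block_sym_double_cosets)
    ultimately show False by simp
  qed
  then obtain u where "?h = (\<Sum>x\<in>p ` {..n}. scal (u x) x)"
    by (auto simp: galg.span_finite)
  then have h: "?h = (\<Sum>s\<le>n. scal (u (p s)) (p s))" using inj by (simp add: sum.reindex)
  \<comment> \<open>h is a left unit for \<open>p t\<close>, which forces every coefficient of h to
    be 1.\<close>
  have "u (p t) = 1" if t: "t \<le> n" for t
  proof -
    have "p t = (\<Sum>s\<le>n. scal (u (p s)) (p s)) * p t" using hp[of t] by (simp add: h[symmetric])
    also have "\<dots> = (\<Sum>s\<le>n. if s = t then scal (u (p t)) (p t) else 0)"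
      unfolding sum_distrib_right using t by (intro sum.cong HOL.refl) (auto simp: mult_scal_left pp)
    also have "\<dots> = scal (u (p t)) (p t)" using t by simp
    finally have "scal (u (p t)) (p t) = scal 1 (p t)" by simp
    then show ?thesis using p_nonzero[OF t] by (simp only: galg.scale_cancel_right) simp
  qed
  then have "?h = (\<Sum>s\<le>n. p s)" using h by simp
  then show ?thesis by (simp add: p_def e_def b_def)
qed


section \<open>Matrices of morphisms and the Karoubi envelope\<close>

lemma galg_mor_comp: "galg_mor r a \<circ>\<^sub>h galg_mor r b = galg_mor r (gmult r a b)"
proof -
  have "galg_mor r a \<circ>\<^sub>h galg_mor r b =
      (\<Sum>u\<in>Sym r. \<Sum>v\<in>Sym r. (a u * b v) *\<^sub>h perm_mor r (u \<circ> v))"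
    unfolding galg_mor_def hcomp_sum_left unfolding hcomp_sum_right
    by (intro sum.cong HOL.refl) (simp add: hcomp_hscale_left hcomp_hscale_right hscale_hscale perm_mor_comp mult.commute)
  also have "\<dots> = (\<Sum>u\<in>Sym r. \<Sum>w\<in>Sym r. (a u * b (inv u \<circ> w)) *\<^sub>h perm_mor r w)"
  proof (rule sum.cong[OF HOL.refl])
    fix u assume u: "u \<in> Sym r"
    show "(\<Sum>v\<in>Sym r. (a u * b v) *\<^sub>h perm_mor r (u \<circ> v)) =
        (\<Sum>w\<in>Sym r. (a u * b (inv u \<circ> w)) *\<^sub>h perm_mor r w)"
      by (rule sum.reindex_bij_witness[of _ "\<lambda>w. inv u \<circ> w" "\<lambda>v. u \<circ> v"])
        (use u in \<open>auto simp: o_assoc Sym_comp Sym_inv\<close>)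
  qed
  also have "\<dots> = galg_mor r (gmult r a b)"
    unfolding galg_mor_def
    by (subst sum.swap) (simp add: gmult_def hscale_sum_left)
  finally show ?thesis .
qed

text \<open>The algebra map \<open>k[S\<^sub>r] \<rightarrow> End(P\<^sup>r)\<close>, as a relation.\<close>

definition represents :: "nat \<Rightarrow> (fperm \<Rightarrow>\<^sub>0 'k::field) \<Rightarrow> 'k hmor \<Rightarrow> bool" where
  "represents r x f \<longleftrightarrow> (\<exists>a. x = emb r a \<and> f = galg_mor r a)"

text \<open>\<open>emb\<close> determines the values on S_r, and \<open>galg_mor\<close> sees no
  others, so the relation is single-valued from algebra elements to morphisms. Equations in the
  algebra are transported by this rule.\<close>

lemma represents_unique: "represents r x f \<Longrightarrow> represents r x g \<Longrightarrow> f = g"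
  unfolding represents_def galg_mor_def using emb_inject by (metis (mono_tags, lifting) sum.cong)

lemma represents_comp: "represents r x f \<Longrightarrow> represents r y g \<Longrightarrow> represents r (x * y) (f \<circ>\<^sub>h g)"
  unfolding represents_def using emb_gmult galg_mor_comp by metis

lemma represents_hscale: "represents r x f \<Longrightarrow> represents r (scal c x) (c *\<^sub>h f)"
proof -
  have "galg_mor r (\<lambda>w. c * a w) = c *\<^sub>h galg_mor r a" for a
    by (simp add: galg_mor_def hscale_sum_right hscale_hscale)
  then show "represents r x f \<Longrightarrow> represents r (scal c x) (c *\<^sub>h f)"
    unfolding represents_def using emb_scal by metis
qed

lemma represents_zero: "represents r 0 0"
  unfolding represents_def by (rule exI[of _ "\<lambda>_. 0"]) (simp add: emb_def galg_mor_def)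

lemma represents_add:
  assumes "represents r x f" "represents r y g"
  shows "represents r (x + y) (f + g)"
proof -
  obtain a b where ab: "x = emb r a" "f = galg_mor r a" "y = emb r b" "g = galg_mor r b"
    using assms unfolding represents_def by auto
  show ?thesis unfolding represents_def ab
    by (rule exI[of _ "\<lambda>w. a w + b w"])
      (simp add: emb_def galg_mor_def galg.scale_left_distrib hscale_add_left sum.distrib)
qed

lemma represents_sum:
  "(\<And>i. i \<in> I \<Longrightarrow> represents r (x i) (f i)) \<Longrightarrow> represents r (\<Sum>i\<in>I. x i) (\<Sum>i\<in>I. f i)"
  by (induction I rule: infinite_finite_induct) (auto intro: represents_zero represents_add)

lemma represents_in_hhom: "represents r x f \<Longrightarrow> f \<in> hhom (Ppow r) (Ppow r)"
  unfolding represents_def galg_mor_def by (auto intro!: hhom_sum hhom_hscale perm_mor_in_hhom)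

lemma represents_e_mor: "represents (a + b) (young_idem a b) (e_mor [a, b])"
  unfolding represents_def young_idem_def e_mor_def by auto

lemma represents_perm_mor:
  assumes "w \<in> Sym r"
  shows "represents r (basis w) (perm_mor r w :: 'k::field hmor)"
  unfolding represents_def
proof (intro exI conjI)
  show "basis w = (emb r (\<lambda>u. if u = w then 1 else 0) :: _ \<Rightarrow>\<^sub>0 'k)"
    using emb_indicator[of "{w}" r "1 :: 'k"] assms by (simp add: gsum_def)
  have "galg_mor r (\<lambda>u. if u = w then 1 else 0) = (\<Sum>u\<in>{w}. perm_mor r u :: 'k hmor)"
    unfolding galg_mor_def by (rule sum.mono_neutral_cong_right) (use assms in auto)
  then show "perm_mor r w = (galg_mor r (\<lambda>u. if u = w then 1 else 0) :: 'k hmor)" by simp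
qed

lemma represents_h_mor_tensor:
  "represents (m + n) (block_sym m n) (h_mor m \<otimes>\<^sub>h h_mor n :: 'k::field_char_0 hmor)"
  unfolding represents_def
proof (intro exI conjI)
  let ?c = "1 / (fact m * fact n) :: 'k"
  show "block_sym m n = emb (m + n) (\<lambda>w. if w \<in> young_subgroup m n then ?c else 0)"
    by (rule emb_block_sym[symmetric])
  have "h_mor m \<otimes>\<^sub>h h_mor n =
      (\<Sum>u\<in>Sym m. \<Sum>v\<in>Sym n. ?c *\<^sub>h perm_mor (m + n) (juxtapose m u v))"
    unfolding h_mor_def galg_mor_def htensor_sum_left unfolding htensor_sum_right
    by (intro sum.cong HOL.refl)
      (simp add: htensor_hscale_left htensor_hscale_right hscale_hscale perm_mor_tensor
        complete_symmetrizer_def mult.commute)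
  also have "\<dots> = (\<Sum>x\<in>Sym m \<times> Sym n. ?c *\<^sub>h perm_mor (m + n) ((\<lambda>(u, v). juxtapose m u v) x))"
    by (simp add: sum.cartesian_product case_prod_beta)
  also have "\<dots> = (\<Sum>w\<in>young_subgroup m n. ?c *\<^sub>h perm_mor (m + n) w)"
    by (rule sum.reindex_bij_betw[OF bij_betw_juxtapose])
  also have "\<dots> = galg_mor (m + n) (\<lambda>w. if w \<in> young_subgroup m n then ?c else 0)"
    unfolding galg_mor_def
    by (rule sum.mono_neutral_cong_left) (auto simp: young_subgroup_Sym)
  finally show "h_mor m \<otimes>\<^sub>h h_mor n = galg_mor (m + n) (\<lambda>w. if w \<in> young_subgroup m n then ?c else 0)" .
qed

section \<open>The permutation crossing two blocks\<close>

lemma block_perm_inverse: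
  "block_perm m n (block_perm n m i) = i"
  by (auto simp: block_perm_def)

lemma block_perm_Sym: "block_perm m n \<in> Sym (m + n)"
proof -
  have "block_perm m n permutes {..<m + n}"
    by (rule permutes_if_inverse[of _ _ "block_perm n m"]) (auto simp: block_perm_inverse, auto simp: block_perm_def)
  then show ?thesis by (simp add: Sym_def)
qed

lemma inv_block_perm: "inv (block_perm m n) = block_perm n m"
  by (rule inv_unique_comp) (auto simp: block_perm_inverse)

lemma block_perm_conj:
  assumes "w \<in> young_subgroup m n"
  shows "block_perm m n \<circ> w \<circ> block_perm n m \<in> young_subgroup n m"
proof -
  have S: "w \<in> Sym (n + m)" "block_perm m n \<in> Sym (n + m)" "block_perm n m \<in> Sym (n + m)"
    using young_subgroup_Sym[OF assms] block_perm_Sym[of m n] block_perm_Sym[of n m]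
    by (simp_all add: add.commute)
  show ?thesis
  proof (rule young_subgroup_stable)
    show "block_perm m n \<circ> w \<circ> block_perm n m \<in> Sym (n + m)" using S by (intro Sym_comp)
    fix i assume "n \<le> i" "i < n + m"
    then have "w (i - n) < m" using assms by (simp add: young_subgroup_def)
    then show "n \<le> (block_perm m n \<circ> w \<circ> block_perm n m) i"
      using \<open>n \<le> i\<close> \<open>i < n + m\<close> by (simp add: block_perm_def)
  qed
qed

text \<open>Crossing the blocks conjugates S_m x S_n into S_n x S_m, which reduces the case m < n to
  the ordered one.\<close>

lemma block_perm_block_sym:
  "basis (block_perm m n) * block_sym m n * basis (block_perm n m) = block_sym n m"
proof -
  note S = block_perm_Sym[of m n] block_perm_Sym[of n m, unfolded add.commute[of n m]]
  have conj: "block_perm n m \<circ> (block_perm m n \<circ> w \<circ> block_perm n m) \<circ> block_perm m n = w" for w m n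
    by (auto simp: block_perm_inverse)
  have "basis (block_perm m n) * row_sum m n * basis (block_perm n m) =
      (\<Sum>w\<in>young_subgroup m n. basis (block_perm m n \<circ> w \<circ> block_perm n m))"
    unfolding gsum_def sum_distrib_left sum_distrib_right
    by (intro sum.cong HOL.refl)
      (simp add: basis_mult_Sym[OF S(1) young_subgroup_Sym] basis_mult_Sym[OF Sym_comp S(2)] S(1) young_subgroup_Sym)
  also have "\<dots> = row_sum n m"
    unfolding gsum_def
  by (rule sum.reindex_bij_witness[of _ "\<lambda>w. block_perm n m \<circ> w \<circ> block_perm m n"
        "\<lambda>w. block_perm m n \<circ> w \<circ> block_perm n m"])
      (auto simp: conj block_perm_conj simp del: o_apply)
  finally show ?thesis by (simp add: block_sym_def mult_scal_left mult_scal_right mult.commute)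
qed

section \<open>Morphisms and direct sums in the Karoubi envelope\<close>

lemma mcomp_entry: "mcomp [X] (entry g) (entry f) = entry (g \<circ>\<^sub>h f)"
  by (auto simp: mcomp_def entry_def fun_eq_iff)

lemma entry_in_mhom: "f \<in> hhom X Y \<Longrightarrow> entry f \<in> mhom [X] [Y]"
  by (auto simp: mhom_def entry_def)

lemma entry_in_khom:
  assumes "e \<in> hhom X X" "e \<circ>\<^sub>h e = e" "e' \<in> hhom Y Y" "e' \<circ>\<^sub>h e' = e'"
    "f \<in> hhom X Y" "f \<circ>\<^sub>h e = f" "e' \<circ>\<^sub>h f = f"
  shows "entry f \<in> khom ([X], entry e) ([Y], entry e')"
  using assms by (simp add: khom_def is_kobj_def mcomp_entry entry_in_mhom)

lemma entry_sum: "entry (\<Sum>i\<in>I. f i) = (\<Sum>i\<in>I. entry (f i))"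
  by (rule ext)+ (simp add: entry_def sum_fun_apply)

lemma ksum_entries:
  "ksum (map (\<lambda>s. ([X s], entry (e s))) ss) =
    (map X ss, \<lambda>i j. if i = j \<and> i < length ss then e (ss ! i) else 0)"
proof (induction ss)
  case Nil
  then show ?case by (simp add: ksum_def kzero_def)
next
  case (Cons s ss)
  then show ?case
    by (auto simp: ksum_def ksum2_def Let_def entry_def fun_eq_iff nth_Cons' Suc_diff_le)
qed

text \<open>The f_i form a column matrix and the g_i a row matrix; \<open>fg\<close> and
  \<open>gf\<close> say that these are mutually inverse, because the identities of the Karoubi
  envelope are the idempotents themselves.\<close>

lemma kiso_ksum:
  assumes h: "h \<in> hhom X X" "h \<circ>\<^sub>h h = h"
    and e: "\<And>i. i < k \<Longrightarrow> e i \<in> hhom X X" "\<And>i. i < k \<Longrightarrow> e i \<circ>\<^sub>h e i = e i"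
    and f: "\<And>i. i < k \<Longrightarrow> f i \<in> hhom X X" "\<And>i. i < k \<Longrightarrow> f i \<circ>\<^sub>h h = f i"
      "\<And>i. i < k \<Longrightarrow> e i \<circ>\<^sub>h f i = f i"
    and g: "\<And>i. i < k \<Longrightarrow> g i \<in> hhom X X" "\<And>i. i < k \<Longrightarrow> g i \<circ>\<^sub>h e i = g i"
      "\<And>i. i < k \<Longrightarrow> h \<circ>\<^sub>h g i = g i"
    and fg: "\<And>i j. i < k \<Longrightarrow> j < k \<Longrightarrow> f i \<circ>\<^sub>h g j = (if i = j then e i else 0)"
    and gf: "(\<Sum>i<k. g i \<circ>\<^sub>h f i) = h"
  shows "([X], entry h) \<cong>\<^sub>k ksum (map (\<lambda>i. ([X], entry (e i))) [0..<k])"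
proof -
  let ?B = "ksum (map (\<lambda>i. ([X], entry (e i))) [0..<k])"
  define D where "D = (\<lambda>i j. if i = j \<and> i < k then e i else 0)"
  have B: "?B = (map (\<lambda>_. X) [0..<k], D)"
    unfolding ksum_entries D_def by (auto simp: fun_eq_iff)
  define F where "F = (\<lambda>i (j :: nat). if j = 0 \<and> i < k then f i else 0)"
  define G where "G = (\<lambda>(i :: nat) j. if i = 0 \<and> j < k then g j else 0)"
  have pick_left: "(\<Sum>j<k. D i j \<circ>\<^sub>h c j) = (if i < k then e i \<circ>\<^sub>h c i else 0)" for i c
  proof -
    have "(\<Sum>j<k. D i j \<circ>\<^sub>h c j) = (\<Sum>j<k. if j = i then e i \<circ>\<^sub>h c i else 0)"
      by (intro sum.cong) (auto simp: D_def)
    then show ?thesis by simp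
  qed
  have pick_right: "(\<Sum>j<k. c j \<circ>\<^sub>h D j i) = (if i < k then c i \<circ>\<^sub>h e i else 0)" for i c
  proof -
    have "(\<Sum>j<k. c j \<circ>\<^sub>h D j i) = (\<Sum>j<k. if j = i then c i \<circ>\<^sub>h e i else 0)"
      by (intro sum.cong) (auto simp: D_def)
    then show ?thesis by simp
  qed
  have DD: "e i \<circ>\<^sub>h D i j = D i j" if "i < k" for i j
    using that e(2) by (simp add: D_def)
  have objA: "is_kobj ([X], entry h)"
    using h by (simp add: is_kobj_def mcomp_entry entry_in_mhom)
  have objB: "is_kobj ?B"
    unfolding B is_kobj_def
  proof (simp, intro conjI)
    show "D \<in> mhom (map (\<lambda>_. X) [0..<k]) (map (\<lambda>_. X) [0..<k])"
      by (auto simp: mhom_def D_def e hhom_zero)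
    show "mcomp (map (\<lambda>_. X) [0..<k]) D D = D"
      by (auto simp: mcomp_def pick_left DD fun_eq_iff) (simp add: D_def)
  qed
  have F: "F \<in> khom ([X], entry h) ?B"
    using objA objB unfolding B khom_def
    by (auto simp: mhom_def F_def mcomp_def entry_def pick_left fun_eq_iff f)
  have G: "G \<in> khom ?B ([X], entry h)"
    using objA objB unfolding B khom_def
    by (auto simp: mhom_def G_def mcomp_def entry_def pick_right fun_eq_iff g)
  have gf': "(\<Sum>x<k. (if x < k then g x else 0) \<circ>\<^sub>h (if x < k then f x else 0)) = h"
    unfolding gf[symmetric] by (rule sum.cong) auto
  have 1: "kcomp ?B G F = kid ([X], entry h)"
    unfolding B kcomp_def kid_def
    by (auto simp: F_def G_def mcomp_def entry_def fun_eq_iff gf gf')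
  have 2: "kcomp ([X], entry h) F G = kid ?B"
    unfolding B kcomp_def kid_def
    by (auto simp: F_def G_def D_def mcomp_def fun_eq_iff fg)
  show ?thesis unfolding kiso_def using F G 1 2 by blast
qed

lemma P_sym_tensor:
  "P_sym m \<otimes>\<^sub>k P_sym n = ([Ppow (m + n)], entry (h_mor m \<otimes>\<^sub>h h_mor n))"
  by (auto simp: P_sym_def ktensor_def Let_def entry_def fun_eq_iff Ppow_simps)

lemma P_part_two: "P_part [a, b] = ([Ppow (a + b)], entry (e_mor [a, b]))"
  by (simp add: P_part_def)

theorem proposition4p8:
  fixes m n :: nat
  shows "(\<forall>s\<le>min n m.
       (iota m n s :: 'k::field_char_0 hmatrix) \<in> khom (P_part [m + n - s, s]) (P_sym m \<otimes>\<^sub>k P_sym n) \<and>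
       (rho m n s :: 'k hmatrix) \<in> khom (P_sym m \<otimes>\<^sub>k P_sym n) (P_part [m + n - s, s])) \<and>
    (\<forall>s\<le>min n m. \<forall>t\<le>min n m.
       kcomp (P_sym m \<otimes>\<^sub>k P_sym n) (rho m n t) (iota m n s :: 'k hmatrix) =
       (if s = t then kid (P_part [m + n - s, s]) else 0)) \<and>
    kid (P_sym m \<otimes>\<^sub>k P_sym n :: 'k kobj) =
      (\<Sum>s=0..min n m. kcomp (P_part [m + n - s, s]) (iota m n s) (rho m n s)) \<and>
    (P_sym m \<otimes>\<^sub>k P_sym n :: 'k kobj) \<cong>\<^sub>k ksum (map (\<lambda>s. P_part [m + n - s, s]) [0..<Suc (min m n)])"
proof -
  \<comment> \<open>The shapes depend on the unordered pair only, so the algebra is done for the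
    sorted pair.\<close>
  define N p q where "N = m + n" and "p = max m n" and "q = min m n"
  have pq: "p + q = N" "q \<le> p" by (auto simp: N_def p_def q_def)
  define X where "X = Ppow N"
  define h where "h = (block_sym m n :: _ \<Rightarrow>\<^sub>0 'k)"
  define h' where "h' = (block_sym p q :: _ \<Rightarrow>\<^sub>0 'k)"
  define e where "e s = (young_idem (N - s) s :: _ \<Rightarrow>\<^sub>0 'k)" for s
  define b where "b s = (of_nat (q choose s) :: 'k)" for s
  \<comment> \<open>In both cases \<open>fi s\<close> is represented by b_s U e_s and
    \<open>fr s\<close> by e_s V. After that only \<open>V * U = h'\<close>,
    \<open>U * h' * V = h\<close> and the absorption laws \<open>hU\<close> are needed, with no
    further distinction of cases.\<close>
  define U where "U = (if n \<le> m then h else h * (basis (block_perm n m) * h'))"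
  define V where "V = (if n \<le> m then h else h' * (basis (block_perm m n) * h))"
  define fi where "fi s = (if m \<ge> n
      then of_nat (n choose s) *\<^sub>h ((h_mor m \<otimes>\<^sub>h h_mor n) \<circ>\<^sub>h e_mor [m + n - s, s])
      else of_nat (m choose s) *\<^sub>h
        ((h_mor m \<otimes>\<^sub>h h_mor n) \<circ>\<^sub>h tau_inv m n \<circ>\<^sub>h (h_mor n \<otimes>\<^sub>h h_mor m) \<circ>\<^sub>h e_mor [m + n - s, s]) :: 'k hmor)" for s
  define fr where "fr s = (if m \<ge> n
      then e_mor [m + n - s, s] \<circ>\<^sub>h (h_mor m \<otimes>\<^sub>h h_mor n)
      else e_mor [m + n - s, s] \<circ>\<^sub>h (h_mor n \<otimes>\<^sub>h h_mor m) \<circ>\<^sub>h tau m n \<circ>\<^sub>h (h_mor m \<otimes>\<^sub>h h_mor n) :: 'k hmor)" for s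
  let ?hm = "h_mor m \<otimes>\<^sub>h h_mor n :: 'k hmor"
  have iota: "iota m n s = entry (fi s)" and rho: "rho m n s = entry (fr s)" for s
    by (simp_all add: iota_def rho_def fi_def fr_def)
  have h_square: "h * h = h" "h' * h' = h'" by (simp_all add: h_def h'_def block_sym_idem)
  have rep_h: "represents N h ?hm" unfolding N_def h_def by (rule represents_h_mor_tensor)
  have rep_e: "represents N (e s) (e_mor [N - s, s])" if "s \<le> q" for s
    using represents_e_mor[of "N - s" s, where ?'a = 'k] that pq by (simp add: e_def)
  have conj: "basis (block_perm m n) * h * basis (block_perm n m) = h'" if "\<not> n \<le> m"
    using that block_perm_block_sym[of m n, where ?'a = 'k] by (simp add: h_def h'_def p_def q_def)
  have conj': "basis (block_perm n m) * h' * basis (block_perm m n) = h" if "\<not> n \<le> m"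
    using that block_perm_block_sym[of n m, where ?'a = 'k] by (simp add: h_def h'_def p_def q_def)
  have rep_fi: "represents N (scal (b s) (U * e s)) (fi s)" if s: "s \<le> q" for s
  proof (cases "n \<le> m")
    case True
    then show ?thesis
      using represents_hscale[OF represents_comp[OF rep_h rep_e[OF s]], of "b s"]
      by (simp add: fi_def U_def b_def q_def N_def)
  next
    case False
    have "represents N (basis (block_perm n m)) (tau_inv m n :: 'k hmor)"
      unfolding tau_inv_def inv_block_perm N_def
      using block_perm_Sym[of n m] by (intro represents_perm_mor) (simp add: add.commute)
    moreover have "represents N h' (h_mor n \<otimes>\<^sub>h h_mor m)"
      using represents_h_mor_tensor[of n m, where ?'k = 'k] False
      by (simp add: N_def h'_def p_def q_def add.commute)
    ultimately have "represents N (h * (basis (block_perm n m) * (h' * e s)))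
        (?hm \<circ>\<^sub>h tau_inv m n \<circ>\<^sub>h (h_mor n \<otimes>\<^sub>h h_mor m) \<circ>\<^sub>h e_mor [N - s, s])"
      using rep_h rep_e[OF s] by (intro represents_comp)
    from represents_hscale[OF this, of "b s"] show ?thesis
      using False by (simp add: fi_def U_def b_def q_def N_def mult.assoc)
  qed
  have rep_fr: "represents N (e s * V) (fr s)" if s: "s \<le> q" for s
  proof (cases "n \<le> m")
    case True
    then show ?thesis
      using represents_comp[OF rep_e[OF s] rep_h] by (simp add: fr_def V_def N_def)
  next
    case False
    have "represents N (basis (block_perm m n)) (tau m n :: 'k hmor)"
      unfolding tau_def N_def by (intro represents_perm_mor block_perm_Sym)
    moreover have "represents N h' (h_mor n \<otimes>\<^sub>h h_mor m)"
      using represents_h_mor_tensor[of n m, where ?'k = 'k] False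
      by (simp add: N_def h'_def p_def q_def add.commute)
    ultimately have "represents N (e s * (h' * (basis (block_perm m n) * h)))
        (e_mor [N - s, s] \<circ>\<^sub>h (h_mor n \<otimes>\<^sub>h h_mor m) \<circ>\<^sub>h tau m n \<circ>\<^sub>h ?hm)"
      using rep_h rep_e[OF s] by (intro represents_comp)
    then show ?thesis using False by (simp add: fr_def V_def N_def)
  qed
  have VU: "V * U = h'"
  proof (cases "n \<le> m")
    case True
    then show ?thesis by (simp add: U_def V_def h_def h'_def p_def q_def block_sym_idem)
  next
    case False
    \<comment> \<open>Conjugation by the block crossing turns h into h', and the three copies of h'
      collapse.\<close>
    have "V * U = h' * (basis (block_perm m n) * (h * h) * basis (block_perm n m)) * h'"
      using False by (simp add: U_def V_def mult.assoc)
    then show ?thesis by (simp only: h_square conj[OF False])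
  qed
  have UV: "U * h' * V = h"
  proof (cases "n \<le> m")
    case True
    then show ?thesis by (simp add: U_def V_def h_def h'_def p_def q_def block_sym_idem)
  next
    case False
    have "U * h' * V = h * (basis (block_perm n m) * (h' * h' * h') * basis (block_perm m n)) * h"
      using False by (simp add: U_def V_def mult.assoc)
    then show ?thesis by (simp only: h_square conj'[OF False])
  qed
  have hU: "h * U = U" "V * h = V" "U * h' = U" "h' * V = V"
  proof -
    have *: "h * (h * x) = h * x" "h' * (h' * x) = h' * x" for x
      by (simp_all only: mult.assoc[symmetric] h_square)
    have "h = h'" if "n \<le> m" using that by (simp add: h_def h'_def p_def q_def)
    then show "h * U = U" "V * h = V" "U * h' = U" "h' * V = V"
      by (auto simp: U_def V_def h_square * mult.assoc)
  qed
  have e_square: "e s * e s = e s" if "s \<le> q" for s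
    using that pq young_idem_idem[of s "N - s", where ?'k = 'k] by (simp add: e_def)
  have ehe: "e t * h' * e s = (if s = t then scal (1 / b s) (e s) else 0)" if "s \<le> q" "t \<le> q" for s t
  proof (cases "s = t")
    case True
    then show ?thesis using young_idem_block_sym_young_idem[of s q p, where ?'k = 'k] that pq by (simp add: e_def b_def h'_def)
  next
    case False
    have "h' = emb (N - t + t) (\<lambda>w. if w \<in> young_subgroup p q then 1 / (fact p * fact q) else 0)"
      using that pq emb_block_sym[of p q, where ?'a = 'k] by (simp add: h'_def)
    moreover have "s \<le> N - s" "t \<le> N - t" using that pq by auto
    ultimately show ?thesis
      using young_idem_orthogonal[of "N - t" t "N - s" s, where ?'k = 'k] False that pq by (simp add: e_def)
  qed
  have rf: "represents N (e t * V * (scal (b s) (U * e s))) (fr t \<circ>\<^sub>h fi s)" if "s \<le> q" "t \<le> q" for s t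
    by (intro represents_comp rep_fr rep_fi that)
  have fr_fi: "fr t \<circ>\<^sub>h fi s = (if s = t then e_mor [N - s, s] else 0)" if st: "s \<le> q" "t \<le> q" for s t
  proof -
    \<comment> \<open>The inner product V U is h', which reduces the composite to products e_t h'
      e_s of Young idempotents.\<close>
    have "e t * V * scal (b s) (U * e s) = scal (b s) (e t * (V * U) * e s)"
      by (simp add: mult_scal_right mult.assoc)
    also have "\<dots> = (if s = t then e s else 0)"
      using st by (simp add: VU ehe b_def)
    finally have "represents N (if s = t then e s else 0) (fr t \<circ>\<^sub>h fi s)" using rf[OF st] by simp
    then show ?thesis
      using rep_e[OF st(1)] represents_zero[of N, where ?'a = 'k] by (auto intro: represents_unique split: if_splits)
  qed
  have sum: "(\<Sum>s\<le>q. fi s \<circ>\<^sub>h fr s) = ?hm"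
  proof (rule represents_unique[OF _ rep_h])
    have "represents N (\<Sum>s\<le>q. scal (b s) (U * e s) * (e s * V)) (\<Sum>s\<le>q. fi s \<circ>\<^sub>h fr s)"
      by (intro represents_sum represents_comp rep_fi rep_fr) auto
    also have "(\<Sum>s\<le>q. scal (b s) (U * e s) * (e s * V)) = U * (\<Sum>s\<le>q. scal (b s) (h' * e s * h')) * V"
      unfolding sum_distrib_left sum_distrib_right
    proof (intro sum.cong HOL.refl)
      fix s assume "s \<in> {..q}"
      then have "scal (b s) (U * e s) * (e s * V) = scal (b s) (U * (e s * e s) * V)"
        by (simp add: mult_scal_left mult.assoc)
      \<comment> \<open>\<open>U\<close> and \<open>V\<close> absorb h', so copies of it can be
        inserted to produce a summand of the decomposition of h'.\<close>
      also have "\<dots> = scal (b s) ((U * h') * e s * (h' * V))"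
        using \<open>s \<in> {..q}\<close> by (simp add: e_square hU)
      finally show "scal (b s) (U * e s) * (e s * V) = U * scal (b s) (h' * e s * h') * V"
        by (simp add: mult_scal_left mult_scal_right mult.assoc)
    qed
    also have "(\<Sum>s\<le>q. scal (b s) (h' * e s * h')) = h'"
      using block_sym_decomposition[OF pq(2), where ?'k = 'k] pq(1) by (simp add: h'_def e_def b_def)
    finally show "represents N h (\<Sum>s\<le>q. fi s \<circ>\<^sub>h fr s)" unfolding UV .
  qed
  have h_idem: "?hm \<circ>\<^sub>h ?hm = ?hm"
    using represents_comp[OF rep_h rep_h] rep_h unfolding h_square by (rule represents_unique)
  have e_idem: "e_mor [N - s, s] \<circ>\<^sub>h e_mor [N - s, s] = (e_mor [N - s, s] :: 'k hmor)" if "s \<le> q" for s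
    using represents_comp[OF rep_e rep_e, OF that that] rep_e[OF that] unfolding e_square[OF that]
    by (rule represents_unique)
  have fi_e: "fi s \<circ>\<^sub>h e_mor [N - s, s] = fi s" if "s \<le> q" for s
  proof (rule represents_unique[OF _ rep_fi[OF that]])
    show "represents N (scal (b s) (U * e s)) (fi s \<circ>\<^sub>h e_mor [N - s, s])"
      using represents_comp[OF rep_fi rep_e, OF that that] by (simp add: mult_scal_left mult.assoc e_square that)
  qed
  have h_fi: "?hm \<circ>\<^sub>h fi s = fi s" if "s \<le> q" for s
  proof (rule represents_unique[OF _ rep_fi[OF that]])
    show "represents N (scal (b s) (U * e s)) (?hm \<circ>\<^sub>h fi s)"
      using represents_comp[OF rep_h rep_fi[OF that]]
      by (simp add: mult_scal_right mult.assoc[symmetric] hU)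
  qed
  have fr_h: "fr s \<circ>\<^sub>h ?hm = fr s" if "s \<le> q" for s
  proof (rule represents_unique[OF _ rep_fr[OF that]])
    show "represents N (e s * V) (fr s \<circ>\<^sub>h ?hm)"
      using represents_comp[OF rep_fr[OF that] rep_h] by (simp add: mult.assoc hU)
  qed
  have e_fr: "e_mor [N - s, s] \<circ>\<^sub>h fr s = fr s" if "s \<le> q" for s
  proof (rule represents_unique[OF _ rep_fr[OF that]])
    show "represents N (e s * V) (e_mor [N - s, s] \<circ>\<^sub>h fr s)"
      using represents_comp[OF rep_e rep_fr, OF that that] by (simp add: mult.assoc[symmetric] e_square that)
  qed
  note hom = represents_in_hhom[OF rep_h, folded X_def] represents_in_hhom[OF rep_e, folded X_def]
    represents_in_hhom[OF rep_fi, folded X_def] represents_in_hhom[OF rep_fr, folded X_def]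
  have A: "P_sym m \<otimes>\<^sub>k P_sym n = ([X], entry ?hm)"
    by (simp add: P_sym_tensor X_def N_def)
  have B: "P_part [m + n - s, s] = ([X], entry (e_mor [N - s, s] :: 'k hmor))" if "s \<le> q" for s
    using that pq by (simp add: P_part_two X_def N_def)
  have q: "min n m = q" "min m n = q" by (simp_all add: q_def min.commute)
  show ?thesis unfolding q A
  proof (intro conjI allI impI)
    fix s assume s: "s \<le> q"
    show "iota m n s \<in> khom (P_part [m + n - s, s]) ([X], entry ?hm)"
      unfolding B[OF s] iota using s by (intro entry_in_khom hom e_idem h_idem fi_e h_fi)
    show "rho m n s \<in> khom ([X], entry ?hm) (P_part [m + n - s, s])"
      unfolding B[OF s] rho using s by (intro entry_in_khom hom e_idem h_idem fr_h e_fr)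
    fix t assume t: "t \<le> q"
    have "entry (0 :: 'k hmor) = 0" by (simp add: entry_def fun_eq_iff)
    then show "kcomp ([X], entry ?hm) (rho m n t) (iota m n s) =
        (if s = t then kid (P_part [m + n - s, s]) else 0)"
      by (cases "s = t") (simp_all add: fr_fi[OF s t] fr_fi[OF t t] B[OF t] iota rho kcomp_def kid_def mcomp_entry)
  next
    have "(\<Sum>s = 0..q. kcomp (P_part [m + n - s, s]) (iota m n s) (rho m n s)) =
        (\<Sum>s\<le>q. entry (fi s \<circ>\<^sub>h fr s))"
      unfolding atLeast0AtMost
      by (intro sum.cong HOL.refl) (simp add: B iota rho kcomp_def mcomp_entry)
    also have "\<dots> = entry ?hm" by (simp only: entry_sum[symmetric] sum)
    finally show "kid ([X], entry ?hm) =
        (\<Sum>s = 0..q. kcomp (P_part [m + n - s, s]) (iota m n s) (rho m n s))"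
      by (simp add: kid_def)
  next
    have "([X], entry ?hm) \<cong>\<^sub>k ksum (map (\<lambda>s. ([X], entry (e_mor [N - s, s] :: 'k hmor))) [0..<Suc q])"
      by (rule kiso_ksum[where f = fr and g = fi])
        (auto simp: less_Suc_eq_le hom h_idem e_idem fi_e h_fi fr_h e_fr fr_fi sum lessThan_Suc_atMost)
    moreover have "map (\<lambda>s. P_part [m + n - s, s] :: 'k kobj) [0..<Suc q] =
        map (\<lambda>s. ([X], entry (e_mor [N - s, s]))) [0..<Suc q]"
      using B by (intro map_cong HOL.refl) auto
    ultimately show "([X], entry ?hm) \<cong>\<^sub>k ksum (map (\<lambda>s. P_part [m + n - s, s]) [0..<Suc q])"
      by (simp only:)
  qed
qed

end
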